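(* Fix $q\in[0,1)$ and let $Y_q=\mathrm{RW}(\mathcal{X}_q)$ be the redwood tree of a two-sided infinite Mallows permutation $\mathcal{X}_q$ with parameter $q$. For $k\in\mathbb{Z}$ let $Y_q(k)=Y_q\cap 1^k0\mathbb{T}$. Then the sizes $(|Y_q(k)|)_{k\in\mathbb{Z}}$ are independent, with $|Y_q(k)|\sim\mathrm{Geom}_0(1-q)$ for $k\neq0$ and $|Y_q(0)|\sim\mathrm{SBGeom}(1-q)$; moreover, conditionally on the sizes, the trees $(Y_q(k))_{k\in\mathbb{Z}}$ are independent and for every $n\ge0$ and every binary tree $t\subseteq\mathbb{T}$ with $|t|=n$, $$\mathbb{P}\big(Y_q(k)=1^k0t\ \big|\ |Y_q(k)|=n\big)=\mathbb{P}\big(\mathrm{BST}(\Pi_n)=t\big),$$ where $\Pi_n$ is $\pi_{n,q}$-distributed. Conversely, these properties fully characterize the distribution of $Y_q$.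
   Context: Geometric laws: $G\sim\mathrm{Geom}_0(p)$ means $\mathbb{P}(G=k)=(1-p)^kp$ for $k\ge0$; $G\sim\mathrm{SBGeom}(p)$ means $\mathbb{P}(G=k)=(k+1)(1-p)^kp^2$ for $k\ge0$. Mallows distribution: $\pi_{n,q}(\sigma)=q^{\mathrm{Inv}(\sigma)}/Z_{n,q}$ on $S_n$, $\mathrm{Inv}(\sigma)=|\{i<j:\sigma(i)>\sigma(j)\}|$, $0^0=1$. A Mallows permutation on $\mathbb{N}$ with parameter $q$ is $(I_1,I_2,\dots)$ where, for independent Bernoulli$(1-q)$ variables $(B_{i,j})_{i,j\ge1}$, $I_i=\min\{j\notin\{I_1,\dots,I_{i-1}\}:B_{i,j}=1\}$. Binary trees: $\mathbb{T}$ is the set of finite words over $\{0,1\}$ with empty word $\varnothing$; $aS=\{aw:w\in S\}$. For a finite sequence $x=(x_1,\dots,x_n)$ of distinct numbers, $\mathrm{BST}(x)=\emptyset$ if $n=0$, else $\mathrm{BST}(x)=\{\varnothing\}\cup0\,\mathrm{BST}(x_-)\cup1\,\mathrm{BST}(x_+)$, with $x_-$ (resp. $x_+$) the subsequence of entries smaller (resp. larger) than $x_1$ in original order; $\mathrm{BST}(\sigma)=\mathrm{BST}(\sigma(1),\dots,\sigma(n))$. A binary tree is a prefix-closed subset of $\mathbb{T}$. Extended words: add a letter $\Upsilon$ with convention $1^k=1\cdots1$ ($k$ letters) for $k>0$, $1^0=\varnothing$, $1^k=\Upsilon^{|k|}$ for $k<0$. Redwood tree: an injective $\sigma:\mathbb{Z}\to\mathbb{Z}$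 is admissible if $|\{i\in\mathbb{N}:\sigma(i)\notin\mathbb{N}\}|+|\{i\in\mathbb{Z}\setminus\mathbb{N}:\sigma(i)\in\mathbb{N}\}|<\infty$. A record index is $r$ with $\sigma(r)>\sigma(k)$ for all $k<r$; the standard record representation is the increasing enumeration $(r_k)_{k\in\mathbb{Z}}$ of all record indices with $\sigma(r_0)\le0<\sigma(r_1)$. $\sigma[k]$ is the sequence of values $\sigma(i)$ with $\sigma(r_k)<\sigma(i)<\sigma(r_{k+1})$ in increasing order of $i$. $\mathrm{RW}(\sigma)=\bigcup_{k\in\mathbb{Z}}(\{1^k\}\cup1^k0\,\mathrm{BST}(\sigma[k]))$. Two-sided Mallows permutation: $\Pi_+,\Pi_-$ independent Mallows permutations on $\mathbb{N}$; $(M_i)_{i\ge1}$ independent, $\mathbb{P}(M_i=m)=q^{im}(1-q^i)$; $\Lambda_1\ge\Lambda_2\ge\dots\ge0$ with $|\{j:\Lambda_j=i\}|=M_i$ for $i\ge1$; $\ell_i=i-\Lambda_i$; $k_0>k_{-1}>\dots$ enumerate $\mathbb{Z}\setminus\{\ell_i\}$; $\mathcal{X}_q(\ell_i)=\Pi_+(i)$, $\mathcal{X}_q(k_i)=1-\Pi_-(1-i)$ ($i\le0$). It is a.s. admissible. *)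

theory Defs
  imports "HOL-Probability.Probability"
begin

definition geom0_pmf :: "real \<Rightarrow> nat \<Rightarrow> real" where
  "geom0_pmf p k = (1 - p) ^ k * p"

definition sbgeom_pmf :: "real \<Rightarrow> nat \<Rightarrow> real" where
  "sbgeom_pmf p k = real (k + 1) * (1 - p) ^ k * p ^ 2"

definition inversions :: "nat \<Rightarrow> (nat \<Rightarrow> nat) \<Rightarrow> nat" where
  "inversions n \<sigma> = card {(i, j). 1 \<le> i \<and> i < j \<and> j \<le> n \<and> \<sigma> i > \<sigma> j}"

definition mallows_Z :: "nat \<Rightarrow> real \<Rightarrow> real" where
  "mallows_Z n q = (\<Sum>\<sigma> \<in> {\<sigma>. \<sigma> permutes {1..n}}. q ^ inversions n \<sigma>)"

definition mallows_pmf :: "nat \<Rightarrow> real \<Rightarrow> (nat \<Rightarrow> nat) \<Rightarrow> real" where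
  "mallows_pmf n q \<sigma> = (if \<sigma> permutes {1..n} then q ^ inversions n \<sigma> / mallows_Z n q else 0)"

datatype letter = L0 | L1 | Ups

type_synonym word = "letter list"

definition bin_words :: "word set" where
  "bin_words = {w. set w \<subseteq> {L0, L1}}"

definition is_bintree :: "word set \<Rightarrow> bool" where
  "is_bintree t \<longleftrightarrow> t \<subseteq> bin_words \<and> (\<forall>u v. u @ v \<in> t \<longrightarrow> u \<in> t)"

definition one_pow :: "int \<Rightarrow> word" where
  "one_pow k = (if 0 \<le> k then replicate (nat k) L1 else replicate (nat (- k)) Ups)"

fun bst :: "'a::linorder list \<Rightarrow> word set" where
  "bst [] = {}"
| "bst (x # xs) = {[]} \<union> (\<lambda>w. L0 # w) ` bst (filter (\<lambda>y. y < x) xs)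
                         \<union> (\<lambda>w. L1 # w) ` bst (filter (\<lambda>y. x < y) xs)"

definition mallows_bst_prob :: "real \<Rightarrow> nat \<Rightarrow> word set \<Rightarrow> real" where
  "mallows_bst_prob q n t =
     (\<Sum>\<sigma> \<in> {\<sigma>. \<sigma> permutes {1..n} \<and> bst (map \<sigma> [1..<n+1]) = t}. mallows_pmf n q \<sigma>)"

definition records :: "(int \<Rightarrow> int) \<Rightarrow> int set" where
  "records \<sigma> = {r. \<forall>k<r. \<sigma> k < \<sigma> r}"

definition rec_enum :: "(int \<Rightarrow> int) \<Rightarrow> int \<Rightarrow> int" where
  "rec_enum \<sigma> = (THE r. strict_mono r \<and> range r = records \<sigma> \<and> \<sigma> (r 0) \<le> 0 \<and> 0 < \<sigma> (r 1))"

definition seg :: "(int \<Rightarrow> int) \<Rightarrow> int \<Rightarrow> int list" where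
  "seg \<sigma> k = (let r = rec_enum \<sigma> in
     map \<sigma> (sorted_list_of_set {i. \<sigma> (r k) < \<sigma> i \<and> \<sigma> i < \<sigma> (r (k + 1))}))"

definition RW :: "(int \<Rightarrow> int) \<Rightarrow> word set" where
  "RW \<sigma> = (\<Union>k. {one_pow k} \<union> (\<lambda>w. one_pow k @ L0 # w) ` bst (seg \<sigma> k))"

definition Ypart :: "word set \<Rightarrow> int \<Rightarrow> word set" where
  "Ypart Y k = {w \<in> Y. \<exists>v \<in> bin_words. w = one_pow k @ L0 # v}"

fun mall_list :: "(nat \<Rightarrow> nat \<Rightarrow> bool) \<Rightarrow> nat \<Rightarrow> nat list" where
  "mall_list B 0 = []"
| "mall_list B (Suc n) = (let xs = mall_list B n in
      xs @ [LEAST j. 1 \<le> j \<and> j \<notin> set xs \<and> B (Suc n) j])"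

definition mallows_perm :: "(nat \<Rightarrow> nat \<Rightarrow> bool) \<Rightarrow> nat \<Rightarrow> nat" where
  "mallows_perm B i = last (mall_list B i)"

definition tailsum :: "(nat \<Rightarrow> nat) \<Rightarrow> nat \<Rightarrow> nat" where
  "tailsum mv i = (\<Sum>i' \<in> {i'. i \<le> i' \<and> mv i' \<noteq> 0}. mv i')"

text \<open>Lambda_j: the j-th largest entry of the multiset with M_i copies of i (0 if none).\<close>
definition Lam :: "(nat \<Rightarrow> nat) \<Rightarrow> nat \<Rightarrow> nat" where
  "Lam mv j = card {i. 1 \<le> i \<and> j \<le> tailsum mv i}"

definition ell :: "(nat \<Rightarrow> nat) \<Rightarrow> nat \<Rightarrow> int" where
  "ell mv i = int i - int (Lam mv i)"

definition two_sided_mallows ::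
  "(nat \<Rightarrow> nat \<Rightarrow> bool) \<Rightarrow> (nat \<Rightarrow> nat \<Rightarrow> bool) \<Rightarrow> (nat \<Rightarrow> nat) \<Rightarrow> int \<Rightarrow> int" where
  "two_sided_mallows Bp Bm mv z =
     (let L = ell mv ` {1..} in
      if z \<in> L then int (mallows_perm Bp (THE i. 1 \<le> i \<and> ell mv i = z))
      else 1 - int (mallows_perm Bm (1 + card {w. w \<notin> L \<and> z < w})))"

datatype drv_idx = BP nat nat | BM nat nat | MV nat

definition drv_index_set :: "drv_idx set" where
  "drv_index_set = {BP i j | i j. 1 \<le> i \<and> 1 \<le> j} \<union> {BM i j | i j. 1 \<le> i \<and> 1 \<le> j}
                   \<union> {MV i | i. 1 \<le> i}"

definition Yq :: "(drv_idx \<Rightarrow> 'a \<Rightarrow> nat) \<Rightarrow> 'a \<Rightarrow> word set" where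
  "Yq Z \<omega> = RW (two_sided_mallows (\<lambda>i j. Z (BP i j) \<omega> = 1) (\<lambda>i j. Z (BM i j) \<omega> = 1)
                                  (\<lambda>i. Z (MV i) \<omega>))"

definition tree_space :: "word set measure" where
  "tree_space = sigma UNIV (range (\<lambda>w. {S. w \<in> S}))"

definition redwood_props :: "real \<Rightarrow> 'b measure \<Rightarrow> ('b \<Rightarrow> word set) \<Rightarrow> bool" where
  "redwood_props q N Y \<longleftrightarrow>
     Y \<in> measurable N tree_space \<and>
     prob_space.indep_vars N (\<lambda>_. count_space UNIV) (\<lambda>k \<omega>. card (Ypart (Y \<omega>) k)) UNIV \<and>
     (\<forall>k n. k \<noteq> 0 \<longrightarrow> measure N {\<omega> \<in> space N. card (Ypart (Y \<omega>) k) = n} = geom0_pmf (1 - q) n) \<and>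
     (\<forall>n. measure N {\<omega> \<in> space N. card (Ypart (Y \<omega>) 0) = n} = sbgeom_pmf (1 - q) n) \<and>
     (\<forall>(K :: int set) (L :: int set) (t :: int \<Rightarrow> word set) (m :: int \<Rightarrow> nat).
        finite K \<and> finite L \<and> (\<forall>k \<in> K. is_bintree (t k) \<and> finite (t k)) \<longrightarrow>
        measure N {\<omega> \<in> space N. (\<forall>k \<in> K. Ypart (Y \<omega>) k = (\<lambda>w. one_pow k @ L0 # w) ` t k)
                                 \<and> (\<forall>k \<in> L. card (Ypart (Y \<omega>) k) = m k)}
        = measure N {\<omega> \<in> space N. (\<forall>k \<in> K. card (Ypart (Y \<omega>) k) = card (t k))
                                 \<and> (\<forall>k \<in> L. card (Ypart (Y \<omega>) k) = m k)}
          * (\<Prod>k \<in> K. mallows_bst_prob q (card (t k)) (t k)))"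

end

theory Submission
  imports Defs
begin

text \<open>
  For a value \<open>z\<close> of the two-sided Mallows permutation \<open>\<sigma>\<close>, let \<open>c z\<close> be the number of larger values
  that precede \<open>z\<close>. The key fact is that the \<open>c z\<close>, for \<open>z\<close> ranging over all integers, are independent
  geometric variables. For positive \<open>z\<close> this holds because a Mallows permutation of the positive
  integers is inverted by transposing its Bernoulli array, so that prescribing \<open>c 1, \<dots>, c n\<close> is a
  cylinder event. For \<open>z \<le> 0\<close>, the dual code (smaller values that follow \<open>z\<close>) is independent
  geometric, and the set of positions of positive values is a particle configuration \<open>L\<close> of weight
  proportional to \<open>q\<close> to the number of particle-hole inversions of \<open>L\<close>. Moving the values \<open>0, -1, \<dots>\<close>
  one at a time from the negative to the positive side turns (configuration, dual code) bijectively
  into (configuration, code) and preserves the total exponent of \<open>q\<close>.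

  The record values of \<open>\<sigma>\<close> are the zeros of \<open>c\<close>. Hence the gaps between consecutive records are
  geometric and the gap that straddles the cut at 0 is size-biased. The order in which the values of
  a gap appear is a function of the codes in that gap; the codes that yield a given order \<open>xs\<close> are
  parametrised by nondecreasing sequences, with \<open>q\<close>-weight \<open>q\<close> to the number of inversions of \<open>xs\<close>
  times a factor independent of \<open>xs\<close>, which is the finite Mallows law.
\<close>

section \<open>Counting in linear orders\<close>

text \<open>The obstacle lies at the values \<le> 0. Records need the larger values that precede,
  and for a value \<le> 0 these include positive values, so its code entry mixes the particle
  configuration with both one-sided permutations; only the dual code has an immediate law there. The
  exchange of codes rests on one identity: turning the particle \<open>k\<close> of \<open>L\<close>
  into a hole changes \<open>energy\<close> by (particles left of \<open>k\<close>) - (holes right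
  of \<open>k\<close>), which is the code entry minus the dual code entry of the value placed at
  \<open>k\<close>. After \<open>V\<close> moves the configuration still has weight
  \<open>C * q ^ energy L\<close>, now at charge \<open>V\<close>. Translation shows that these
  weights have total mass one at every charge, so the Euler product \<open>C\<close> is never
  evaluated; the sum over offsets in the finite Mallows law is identified by total mass too. The
  size bias is a count: a window of prescribed patterns has the same probability wherever it is
  placed, and a gap of \<open>n\<close> values can straddle the cut in \<open>n + 1\<close> ways.
  For the converse, an infinite part has \<open>card\<close> 0, so finiteness of the parts of
  \<open>W\<close> must come from the law: the weights of finite trees already exhaust the
  mass.\<close>

lemma card_below_inj:
  fixes S :: "'a::linorder set"
  assumes "x \<in> S" "y \<in> S" "finite {s\<in>S. s < x}" "finite {s\<in>S. s < y}"
    "card {s\<in>S. s < x} = card {s\<in>S. s < y}"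
  shows "x = y"
proof -
  have *: "card {s\<in>S. s < u} < card {s\<in>S. s < v}"
    if "u < v" "u \<in> S" "finite {s\<in>S. s < v}" for u v
    by (rule psubset_card_mono) (use that in auto)
  show ?thesis
    using *[of x y] *[of y x] assms by (cases x y rule: linorder_cases) auto
qed

lemma card_above_inj:
  fixes S :: "'a::linorder set"
  assumes "x \<in> S" "y \<in> S" "finite {s\<in>S. x < s}" "finite {s\<in>S. y < s}"
    "card {s\<in>S. x < s} = card {s\<in>S. y < s}"
  shows "x = y"
proof -
  have *: "card {s\<in>S. v < s} < card {s\<in>S. u < s}"
    if "u < v" "v \<in> S" "finite {s\<in>S. u < s}" for u v
    by (rule psubset_card_mono) (use that in auto)
  show ?thesis
    using *[of x y] *[of y x] assms by (cases x y rule: linorder_cases) auto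
qed

lemma card_below_enumerate:
  fixes S :: "nat set"
  assumes "infinite S"
  shows "card {s\<in>S. s < enumerate S a} = a"
proof -
  have "{s\<in>S. s < enumerate S a} = enumerate S ` {..<a}"
    using assms enumerate_Ex[OF assms] by (auto simp: enumerate_in_set) (metis enumerate_mono_iff imageI lessThan_iff)
  then show ?thesis
    using inj_enumerate[OF assms] by (simp add: card_image inj_on_subset)
qed

section \<open>One-sided Mallows permutations\<close>

lemma mall_list_conv: "mall_list B n = map (mallows_perm B) [1..<Suc n]"
proof (induction n)
  case (Suc n)
  have "mallows_perm B (Suc n) = (LEAST j. 1 \<le> j \<and> j \<notin> set (mall_list B n) \<and> B (Suc n) j)"
    by (simp add: mallows_perm_def Let_def)
  then have "mall_list B (Suc n) = mall_list B n @ [mallows_perm B (Suc n)]"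
    by (simp add: Let_def)
  then show ?case using Suc by simp
qed simp

lemma mallows_perm_rec:
  assumes "1 \<le> n"
  shows "mallows_perm B n = (LEAST j. 1 \<le> j \<and> j \<notin> mallows_perm B ` {1..<n} \<and> B n j)"
proof -
  obtain m where m: "n = Suc m" using assms by (cases n) auto
  have "set (mall_list B m) = mallows_perm B ` {1..<n}"
    unfolding mall_list_conv m by (simp only: set_map set_upt)
  then show ?thesis
    unfolding m by (simp add: mallows_perm_def Let_def)
qed

text \<open>Infinitely many successes in every row and every column, so that the greedy rule never
  stalls, neither for the array nor for its transpose.\<close>

definition rich :: "(nat \<Rightarrow> nat \<Rightarrow> bool) \<Rightarrow> bool" where
  "rich B \<longleftrightarrow> (\<forall>i\<ge>1. infinite {j. B i j}) \<and> (\<forall>j\<ge>1. infinite {i. B i j})"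

abbreviation (input) flip :: "(nat \<Rightarrow> nat \<Rightarrow> bool) \<Rightarrow> nat \<Rightarrow> nat \<Rightarrow> bool" where
  "flip B \<equiv> \<lambda>i j. B j i"

lemma rich_flip: "rich B \<Longrightarrow> rich (flip B)"
  unfolding rich_def by blast

lemma mallows_perm_props:
  assumes "rich B" "1 \<le> n"
  shows "1 \<le> mallows_perm B n" "mallows_perm B n \<notin> mallows_perm B ` {1..<n}"
    "B n (mallows_perm B n)"
    "\<And>j. 1 \<le> j \<Longrightarrow> j \<notin> mallows_perm B ` {1..<n} \<Longrightarrow> B n j \<Longrightarrow> mallows_perm B n \<le> j"
proof -
  let ?P = "\<lambda>j. 1 \<le> j \<and> j \<notin> mallows_perm B ` {1..<n} \<and> B n j"
  have "infinite ({j. B n j} - (insert 0 (mallows_perm B ` {1..<n})))"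
    using assms by (intro Diff_infinite_finite) (auto simp: rich_def)
  then obtain j where "j \<in> {j. B n j} - (insert 0 (mallows_perm B ` {1..<n}))"
    by (meson finite.emptyI finite_subset subsetI)
  then have "?P j" by auto
  then have "\<exists>j. ?P j" by blast
  then have "?P (LEAST j. ?P j)" by (rule LeastI_ex)
  then show "1 \<le> mallows_perm B n" "mallows_perm B n \<notin> mallows_perm B ` {1..<n}"
    "B n (mallows_perm B n)"
    unfolding mallows_perm_rec[OF assms(2), of B, symmetric] by auto
  show "\<And>j. 1 \<le> j \<Longrightarrow> j \<notin> mallows_perm B ` {1..<n} \<Longrightarrow> B n j \<Longrightarrow> mallows_perm B n \<le> j"
    unfolding mallows_perm_rec[OF assms(2), of B] by (rule Least_le) auto
qed

lemma mallows_perm_inj: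
  assumes "rich B" "1 \<le> m" "1 \<le> n" "mallows_perm B m = mallows_perm B n"
  shows "m = n"
  using mallows_perm_props(2)[OF assms(1,2)] mallows_perm_props(2)[OF assms(1,3)] assms
  by (metis atLeastLessThan_iff imageI linorder_neqE_nat)

text \<open>The greedy rule can be run value by value instead of position by position.\<close>

lemma mallows_perm_flip:
  assumes B: "rich B" and v: "1 \<le> v"
  shows "mallows_perm B (mallows_perm (flip B) v) = v"
  using v
proof (induction v rule: less_induct)
  case (less v)
  define f where "f = mallows_perm B"
  define t where "t = mallows_perm (flip B)"
  have IH: "f (t u) = u" if "1 \<le> u" "u < v" for u
    using less that by (simp add: f_def t_def)
  note fp = mallows_perm_props[OF B, folded f_def]
  note tp = mallows_perm_props[OF rich_flip[OF B], folded t_def]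
  have i: "1 \<le> t v" using tp less.prems by blast
  \<comment> \<open>If \<open>v\<close> were taken at an earlier position \<open>i\<close>, then
    \<open>B i v\<close> holds, so the transposed rule can have skipped \<open>i\<close> only
    because a smaller value \<open>u\<close> owns it; by induction \<open>f i = u\<close>, not
    \<open>v\<close>.\<close>
  have "v \<notin> f ` {1..<t v}"
  proof
    assume "v \<in> f ` {1..<t v}"
    then obtain i where i: "1 \<le> i" "i < t v" "f i = v" by auto
    then have "B i v" using fp(3)[of i] by simp
    then have "i \<in> t ` {1..<v}" using tp(4)[OF less.prems i(1)] i(2) by auto
    then obtain u where "1 \<le> u" "u < v" "i = t u" by auto
    then show False using IH[of u] i(3) by simp
  qed
  then have le: "f (t v) \<le> v"
    using fp(4)[OF i less.prems] tp(3)[OF less.prems] by blast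
  \<comment> \<open>A smaller value \<open>u\<close> at position \<open>t v\<close> also sits at
    \<open>t u\<close> by induction, so \<open>t\<close> would repeat a position.\<close>
  moreover have "\<not> f (t v) < v"
  proof
    assume lt: "f (t v) < v"
    define u where "u = f (t v)"
    have u: "1 \<le> u" "u < v" using lt fp(1)[OF i] by (auto simp: u_def)
    have "f (t u) = f (t v)" using IH[OF u] by (simp add: u_def)
    then have "t u = t v"
      using mallows_perm_inj[OF B tp(1)[OF u(1)] i] by (simp add: f_def)
    then show False using tp(2)[OF less.prems] u by (metis atLeastLessThan_iff imageI)
  qed
  ultimately show ?case by (simp add: f_def t_def)
qed

section \<open>The inversion code of a one-sided Mallows permutation as a cylinder event\<close>

definition mcode :: "(nat \<Rightarrow> nat \<Rightarrow> bool) \<Rightarrow> nat \<Rightarrow> nat" where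
  "mcode B v = card {i \<in> {1..<mallows_perm (flip B) v}. v < mallows_perm B i}"

text \<open>A position before that of \<open>v\<close> holds a larger value exactly when the
  transposed rule has not given it to a smaller one. So the code counts the free positions at which
  column \<open>v\<close> failed, which is why it is geometric.\<close>

lemma mcode_alt:
  assumes B: "rich B" and v: "1 \<le> v"
  shows "mcode B v = card ({1..<mallows_perm (flip B) v} - mallows_perm (flip B) ` {1..<v})"
proof -
  define f where "f = mallows_perm B"
  define t where "t = mallows_perm (flip B)"
  have ft: "f (t u) = u" if "1 \<le> u" for u
    using mallows_perm_flip[OF B that] by (simp add: f_def t_def)
  have tf: "t (f u) = u" if "1 \<le> u" for u
    using mallows_perm_flip[OF rich_flip[OF B] that] by (simp add: f_def t_def)
  have f1: "1 \<le> f i" if "1 \<le> i" for i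
    using mallows_perm_props[OF B that] by (simp add: f_def)
  have "v < f i \<longleftrightarrow> i \<notin> t ` {1..<v}" if "1 \<le> i" "i < t v" for i
  proof
    assume "v < f i" then show "i \<notin> t ` {1..<v}" using ft by auto
  next
    assume a: "i \<notin> t ` {1..<v}"
    have "f i \<noteq> v" using tf[OF that(1)] that(2) by auto
    moreover have "\<not> f i < v" 
    proof
      assume "f i < v"
      then have "t (f i) \<in> t ` {1..<v}" using f1[OF that(1)] by auto
      then show False using a tf[OF that(1)] by simp
    qed
    ultimately show "v < f i" by simp
  qed
  then have "{i \<in> {1..<t v}. v < f i} = {1..<t v} - t ` {1..<v}" by auto
  then show ?thesis by (simp add: mcode_def f_def t_def)
qed

text \<open>\<open>T\<close> is the list of positions of \<open>1, ..., V\<close> forced by a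
  prescribed code \<open>a\<close>: value \<open>v\<close> takes the free position that has
  \<open>a v\<close> free positions before it. No array is involved, so the cells to be inspected
  are deterministic.\<close>

definition places :: "(nat \<Rightarrow> nat) \<Rightarrow> nat \<Rightarrow> (nat \<Rightarrow> nat) \<Rightarrow> bool" where
  "places a V T \<longleftrightarrow> (\<forall>v\<in>{1..V}. 1 \<le> T v \<and> T v \<notin> T ` {1..<v} \<and>
     card ({1..<T v} - T ` {1..<v}) = a v)"

lemma places_exists: "\<exists>T. places a V T"
proof (induction V)
  case 0 then show ?case by (auto simp: places_def)
next
  case (Suc V)
  then obtain T where T: "places a V T" by blast
  define S where "S = {1..} - T ` {1..V}"
  have S: "infinite S" unfolding S_def
    by (intro Diff_infinite_finite) (auto simp: infinite_Ici)
  define n where "n = enumerate S (a (Suc V))"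
  define T' where "T' = T (Suc V := n)"
  have n: "n \<in> S" "card {s\<in>S. s < n} = a (Suc V)"
    using enumerate_in_set[OF S] card_below_enumerate[OF S] by (auto simp: n_def)
  have im: "T' ` {1..<v} = T ` {1..<v}" if "v \<le> Suc V" for v
    using that by (intro image_cong) (auto simp: T'_def)
  have "{s\<in>S. s < n} = {1..<n} - T ` {1..<Suc V}"
    unfolding S_def atLeastLessThanSuc_atLeastAtMost by auto
  then have "1 \<le> T' v \<and> T' v \<notin> T' ` {1..<v} \<and> card ({1..<T' v} - T' ` {1..<v}) = a v"
    if "v \<in> {1..Suc V}" for v
  proof (cases "v = Suc V")
    case True
    then show ?thesis using n \<open>{s\<in>S. s < n} = _\<close> im[of v] 
      by (auto simp: T'_def S_def atLeastLessThanSuc_atLeastAtMost)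
  next
    case False
    then have "v \<in> {1..V}" "T' v = T v" using that by (auto simp: T'_def)
    then show ?thesis using T im[of v] by (simp add: places_def)
  qed
  then show ?case unfolding places_def by blast
qed

lemma places_unique:
  assumes T: "places a V T" and t: "places a V t" and "v \<in> {1..V}"
  shows "T v = t v"
  using assms(3)
proof (induction v rule: less_induct)
  case (less v)
  have im: "T ` {1..<v} = t ` {1..<v}"
    using less by (intro image_cong) auto
  have *: "{s \<in> {1..} - X. s < n} = {1..<n} - X" for X and n :: nat by auto
  show ?case
  proof (rule card_below_inj[of _ "{1..} - T ` {1..<v}"])
    show "T v \<in> {1..} - T ` {1..<v}" "t v \<in> {1..} - T ` {1..<v}"
      using T t less.prems im unfolding places_def by (metis DiffI atLeast_iff)+
    show "card {s \<in> {1..} - T ` {1..<v}. s < T v} = card {s \<in> {1..} - T ` {1..<v}. s < t v}"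
      unfolding * using T t less.prems im unfolding places_def by metis
  qed auto
qed

lemma places_mcode:
  assumes B: "rich B" and "\<And>v. v \<in> {1..V} \<Longrightarrow> mcode B v = a v"
  shows "places a V (mallows_perm (flip B))"
  using mallows_perm_props[OF rich_flip[OF B]] mcode_alt[OF B] assms(2)
  by (simp add: places_def)

text \<open>The code fixes the positions \<open>T\<close>; given these, the transposed greedy rule
  reaches them precisely if column \<open>v\<close> fails at the free positions before
  \<open>T v\<close> and succeeds at \<open>T v\<close>. These are distinct cells, finitely many, so
  independence applies directly.\<close>

lemma mcode_event:
  assumes B: "rich B" and T: "places a V T"
  shows "(\<forall>v\<in>{1..V}. mcode B v = a v) \<longleftrightarrow>
    (\<forall>v\<in>{1..V}. B (T v) v \<and> (\<forall>i\<in>{1..<T v} - T ` {1..<v}. \<not> B i v))"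
    (is "?L \<longleftrightarrow> ?R")
proof -
  define t where "t = mallows_perm (flip B)"
  note tp = mallows_perm_props[OF rich_flip[OF B], folded t_def]
  show ?thesis
  proof
    assume ?L
    then have "places a V t" using places_mcode[OF B] by (simp add: t_def)
    then have eq: "T v = t v" if "v \<in> {1..V}" for v
      using places_unique[OF T _ that] by blast
    then have im: "T ` {1..<v} = t ` {1..<v}" if "v \<in> {1..V}" for v
      using that by (intro image_cong) auto
    show ?R
    proof (intro ballI conjI)
      fix v assume v: "v \<in> {1..V}"
      show "B (T v) v" using tp(3)[of v] eq[OF v] v by simp
      fix i assume "i \<in> {1..<T v} - T ` {1..<v}"
      then show "\<not> B i v" using tp(4)[of v i] eq[OF v] im[OF v] v by auto
    qed
  next
    assume R: ?R
    have eq: "t v = T v" if "v \<in> {1..V}" for v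
      using that
    proof (induction v rule: less_induct)
      case (less v)
      have im: "t ` {1..<v} = T ` {1..<v}"
        using less by (intro image_cong) auto
      have v: "1 \<le> v" using less.prems by simp
      have "t v \<le> T v"
        using tp(4)[OF v, of "T v"] R T less.prems im by (auto simp: places_def)
      moreover have "\<not> t v < T v"
        using R less.prems tp(1-3)[OF v] im by auto
      ultimately show ?case by simp
    qed
    then have im: "t ` {1..<v} = T ` {1..<v}" if "v \<in> {1..V}" for v
      using that by (intro image_cong) auto
    show ?L
      using mcode_alt[OF B] T eq im by (simp add: places_def t_def)
  qed
qed

section \<open>Particle configurations on the integers\<close>

text \<open>A Maya diagram: empty far to the left, full far to the right. The positions of all
  values above a threshold form such a set.\<close>

definition maya :: "int set \<Rightarrow> bool" where
  "maya L \<longleftrightarrow> (\<exists>a. \<forall>z<a. z \<notin> L) \<and> (\<exists>b. \<forall>z\<ge>b. z \<in> L)"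

definition holes_above :: "int set \<Rightarrow> int \<Rightarrow> nat" where
  "holes_above L x = card {h. h \<notin> L \<and> x < h}"

text \<open>\<open>s\<close> is the charge in the fermionic sense. Requiring the balance at every
  \<open>x\<close> is convenient to use; \<open>chargedI\<close> shows that a single
  \<open>x\<close> is enough to establish it.\<close>

definition charged :: "int \<Rightarrow> int set \<Rightarrow> bool" where
  "charged s L \<longleftrightarrow> maya L \<and> (\<forall>x. int (card {l\<in>L. l \<le> x}) = int (holes_above L x) + x + s)"

text \<open>Under the correspondence with partitions at charge 0 this is the size of the partition,
  see \<open>energy_mult_of\<close>.\<close>

definition energy :: "int set \<Rightarrow> nat" where
  "energy L = card {(l, h). l \<in> L \<and> h \<notin> L \<and> l < h}"

lemma maya_finite:
  assumes "maya L"
  shows "finite {l\<in>L. l \<le> x}" "finite {l\<in>L. l < x}" "finite {h. h \<notin> L \<and> x < h}"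
    "finite {(l, h). l \<in> L \<and> h \<notin> L \<and> l < h}"
proof -
  obtain a b where a: "\<And>z. z < a \<Longrightarrow> z \<notin> L" and b: "\<And>z. b \<le> z \<Longrightarrow> z \<in> L"
    using assms unfolding maya_def by blast
  show "finite {l\<in>L. l \<le> x}"
    by (rule finite_subset[of _ "{a..x}"]) (use a in \<open>auto simp: not_less[symmetric]\<close>)
  then show "finite {l\<in>L. l < x}" by (rule rev_finite_subset) auto
  show "finite {h. h \<notin> L \<and> x < h}"
  proof (rule finite_subset[of _ "{x..b}"])
    have "h \<le> b" if "h \<notin> L" for h using b that by (metis linear)
    then show "{h. h \<notin> L \<and> x < h} \<subseteq> {x..b}" by auto
  qed simp
  show "finite {(l, h). l \<in> L \<and> h \<notin> L \<and> l < h}"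
  proof (rule finite_subset)
    show "{(l, h). l \<in> L \<and> h \<notin> L \<and> l < h} \<subseteq> {a..b} \<times> {a..b}"
    proof safe
      fix l h assume "l \<in> L" "h \<notin> L" "l < h"
      moreover have "a \<le> l" "h \<le> b"
        using a b calculation by (meson not_less linear)+
      ultimately show "l \<in> {a..b}" "h \<in> {a..b}" by auto
    qed
  qed simp
qed

lemma maya_remove: "maya L \<Longrightarrow> maya (L - {k})"
  unfolding maya_def
proof safe
  fix a b assume a: "\<forall>z<a. z \<notin> L" and b: "\<forall>z\<ge>b. z \<in> L"
  then show "\<exists>a. \<forall>z<a. z \<notin> L - {k}" by blast
  show "\<exists>b. \<forall>z\<ge>b. z \<in> L - {k}"
    by (rule exI[of _ "max b (k + 1)"]) (use b in auto)
qed

lemma maya_insert: "maya L \<Longrightarrow> maya (insert k L)"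
  unfolding maya_def
proof safe
  fix a b assume a: "\<forall>z<a. z \<notin> L" and b: "\<forall>z\<ge>b. z \<in> L"
  then show "\<exists>b. \<forall>z\<ge>b. z \<in> insert k L" by blast
  show "\<exists>a. \<forall>z<a. z \<notin> insert k L"
    by (rule exI[of _ "min a k"]) (use a in auto)
qed

text \<open>Passing \<open>x + 1\<close> either gains a particle or loses a hole, so the balance
  does not depend on \<open>x\<close>.\<close>

lemma holes_above_Suc:
  assumes "maya L"
  shows "int (card {l\<in>L. l \<le> x + 1}) - int (holes_above L (x + 1)) - (x + 1)
       = int (card {l\<in>L. l \<le> x}) - int (holes_above L x) - x"
proof (cases "x + 1 \<in> L")
  case True
  then have "{l\<in>L. l \<le> x + 1} = insert (x + 1) {l\<in>L. l \<le> x}"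
    "{h. h \<notin> L \<and> x + 1 < h} = {h. h \<notin> L \<and> x < h}"
    by (auto, smt (verit))
  then show ?thesis using maya_finite(1)[OF assms, of x] by (simp add: holes_above_def)
next
  case False
  then have "{l\<in>L. l \<le> x + 1} = {l\<in>L. l \<le> x}"
    "{h. h \<notin> L \<and> x < h} = insert (x + 1) {h. h \<notin> L \<and> x + 1 < h}"
    by (auto, smt (verit))
  then show ?thesis using maya_finite(3)[OF assms, of "x + 1"] by (simp add: holes_above_def)
qed

lemma chargedI:
  assumes L: "maya L" and x: "int (card {l\<in>L. l \<le> x}) = int (holes_above L x) + x + s"
  shows "charged s L"
proof -
  define d where "d y = int (card {l\<in>L. l \<le> y}) - int (holes_above L y) - y" for y
  have d: "d (y + 1) = d y" for y
    using holes_above_Suc[OF L, of y] by (simp add: d_def)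
  have "d y = d x" for y
  proof (induction y rule: int_induct[where k = x])
    case (step2 i)
    then show ?case using d[of "i - 1"] by simp
  qed (simp_all add: d)
  then show ?thesis
    using x L by (simp add: charged_def d_def algebra_simps)
qed

lemma charged_remove:
  assumes "charged (s + 1) L" "k \<in> L"
  shows "charged s (L - {k})"
proof (rule chargedI[of _ k])
  have L: "maya L" and e: "int (card {l\<in>L. l \<le> k}) = int (holes_above L k) + k + (s + 1)"
    using assms by (auto simp: charged_def)
  show "maya (L - {k})" using L by (rule maya_remove)
  have "{l\<in>L. l \<le> k} = insert k {l\<in>L - {k}. l \<le> k}" using assms by auto
  then have "card {l\<in>L. l \<le> k} = Suc (card {l\<in>L - {k}. l \<le> k})"
    using maya_finite(1)[OF maya_remove[OF L], of k k] by simp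
  moreover have "holes_above (L - {k}) k = holes_above L k"
    unfolding holes_above_def by (rule arg_cong[where f = card]) auto
  ultimately show "int (card {l\<in>L - {k}. l \<le> k}) = int (holes_above (L - {k}) k) + k + s"
    using e by simp
qed

lemma charged_insert:
  assumes "charged s L" "k \<notin> L"
  shows "charged (s + 1) (insert k L)"
proof (rule chargedI[of _ k])
  have L: "maya L" and e: "int (card {l\<in>L. l \<le> k}) = int (holes_above L k) + k + s"
    using assms by (auto simp: charged_def)
  show "maya (insert k L)" using L by (rule maya_insert)
  have "{l\<in>insert k L. l \<le> k} = insert k {l\<in>L. l \<le> k}" using assms by auto
  then have "card {l\<in>insert k L. l \<le> k} = Suc (card {l\<in>L. l \<le> k})"
    using maya_finite(1)[OF L, of k] assms by simp
  moreover have "holes_above (insert k L) k = holes_above L k"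
    unfolding holes_above_def by (rule arg_cong[where f = card]) auto
  ultimately show "int (card {l\<in>insert k L. l \<le> k}) = int (holes_above (insert k L) k) + k + (s + 1)"
    using e by simp
qed

text \<open>Only pairs containing \<open>k\<close> change: as a particle it meets the holes to its
  right, as a hole the particles to its left. These counts are the dual code and the code of the
  value placed at \<open>k\<close>, so \<open>q ^ energy\<close> absorbs the exchange of one for the
  other.\<close>

lemma energy_remove:
  assumes L: "maya L" and k: "k \<in> L"
  shows "energy (L - {k}) + holes_above L k = energy L + card {l\<in>L. l < k}"
proof -
  let ?P = "{(l, h). l \<in> L - {k} \<and> h \<notin> L \<and> l < h}"
  have fP: "finite ?P"
    by (rule finite_subset[OF _ maya_finite(4)[OF L]]) auto
  have "{(l, h). l \<in> L \<and> h \<notin> L \<and> l < h} = ?P \<union> Pair k ` {h. h \<notin> L \<and> k < h}"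
    using k by auto
  then have 1: "energy L = card ?P + holes_above L k"
    unfolding energy_def holes_above_def
    using fP maya_finite(3)[OF L, of k]
    by (simp only:) (subst card_Un_disjoint, auto simp: card_image inj_on_def)
  have "{(l, h). l \<in> L - {k} \<and> h \<notin> L - {k} \<and> l < h} = ?P \<union> (\<lambda>l. (l, k)) ` {l\<in>L. l < k}"
    using k by auto
  then have 2: "energy (L - {k}) = card ?P + card {l\<in>L. l < k}"
    unfolding energy_def
    using fP k maya_finite(2)[OF L, of k]
    by (simp only:) (subst card_Un_disjoint, auto simp: card_image inj_on_def)
  show ?thesis using 1 2 by simp
qed

text \<open>Makes the exchange invertible: a configuration and an arbitrary code entry
  \<open>a\<close> determine the particle that has to become a hole.\<close>

lemma maya_nth:
  assumes "maya L"
  shows "\<exists>k\<in>L. card {l\<in>L. l < k} = a"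
proof -
  obtain A b where A: "\<And>z. z < A \<Longrightarrow> z \<notin> L" and b: "\<And>z. b \<le> z \<Longrightarrow> z \<in> L"
    using assms unfolding maya_def by blast
  define S where "S = {n. A + int n \<in> L}"
  have "{nat (b - A)..} \<subseteq> S" using b by (auto simp: S_def)
  then have S: "infinite S" using infinite_Ici infinite_super by blast
  define n where "n = enumerate S a"
  have "{l\<in>L. l < A + int n} = (\<lambda>m. A + int m) ` {s\<in>S. s < n}"
  proof safe
    fix l assume l: "l \<in> L" "l < A + int n"
    then have "A \<le> l" using A by force
    then have "l = A + int (nat (l - A))" by simp
    then show "l \<in> (\<lambda>m. A + int m) ` {s\<in>S. s < n}"
      using l \<open>A \<le> l\<close> by (intro image_eqI[of _ _ "nat (l - A)"]) (auto simp: S_def)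
  qed (auto simp: S_def)
  then have "card {l\<in>L. l < A + int n} = a"
    using card_below_enumerate[OF S, of a] by (simp add: n_def card_image inj_on_def)
  moreover have "A + int n \<in> L" using enumerate_in_set[OF S, of a] by (simp add: n_def S_def)
  ultimately show ?thesis by blast
qed

text \<open>A Maya diagram is determined by its particles \<le> 0 and its holes > 0, two finite
  sets. Countability allows summing probabilities over configurations.\<close>

lemma countable_maya: "countable (Collect maya)"
proof (rule countable_image_inj_on[where f = "\<lambda>L. ({l\<in>L. l \<le> 0}, {h. h \<notin> L \<and> 0 < h})"])
  have "(\<lambda>L. ({l\<in>L. l \<le> 0}, {h. h \<notin> L \<and> 0 < h})) ` Collect maya \<subseteq> Collect finite \<times> Collect finite"
    by (auto intro: maya_finite)
  moreover have "countable (Collect (finite :: int set \<Rightarrow> bool) \<times> Collect (finite :: int set \<Rightarrow> bool))"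
    by (intro countable_SIGMA countable_Collect_finite)
  ultimately show "countable ((\<lambda>L. ({l\<in>L. l \<le> (0::int)}, {h. h \<notin> L \<and> 0 < h})) ` Collect maya)"
    by (rule countable_subset)
  show "inj_on (\<lambda>L. ({l\<in>L. l \<le> (0::int)}, {h. h \<notin> L \<and> 0 < h})) (Collect maya)"
  proof (rule inj_onI, clarify)
    fix L L' :: "int set" assume "{l\<in>L. l \<le> 0} = {l\<in>L'. l \<le> 0}" "{h. h \<notin> L \<and> 0 < h} = {h. h \<notin> L' \<and> 0 < h}"
    then have "(x \<le> 0 \<longrightarrow> x \<in> L \<longleftrightarrow> x \<in> L') \<and> (0 < x \<longrightarrow> x \<in> L \<longleftrightarrow> x \<in> L')" for x by blast
    then show "L = L'" by (meson not_le_imp_less subsetI subset_antisym)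
  qed
qed

lemma translate_eq:
  fixes L :: "int set"
  shows "{l\<in>(+) t ` L. l \<le> x} = (+) t ` {l\<in>L. l \<le> x - t}"
    "{h. h \<notin> (+) t ` L \<and> x < h} = (+) t ` {h. h \<notin> L \<and> x - t < h}"
    "{(l, h). l \<in> (+) t ` L \<and> h \<notin> (+) t ` L \<and> l < h} =
      (\<lambda>(l, h). (t + l, t + h)) ` {(l, h). l \<in> L \<and> h \<notin> L \<and> l < h}"
proof -
  have *: "x \<in> (+) t ` L \<longleftrightarrow> x - t \<in> L" for x and L :: "int set"
    by (metis add.commute diff_add_cancel image_iff add_diff_cancel_left')
  show "{l\<in>(+) t ` L. l \<le> x} = (+) t ` {l\<in>L. l \<le> x - t}"
    "{h. h \<notin> (+) t ` L \<and> x < h} = (+) t ` {h. h \<notin> L \<and> x - t < h}"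
    by (auto simp: *)
  show "{(l, h). l \<in> (+) t ` L \<and> h \<notin> (+) t ` L \<and> l < h} =
      (\<lambda>(l, h). (t + l, t + h)) ` {(l, h). l \<in> L \<and> h \<notin> L \<and> l < h}"
  proof safe
    fix a b assume "b \<notin> (+) t ` L" "t + a < b" "a \<in> L"
    then show "(t + a, b) \<in> (\<lambda>(l, h). (t + l, t + h)) ` {(l, h). l \<in> L \<and> h \<notin> L \<and> l < h}"
      by (intro image_eqI[of _ _ "(a, b - t)"]) (auto simp: *)
  qed auto
qed

lemma maya_translate: "maya L \<Longrightarrow> maya ((+) t ` L)"
  unfolding maya_def
proof safe
  fix a b assume a: "\<forall>z<a. z \<notin> L" and b: "\<forall>z\<ge>b. z \<in> L"
  show "\<exists>a. \<forall>z<a. z \<notin> (+) t ` L"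
    by (rule exI[of _ "a + t"]) (use a in auto)
  show "\<exists>b. \<forall>z\<ge>b. z \<in> (+) t ` L"
  proof (rule exI[of _ "b + t"], safe)
    fix z assume "b + t \<le> z"
    then show "z \<in> (+) t ` L" by (intro image_eqI[of _ _ "z - t"]) (use b in auto)
  qed
qed

lemma charged_translate: "charged s L \<Longrightarrow> charged (s - t) ((+) t ` L)"
  using maya_translate[of L t]
  by (auto simp: charged_def translate_eq holes_above_def card_image)

lemma energy_translate: "energy ((+) t ` L) = energy L"
  unfolding energy_def translate_eq by (rule card_image) (auto simp: inj_on_def)

text \<open>Translation shifts the charge and preserves the energy, so the total
  \<open>q\<close>-weight is the same for every charge.\<close>

lemma bij_betw_translate: "bij_betw ((`) ((+) t)) (Collect (charged s)) (Collect (charged (s - t)))"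
proof (rule bij_betwI[where g = "(`) ((+) (- t))"])
  show "(`) ((+) (- t)) \<in> Collect (charged (s - t)) \<rightarrow> Collect (charged s)"
    using charged_translate[of "s - t" _ "- t"] by auto
qed (auto simp: charged_translate image_image)

section \<open>Partitions as particle configurations\<close>

definition fin_mult :: "(nat \<Rightarrow> nat) \<Rightarrow> bool" where
  "fin_mult mv \<longleftrightarrow> finite {i. 1 \<le> i \<and> mv i \<noteq> 0}"

lemma fin_mult_finite: "fin_mult mv \<Longrightarrow> 1 \<le> i \<Longrightarrow> finite {i'. i \<le> i' \<and> mv i' \<noteq> 0}"
  unfolding fin_mult_def by (erule rev_finite_subset) auto

lemma tailsum_Suc:
  assumes "fin_mult mv" "1 \<le> i"
  shows "tailsum mv i = mv i + tailsum mv (Suc i)"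
proof (cases "mv i = 0")
  case True
  then have "{i'. i \<le> i' \<and> mv i' \<noteq> 0} = {i'. Suc i \<le> i' \<and> mv i' \<noteq> 0}"
    by (auto simp: Suc_le_eq) (metis nless_le)
  then show ?thesis using True by (simp add: tailsum_def)
next
  case False
  then have "{i'. i \<le> i' \<and> mv i' \<noteq> 0} = insert i {i'. Suc i \<le> i' \<and> mv i' \<noteq> 0}"
    by auto
  then show ?thesis using fin_mult_finite[OF assms(1), of "Suc i"] by (simp add: tailsum_def)
qed

lemma tailsum_antimono:
  assumes "fin_mult mv" "1 \<le> i" "i \<le> i'"
  shows "tailsum mv i' \<le> tailsum mv i"
  unfolding tailsum_def
  by (rule sum_mono2) (use assms fin_mult_finite[OF assms(1,2)] in auto)

lemma tailsum_eventually_0: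
  assumes "fin_mult mv"
  shows "\<exists>N. \<forall>i\<ge>N. tailsum mv i = 0"
proof -
  obtain N where N: "\<And>i. i \<in> {i. 1 \<le> i \<and> mv i \<noteq> 0} \<Longrightarrow> i < N"
    using assms unfolding fin_mult_def by (metis finite_nat_set_iff_bounded)
  have "tailsum mv i = 0" if "Suc N \<le> i" for i
  proof -
    have "i' < N" if "i \<le> i'" "mv i' \<noteq> 0" for i' using N[of i'] that \<open>Suc N \<le> i\<close> by simp
    then have "{i'. i \<le> i' \<and> mv i' \<noteq> 0} = {}" using that by fastforce
    then show ?thesis by (simp only: tailsum_def sum.empty)
  qed
  then show ?thesis by blast
qed

text \<open>\<open>tailsum mv\<close> and \<open>Lam mv\<close> are conjugate partitions: since
  \<open>tailsum\<close> decreases, the set counted by \<open>Lam\<close> is an initial segment of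
  the positive integers.\<close>

lemma Lam_ge_iff:
  assumes "fin_mult mv" "1 \<le> j" "1 \<le> i"
  shows "i \<le> Lam mv j \<longleftrightarrow> j \<le> tailsum mv i"
proof -
  define D where "D = {i. 1 \<le> i \<and> j \<le> tailsum mv i}"
  obtain N where N: "\<And>i. N \<le> i \<Longrightarrow> tailsum mv i = 0" using tailsum_eventually_0[OF assms(1)] by blast
  have "D \<subseteq> {..<N}" using N assms(2) by (force simp: D_def not_le[symmetric])
  then have fin: "finite D" by (rule finite_subset) simp
  have down: "i' \<in> D" if "i \<in> D" "1 \<le> i'" "i' \<le> i" for i i'
    using that tailsum_antimono[OF assms(1), of i' i] by (auto simp: D_def)
  have "D = {1..card D}"
  proof (cases "D = {}")
    case False
    have "D = {1..Max D}"
      using down[OF Max_in[OF fin False]] Max_ge[OF fin] by (auto simp: D_def)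
    then show ?thesis by (metis card_atLeastAtMost diff_Suc_1 Suc_eq_plus1)
  qed simp
  then have "i \<in> D \<longleftrightarrow> i \<le> card D" using assms(3) by (metis atLeastAtMost_iff)
  then show ?thesis using assms(3) by (simp add: D_def Lam_def)
qed

lemma Lam_antimono:
  assumes "fin_mult mv" "1 \<le> j" "j \<le> j'"
  shows "Lam mv j' \<le> Lam mv j"
proof (cases "Lam mv j' = 0")
  case False
  then have "1 \<le> Lam mv j'" by simp
  then show ?thesis
    using Lam_ge_iff[OF assms(1), of j' "Lam mv j'"] Lam_ge_iff[OF assms(1), of j "Lam mv j'"] assms
    by simp
qed simp

lemma ell_strict_mono:
  assumes "fin_mult mv" "1 \<le> j" "j < j'"
  shows "ell mv j < ell mv j'"
  using Lam_antimono[OF assms(1,2), of j'] assms(3) by (simp add: ell_def)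

lemma ell_inj: "fin_mult mv \<Longrightarrow> inj_on (ell mv) {1..}"
  by (rule linorder_inj_onI) (use ell_strict_mono in force)+

lemma ell_large:
  assumes "fin_mult mv" "tailsum mv 1 < j"
  shows "ell mv j = int j"
  using Lam_ge_iff[OF assms(1), of j 1] assms(2) by (simp add: ell_def)

definition particles :: "(nat \<Rightarrow> nat) \<Rightarrow> int set" where
  "particles mv = ell mv ` {1..}"

lemma particles_below:
  assumes "fin_mult mv" "1 \<le> j"
  shows "{l\<in>particles mv. l \<le> ell mv j} = ell mv ` {1..j}"
proof -
  have "ell mv i \<le> ell mv j \<longleftrightarrow> i \<le> j" if "1 \<le> i" for i
    using ell_strict_mono[OF assms(1), of i j] ell_strict_mono[OF assms, of i] that
    by (cases i j rule: linorder_cases) auto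
  then show ?thesis by (auto simp: particles_def)
qed

text \<open>Beyond the number of parts \<open>tailsum mv 1\<close> the shift vanishes and
  \<open>ell\<close> is the identity; at such an \<open>N\<close> there are \<open>N\<close>
  particles up to \<open>N\<close> and no holes beyond.\<close>

lemma charged_particles:
  assumes "fin_mult mv"
  shows "charged 0 (particles mv)"
proof -
  define N where "N = Suc (tailsum mv 1)"
  have N: "ell mv j = int j" if "N \<le> j" for j
    using ell_large[OF assms] that by (simp add: N_def)
  have up: "z \<in> particles mv" if "int N \<le> z" for z
    using N[of "nat z"] that unfolding particles_def N_def
    by (intro image_eqI[of _ _ "nat z"]) auto
  have "z \<notin> particles mv" if "z < ell mv 1" for z
    using ell_strict_mono[OF assms, of 1] that unfolding particles_def
    by (metis atLeast_iff imageE le_neq_implies_less less_imp_not_less order_refl)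
  then have M: "maya (particles mv)" using up unfolding maya_def by blast
  show ?thesis
  proof (rule chargedI[OF M, of "int N"])
    have "{h. h \<notin> particles mv \<and> int N < h} = {}" using up by auto
    then have "holes_above (particles mv) (int N) = 0" by (simp only: holes_above_def card.empty)
    moreover have "card {l\<in>particles mv. l \<le> int N} = N"
      using particles_below[OF assms, of N] N[of N] ell_inj[OF assms]
      by (simp add: N_def card_image inj_on_subset)
    ultimately show "int (card {l\<in>particles mv. l \<le> int N}) = int (holes_above (particles mv) (int N)) + int N + 0"
      by simp
  qed
qed

text \<open>The charge identity at the \<open>j\<close>-th particle gives \<open>j\<close> = holes +
  \<open>ell mv j\<close>, while \<open>ell mv j\<close> is \<open>j\<close> minus the
  \<open>j\<close>-th part.\<close>

lemma holes_above_ell: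
  assumes "fin_mult mv" "1 \<le> j"
  shows "holes_above (particles mv) (ell mv j) = Lam mv j"
proof -
  have "card {l\<in>particles mv. l \<le> ell mv j} = j"
    using particles_below[OF assms] ell_inj[OF assms(1)] by (simp add: card_image inj_on_subset)
  then have "int j = int (holes_above (particles mv) (ell mv j)) + ell mv j"
    using charged_particles[OF assms(1)] unfolding charged_def by (metis add.right_neutral)
  then show ?thesis by (simp add: ell_def)
qed

text \<open>The part of the partition belonging to a particle is its number of holes to the right, so the
  multiplicities can be read off the configuration.\<close>

definition mult_of :: "int set \<Rightarrow> nat \<Rightarrow> nat" where
  "mult_of L i = card {l\<in>L. holes_above L l = i}"

text \<open>The ranks \<open>j\<close> whose part equals \<open>i\<close> are those between two
  consecutive tail sums, an interval of length \<open>mv i\<close>.\<close>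

lemma mult_of_particles:
  assumes mv: "fin_mult mv" and i: "1 \<le> i"
  shows "mult_of (particles mv) i = mv i"
proof -
  have "{l\<in>particles mv. holes_above (particles mv) l = i} = ell mv ` {j. 1 \<le> j \<and> Lam mv j = i}"
    using holes_above_ell[OF mv] by (auto simp: particles_def)
  moreover have "Lam mv j = i \<longleftrightarrow> tailsum mv (Suc i) < j \<and> j \<le> tailsum mv i" if "1 \<le> j" for j
    using Lam_ge_iff[OF mv that, of i] Lam_ge_iff[OF mv that, of "Suc i"] i by auto
  then have "{j. 1 \<le> j \<and> Lam mv j = i} = {tailsum mv (Suc i)<..tailsum mv i}"
    by (auto simp only: greaterThanAtMost_iff mem_Collect_eq set_eq_iff)
  ultimately have "mult_of (particles mv) i = card (ell mv ` {tailsum mv (Suc i)<..tailsum mv i})"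
    by (simp add: mult_of_def)
  also have "\<dots> = card {tailsum mv (Suc i)<..tailsum mv i}"
    by (rule card_image, rule inj_on_subset[OF ell_inj[OF mv]]) auto
  finally show ?thesis using tailsum_Suc[OF mv i] by simp
qed

lemma holes_above_antimono: "maya L \<Longrightarrow> x \<le> y \<Longrightarrow> holes_above L y \<le> holes_above L x"
  unfolding holes_above_def by (rule card_mono[OF maya_finite(3)]) auto

lemma finite_inner_particles:
  assumes "maya L" "1 \<le> i"
  shows "finite {l\<in>L. i \<le> holes_above L l}"
proof -
  obtain b where b: "\<And>z. b \<le> z \<Longrightarrow> z \<in> L"
    using assms unfolding maya_def by blast
  have "holes_above L l = 0" if "b \<le> l" for l
  proof -
    have "{h. h \<notin> L \<and> l < h} = {}" using b that by force
    then show ?thesis by (simp only: holes_above_def card.empty)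
  qed
  then have "l \<le> b" if "i \<le> holes_above L l" for l
    using assms(2) that by (metis le_zero_eq linear not_one_le_zero)
  then have "{l\<in>L. i \<le> holes_above L l} \<subseteq> {l\<in>L. l \<le> b}" by blast
  then show ?thesis by (rule finite_subset) (rule maya_finite[OF assms(1)])
qed

lemma fin_mult_mult_of:
  assumes "maya L"
  shows "fin_mult (mult_of L)"
proof -
  have "{i. 1 \<le> i \<and> mult_of L i \<noteq> 0} \<subseteq> holes_above L ` {l\<in>L. 1 \<le> holes_above L l}"
  proof safe
    fix i assume "1 \<le> i" "0 < mult_of L i"
    then have "{l\<in>L. holes_above L l = i} \<noteq> {}" unfolding mult_of_def by (metis card.empty less_irrefl)
    then show "i \<in> holes_above L ` {l\<in>L. 1 \<le> holes_above L l}" using \<open>1 \<le> i\<close> by auto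
  qed
  then show ?thesis
    unfolding fin_mult_def
    by (rule finite_subset) (intro finite_imageI finite_inner_particles[OF assms], simp)
qed

lemma tailsum_mult_of:
  assumes L: "maya L" and i: "1 \<le> i"
  shows "tailsum (mult_of L) i = card {l\<in>L. i \<le> holes_above L l}"
proof -
  let ?I = "{i'. i \<le> i' \<and> mult_of L i' \<noteq> 0}"
  have fin: "finite ?I" using fin_mult_finite[OF fin_mult_mult_of[OF L] i] .
  have finl: "finite {l\<in>L. holes_above L l = i'}" if "i' \<in> ?I" for i'
    by (rule finite_subset[OF _ finite_inner_particles[OF L i]]) (use that in auto)
  have "{l\<in>L. i \<le> holes_above L l} = (\<Union>i'\<in>?I. {l\<in>L. holes_above L l = i'})"
  proof (safe)
    fix l assume l: "l \<in> L" "i \<le> holes_above L l"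
    have "finite {l'\<in>L. holes_above L l' = holes_above L l}"
      by (rule finite_subset[OF _ finite_inner_particles[OF L i]]) (use l in auto)
    then have "mult_of L (holes_above L l) \<noteq> 0"
      using l by (auto simp: mult_of_def)
    then show "l \<in> (\<Union>i'\<in>?I. {l\<in>L. holes_above L l = i'})" using l by auto
  qed
  then have "card {l\<in>L. i \<le> holes_above L l} = (\<Sum>i'\<in>?I. card {l\<in>L. holes_above L l = i'})"
    using fin finl by (simp only:) (subst card_UN_disjoint, auto)
  then show ?thesis by (simp add: tailsum_def mult_of_def)
qed

text \<open>As \<open>holes_above\<close> decreases along \<open>L\<close>, the particles with at
  least \<open>i\<close> holes to their right form an initial segment. Comparing its size with the
  rank of \<open>l\<close> shows that the part of that rank is \<open>holes_above L l\<close>, and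
  charge zero converts rank minus part into the position \<open>l\<close>.\<close>

lemma particles_mult_of:
  assumes "charged 0 L"
  shows "particles (mult_of L) = L"
proof -
  have L: "maya L" and rk: "int (card {l\<in>L. l \<le> x}) = int (holes_above L x) + x" for x
    using assms by (auto simp: charged_def)
  have fm: "fin_mult (mult_of L)" using L by (rule fin_mult_mult_of)
  define rank where "rank l = card {l'\<in>L. l' \<le> l}" for l
  have rank1: "1 \<le> rank l" if "l \<in> L" for l
    using maya_finite(1)[OF L, of l] that by (auto simp: rank_def Suc_le_eq card_gt_0_iff)
  have ell_rank: "ell (mult_of L) (rank l) = l" if l: "l \<in> L" for l
  proof -
    have eq: "i \<le> holes_above L l \<longleftrightarrow> rank l \<le> tailsum (mult_of L) i" if i: "1 \<le> i" for i
    proof (cases "i \<le> holes_above L l")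
      case True
      have "{l'\<in>L. l' \<le> l} \<subseteq> {l\<in>L. i \<le> holes_above L l}"
        using holes_above_antimono[OF L] True by (auto intro: order_trans)
      then have "rank l \<le> tailsum (mult_of L) i"
        unfolding tailsum_mult_of[OF L i] rank_def
        by (rule card_mono[OF finite_inner_particles[OF L i]])
      then show ?thesis using True by simp
    next
      case False
      have "{l\<in>L. i \<le> holes_above L l} \<subset> {l'\<in>L. l' \<le> l}"
      proof
        have "l' \<le> l" if "i \<le> holes_above L l'" for l'
          using holes_above_antimono[OF L, of l l'] False that by linarith
        then show "{l\<in>L. i \<le> holes_above L l} \<subseteq> {l'\<in>L. l' \<le> l}" by blast
        have "l \<in> {l'\<in>L. l' \<le> l}" "l \<notin> {l\<in>L. i \<le> holes_above L l}"
          using l False by auto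
        then show "{l\<in>L. i \<le> holes_above L l} \<noteq> {l'\<in>L. l' \<le> l}" by metis
      qed
      then have "tailsum (mult_of L) i < rank l"
        unfolding tailsum_mult_of[OF L i] rank_def
        by (rule psubset_card_mono[OF maya_finite(1)[OF L]])
      then show ?thesis using False by simp
    qed
    have *: "i \<le> Lam (mult_of L) (rank l) \<longleftrightarrow> i \<le> holes_above L l" for i
      using eq[of i] Lam_ge_iff[OF fm rank1[OF l], of i] by (cases "i = 0") auto
    have "Lam (mult_of L) (rank l) = holes_above L l"
      by (rule antisym) (use * in blast)+
    then show ?thesis using rk[of l] by (simp add: ell_def rank_def)
  qed
  show ?thesis
  proof
    show "L \<subseteq> particles (mult_of L)"
      using ell_rank rank1 by (force simp: particles_def)
    show "particles (mult_of L) \<subseteq> L"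
    proof
      fix z assume "z \<in> particles (mult_of L)"
      then obtain j where j: "1 \<le> j" "z = ell (mult_of L) j" by (auto simp: particles_def)
      obtain k where k: "k \<in> L" "card {l\<in>L. l < k} = j - 1" using maya_nth[OF L] by blast
      have "{l\<in>L. l \<le> k} = insert k {l\<in>L. l < k}" using k by auto
      then have "rank k = j" using k j maya_finite(2)[OF L, of k] by (simp add: rank_def)
      then show "z \<in> L" using ell_rank[OF k(1)] k j by simp
    qed
  qed
qed

text \<open>Inversions are grouped by their particle, then particles by their number of holes. The
  right-hand side is the exponent of \<open>q\<close> in the product of the laws of the
  multiplicities.\<close>

lemma energy_mult_of:
  assumes L: "maya L"
  shows "energy L = (\<Sum>i | 1 \<le> i \<and> mult_of L i \<noteq> 0. i * mult_of L i)"
proof -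
  let ?F = "{l\<in>L. 1 \<le> holes_above L l}" and ?I = "{i. 1 \<le> i \<and> mult_of L i \<noteq> 0}"
  have F: "finite ?F" by (rule finite_inner_particles[OF L]) simp
  have "1 \<le> holes_above L l" if "h \<notin> L" "l < h" for l h
  proof -
    have "h \<in> {h. h \<notin> L \<and> l < h}" using that by blast
    then show ?thesis
      using maya_finite(3)[OF L, of l] unfolding holes_above_def
      by (metis One_nat_def Suc_leI card_gt_0_iff empty_iff)
  qed
  then have "{(l, h). l \<in> L \<and> h \<notin> L \<and> l < h} = (SIGMA l:?F. {h. h \<notin> L \<and> l < h})"
    by auto
  then have "energy L = card (SIGMA l:?F. {h. h \<notin> L \<and> l < h})"
    by (simp only: energy_def)
  also have "\<dots> = (\<Sum>l\<in>?F. holes_above L l)"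
    using F maya_finite(3)[OF L] by (subst card_SigmaI) (auto simp: holes_above_def)
  also have "\<dots> = (\<Sum>i\<in>holes_above L ` ?F. \<Sum>l | l \<in> ?F \<and> holes_above L l = i. holes_above L l)"
    by (rule sum.image_gen[OF F])
  also have "\<dots> = (\<Sum>i\<in>holes_above L ` ?F. i * mult_of L i)"
  proof (rule sum.cong[OF refl])
    fix i assume "i \<in> holes_above L ` ?F"
    then have "{l\<in>L. holes_above L l = i} = {l. l \<in> ?F \<and> holes_above L l = i}" by auto
    then show "(\<Sum>l | l \<in> ?F \<and> holes_above L l = i. holes_above L l) = i * mult_of L i"
      by (simp add: mult_of_def)
  qed
  also have "holes_above L ` ?F = ?I"
  proof safe
    fix l assume l: "l \<in> L" "1 \<le> holes_above L l"
    have "finite {l'\<in>L. holes_above L l' = holes_above L l}"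
      by (rule finite_subset[OF _ F]) (use l in auto)
    then show "0 < mult_of L (holes_above L l)" using l by (auto simp: mult_of_def card_gt_0_iff)
  next
    fix i assume "1 \<le> i" "0 < mult_of L i"
    then have "{l\<in>L. holes_above L l = i} \<noteq> {}" unfolding mult_of_def by (metis card.empty less_irrefl)
    then show "i \<in> holes_above L ` ?F" using \<open>1 \<le> i\<close> by auto
  qed
  finally show ?thesis .
qed

section \<open>The two-sided Mallows permutation\<close>

text \<open>Reflecting the line and exchanging particles with holes reduces this to
  \<open>maya_nth\<close>.\<close>

lemma maya_nth_hole:
  assumes "maya L"
  shows "\<exists>k. k \<notin> L \<and> holes_above L k = a"
proof -
  define L' where "L' = {z. - z \<notin> L}"
  obtain A b where A: "\<And>z. z < A \<Longrightarrow> z \<notin> L" and b: "\<And>z. b \<le> z \<Longrightarrow> z \<in> L"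
    using assms unfolding maya_def by blast
  have "z \<notin> L'" if "z < - b" for z using b[of "- z"] that by (simp add: L'_def)
  moreover have "z \<in> L'" if "- A + 1 \<le> z" for z using A[of "- z"] that by (simp add: L'_def)
  ultimately have "maya L'" unfolding maya_def by blast
  then obtain k where k: "k \<in> L'" "card {l\<in>L'. l < k} = a" using maya_nth by blast
  have "{h. h \<notin> L \<and> - k < h} = uminus ` {l\<in>L'. l < k}"
  proof safe
    fix h assume "h \<notin> L" "- k < h"
    then show "h \<in> uminus ` {l\<in>L'. l < k}"
      by (intro image_eqI[of _ _ "- h"]) (auto simp: L'_def)
  qed (auto simp: L'_def)
  then have "holes_above L (- k) = a"
    using k by (simp add: holes_above_def card_image)
  then show ?thesis using k by (auto simp: L'_def)
qed

lemma holes_above_inj: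
  assumes "maya L" "x \<notin> L" "y \<notin> L" "holes_above L x = holes_above L y"
  shows "x = y"
  using card_above_inj[of x "- L" y] maya_finite(3)[OF assms(1)] assms
  by (simp add: holes_above_def)

lemma holes_above_strict:
  assumes "maya L" "y \<notin> L" "x < y"
  shows "holes_above L y < holes_above L x"
  unfolding holes_above_def
  by (rule psubset_card_mono[OF maya_finite(3)[OF assms(1)]]) (use assms in auto)

definition rcode :: "(int \<Rightarrow> int) \<Rightarrow> int \<Rightarrow> nat" where
  "rcode \<sigma> z = card {i. i < inv \<sigma> z \<and> z < \<sigma> i}"

definition lcode :: "(int \<Rightarrow> int) \<Rightarrow> int \<Rightarrow> nat" where
  "lcode \<sigma> z = card {i. inv \<sigma> z < i \<and> \<sigma> i < z}"

text \<open>The sign makes \<open>s\<close> the number of values that have crossed the cut, which is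
  then the charge of the set.\<close>

definition upset :: "(int \<Rightarrow> int) \<Rightarrow> int \<Rightarrow> int set" where
  "upset \<sigma> s = {i. - s < \<sigma> i}"

lemma tsm_ell:
  assumes "fin_mult mv" "1 \<le> i"
  shows "two_sided_mallows Bp Bm mv (ell mv i) = int (mallows_perm Bp i)"
proof -
  have "(THE j. 1 \<le> j \<and> ell mv j = ell mv i) = i"
    using ell_inj[OF assms(1)] assms(2) by (intro the_equality) (auto dest: inj_onD)
  then show ?thesis using assms(2) by (auto simp: two_sided_mallows_def)
qed

text \<open>The hole with index \<open>i\<close> \<le> 0 has \<open>- i\<close> holes to its right,
  so the argument \<open>1 - i\<close> of the negative-side permutation is one more than that
  number.\<close>

lemma tsm_hole:
  assumes "z \<notin> particles mv"
  shows "two_sided_mallows Bp Bm mv z = 1 - int (mallows_perm Bm (Suc (holes_above (particles mv) z)))"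
  using assms by (simp add: two_sided_mallows_def particles_def holes_above_def)

context
  fixes Bp Bm :: "nat \<Rightarrow> nat \<Rightarrow> bool" and mv :: "nat \<Rightarrow> nat" and \<sigma> :: "int \<Rightarrow> int"
  assumes Bp: "rich Bp" and Bm: "rich Bm" and mv: "fin_mult mv"
  defines "\<sigma> \<equiv> two_sided_mallows Bp Bm mv"
begin

lemma maya_particles: "maya (particles mv)"
  using charged_particles[OF mv] by (simp add: charged_def)

lemma tsm_pos_iff: "0 < \<sigma> z \<longleftrightarrow> z \<in> particles mv"
proof (cases "z \<in> particles mv")
  case True
  then obtain i where "1 \<le> i" "z = ell mv i" by (auto simp: particles_def)
  then show ?thesis using tsm_ell[OF mv, of i Bp Bm] mallows_perm_props(1)[OF Bp, of i] True
    by (simp add: \<sigma>_def)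
next
  case False
  then show ?thesis
    using tsm_hole[OF False, of Bp Bm] mallows_perm_props(1)[OF Bm, of "Suc (holes_above (particles mv) z)"]
    by (simp add: \<sigma>_def)
qed

lemma inj_tsm: "inj \<sigma>"
proof (rule injI)
  fix x y assume eq: "\<sigma> x = \<sigma> y"
  show "x = y"
  proof (cases "x \<in> particles mv")
    case True
    then have "y \<in> particles mv" using eq tsm_pos_iff by metis
    then obtain i j where "1 \<le> i" "x = ell mv i" "1 \<le> j" "y = ell mv j"
      using True by (auto simp: particles_def)
    then show ?thesis
      using eq tsm_ell[OF mv, of _ Bp Bm] mallows_perm_inj[OF Bp, of i j] by (simp add: \<sigma>_def)
  next
    case False
    then have y: "y \<notin> particles mv" using eq tsm_pos_iff by metis
    have "holes_above (particles mv) x = holes_above (particles mv) y"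
      using eq tsm_hole[OF False, of Bp Bm] tsm_hole[OF y, of Bp Bm]
        mallows_perm_inj[OF Bm, of "Suc (holes_above (particles mv) x)" "Suc (holes_above (particles mv) y)"]
      by (simp add: \<sigma>_def)
    then show ?thesis using holes_above_inj[OF maya_particles False y] by blast
  qed
qed

lemma tsm_pos_value:
  assumes "1 \<le> v"
  shows "\<sigma> (ell mv (mallows_perm (flip Bp) v)) = int v"
  using tsm_ell[OF mv, of "mallows_perm (flip Bp) v" Bp Bm] mallows_perm_flip[OF Bp assms]
    mallows_perm_props(1)[OF rich_flip[OF Bp] assms] by (simp add: \<sigma>_def)

lemma tsm_neg_value:
  assumes "1 \<le> v"
  shows "\<exists>k. k \<notin> particles mv \<and> Suc (holes_above (particles mv) k) = mallows_perm (flip Bm) v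
    \<and> \<sigma> k = 1 - int v"
proof -
  obtain k where k: "k \<notin> particles mv" "holes_above (particles mv) k = mallows_perm (flip Bm) v - 1"
    using maya_nth_hole[OF maya_particles] by blast
  have "Suc (holes_above (particles mv) k) = mallows_perm (flip Bm) v"
    using k mallows_perm_props(1)[OF rich_flip[OF Bm] assms] by simp
  then show ?thesis
    using tsm_hole[OF k(1), of Bp Bm] mallows_perm_flip[OF Bm assms] k by (auto simp: \<sigma>_def)
qed

lemma bij_tsm: "bij \<sigma>"
proof (rule bijI[OF inj_tsm], safe)
  fix z :: int
  show "z \<in> range \<sigma>"
  proof (cases "1 \<le> z")
    case True
    then show ?thesis using tsm_pos_value[of "nat z"] by (metis int_nat_eq nat_le_iff nat_one_as_int not_one_le_zero of_nat_1 order_trans rangeI zle_int zero_le_one)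
  next
    case False
    then show ?thesis using tsm_neg_value[of "nat (1 - z)"] by force
  qed
qed simp

text \<open>Values above a positive value are positive, so all of them sit on particles, and
  \<open>ell\<close> preserves the order of positions.\<close>

lemma rcode_tsm:
  assumes v: "1 \<le> v"
  shows "rcode \<sigma> (int v) = mcode Bp v"
proof -
  define t where "t = mallows_perm (flip Bp) v"
  have t: "1 \<le> t" using mallows_perm_props(1)[OF rich_flip[OF Bp] v] by (simp add: t_def)
  have inv: "inv \<sigma> (int v) = ell mv t"
    using tsm_pos_value[OF v] inj_tsm by (metis inv_f_eq t_def)
  have "{i. i < ell mv t \<and> int v < \<sigma> i} = ell mv ` {j\<in>{1..<t}. v < mallows_perm Bp j}"
  proof (intro set_eqI iffI)
    fix i assume i: "i \<in> {i. i < ell mv t \<and> int v < \<sigma> i}"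
    then have "i \<in> particles mv" using tsm_pos_iff[of i] v by auto
    then obtain j where j: "1 \<le> j" "i = ell mv j" by (auto simp: particles_def)
    then have "j < t" using i ell_strict_mono[OF mv t, of j] by (cases j t rule: linorder_cases) auto
    then show "i \<in> ell mv ` {j\<in>{1..<t}. v < mallows_perm Bp j}"
      using i j tsm_ell[OF mv, of j Bp Bm] by (auto simp: \<sigma>_def)
  next
    fix i assume "i \<in> ell mv ` {j\<in>{1..<t}. v < mallows_perm Bp j}"
    then obtain j where "1 \<le> j" "j < t" "v < mallows_perm Bp j" "i = ell mv j" by auto
    then show "i \<in> {i. i < ell mv t \<and> int v < \<sigma> i}"
      using ell_strict_mono[OF mv, of j t] tsm_ell[OF mv, of j Bp Bm] by (simp add: \<sigma>_def)
  qed
  then have "rcode \<sigma> (int v) = card (ell mv ` {j\<in>{1..<t}. v < mallows_perm Bp j})"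
    by (simp only: rcode_def inv)
  also have "\<dots> = card {j\<in>{1..<t}. v < mallows_perm Bp j}"
    by (rule card_image, rule inj_on_subset[OF ell_inj[OF mv]]) auto
  finally show ?thesis by (simp add: mcode_def t_def)
qed

text \<open>Holes are numbered from right to left and values are reflected by \<open>1 - v\<close>.
  Both orders reverse, so larger values before become smaller values after.\<close>

lemma lcode_tsm:
  assumes v: "1 \<le> v"
  shows "lcode \<sigma> (1 - int v) = mcode Bm v"
proof -
  define t where "t = mallows_perm (flip Bm) v"
  let ?L = "particles mv" and ?h = "\<lambda>i. Suc (holes_above (particles mv) i)"
  obtain k where k: "k \<notin> ?L" "?h k = t" "\<sigma> k = 1 - int v"
    using tsm_neg_value[OF v] by (auto simp: t_def)
  have inv: "inv \<sigma> (1 - int v) = k"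
    using k(3) inj_tsm by (metis inv_f_eq)
  have "bij_betw ?h {i. k < i \<and> \<sigma> i < 1 - int v} {j\<in>{1..<t}. v < mallows_perm Bm j}"
  proof (rule bij_betw_imageI)
    have hole: "i \<notin> ?L" if "\<sigma> i < 1 - int v" for i using tsm_pos_iff[of i] that v by auto
    show "inj_on ?h {i. k < i \<and> \<sigma> i < 1 - int v}"
      using holes_above_inj[OF maya_particles] hole by (auto simp: inj_on_def)
    show "?h ` {i. k < i \<and> \<sigma> i < 1 - int v} = {j\<in>{1..<t}. v < mallows_perm Bm j}"
    proof (intro set_eqI iffI)
      fix j assume "j \<in> ?h ` {i. k < i \<and> \<sigma> i < 1 - int v}"
      then obtain i where i: "k < i" "\<sigma> i < 1 - int v" "j = ?h i" by auto
      then show "j \<in> {j\<in>{1..<t}. v < mallows_perm Bm j}"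
        using hole[OF i(2)] tsm_hole[of i mv Bp Bm] holes_above_strict[OF maya_particles, of i k] k(2)
        by (auto simp: \<sigma>_def)
    next
      fix j assume j: "j \<in> {j\<in>{1..<t}. v < mallows_perm Bm j}"
      obtain i where i: "i \<notin> ?L" "holes_above ?L i = j - 1" using maya_nth_hole[OF maya_particles] by blast
      then have hi: "?h i = j" using j by simp
      then have "?h i < ?h k" using j k by simp
      then have "k < i"
        using holes_above_antimono[OF maya_particles, of i k] by (meson Suc_less_eq linorder_not_less)
      moreover have "\<sigma> i < 1 - int v" using tsm_hole[OF i(1), of Bp Bm] hi j by (simp add: \<sigma>_def)
      ultimately show "j \<in> ?h ` {i. k < i \<and> \<sigma> i < 1 - int v}" using hi by blast
    qed
  qed
  then have "card {i. k < i \<and> \<sigma> i < 1 - int v} = card {j\<in>{1..<t}. v < mallows_perm Bm j}"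
    by (rule bij_betw_same_card)
  then show ?thesis by (simp add: lcode_def inv mcode_def t_def)
qed

lemma upset_0: "upset \<sigma> 0 = particles mv"
  using tsm_pos_iff by (auto simp: upset_def)

end

section \<open>Moving the cut by one value\<close>

lemma upset_Suc: "bij \<sigma> \<Longrightarrow> upset \<sigma> (s + 1) = insert (inv \<sigma> (- s)) (upset \<sigma> s)"
proof -
  assume b: "bij \<sigma>"
  have "\<sigma> i = - s \<longleftrightarrow> i = inv \<sigma> (- s)" for i
    using b by (metis bij_inv_eq_iff)
  moreover have "- (s + 1) < \<sigma> i \<longleftrightarrow> \<sigma> i = - s \<or> - s < \<sigma> i" for i by auto
  ultimately show ?thesis by (auto simp: upset_def)
qed

lemma inv_notin_upset: "bij \<sigma> \<Longrightarrow> inv \<sigma> (- s) \<notin> upset \<sigma> s"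
  by (simp add: upset_def bij_is_surj surj_f_inv_f)

lemma charged_upset:
  assumes "bij \<sigma>" "charged 0 (upset \<sigma> 0)"
  shows "charged (int s) (upset \<sigma> (int s))"
proof (induction s)
  case (Suc s)
  then show ?case
    using charged_insert[OF Suc inv_notin_upset[OF assms(1)]] upset_Suc[OF assms(1), of "int s"]
    by (simp add: add.commute)
qed (use assms in simp)

lemma rcode_upset: "rcode \<sigma> (- s) = card {l\<in>upset \<sigma> s. l < inv \<sigma> (- s)}"
  unfolding rcode_def upset_def by (rule arg_cong[where f = card]) auto

lemma lcode_upset:
  assumes "bij \<sigma>"
  shows "lcode \<sigma> (- s) = holes_above (upset \<sigma> s) (inv \<sigma> (- s))"
  unfolding lcode_def upset_def holes_above_def
proof (rule arg_cong[where f = card], safe)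
  fix x assume x: "inv \<sigma> (- s) < x" "\<not> - s < \<sigma> x"
  then have "\<sigma> x \<noteq> - s" using assms by (metis bij_inv_eq_iff less_irrefl)
  then show "\<sigma> x < - s" using x by simp
qed auto

text \<open>Moving value \<open>- s\<close> across the cut: its particle rank in the new configuration together with
  that configuration carries the same information as its hole rank together with the old one.\<close>

lemma upset_step:
  assumes \<sigma>: "bij \<sigma>" and L: "maya L" and k: "k \<in> L"
  shows "upset \<sigma> (s + 1) = L \<and> rcode \<sigma> (- s) = card {l\<in>L. l < k} \<longleftrightarrow>
    upset \<sigma> s = L - {k} \<and> lcode \<sigma> (- s) = holes_above L k"
proof -
  define p where "p = inv \<sigma> (- s)"
  have p: "p \<notin> upset \<sigma> s" using inv_notin_upset[OF \<sigma>] by (simp add: p_def)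
  have up: "upset \<sigma> (s + 1) = insert p (upset \<sigma> s)" using upset_Suc[OF \<sigma>] by (simp add: p_def)
  have r: "rcode \<sigma> (- s) = card {l\<in>insert p (upset \<sigma> s). l < p}"
    unfolding rcode_upset p_def[symmetric] by (rule arg_cong[where f = card]) auto
  have l: "lcode \<sigma> (- s) = holes_above (upset \<sigma> s) p"
    using lcode_upset[OF \<sigma>] by (simp add: p_def)
  have h: "holes_above (insert x A) x = holes_above A x" for x A
    unfolding holes_above_def by (rule arg_cong[where f = card]) auto
  show ?thesis
  proof
    assume a: "upset \<sigma> (s + 1) = L \<and> rcode \<sigma> (- s) = card {l\<in>L. l < k}"
    then have Lp: "L = insert p (upset \<sigma> s)" using up by simp
    have "p = k"
      by (rule card_below_inj[of _ L]) (use a r Lp k maya_finite(2)[OF L] in auto)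
    then show "upset \<sigma> s = L - {k} \<and> lcode \<sigma> (- s) = holes_above L k"
      using Lp p l h[of p "upset \<sigma> s"] by auto
  next
    assume a: "upset \<sigma> s = L - {k} \<and> lcode \<sigma> (- s) = holes_above L k"
    have kL: "insert k (L - {k}) = L" using k by auto
    have "p = k"
    proof (rule holes_above_inj[OF maya_remove[OF L, of k]])
      show "holes_above (L - {k}) p = holes_above (L - {k}) k"
        using a l h[of k "L - {k}"] kL by metis
    qed (use a p in auto)
    then show "upset \<sigma> (s + 1) = L \<and> rcode \<sigma> (- s) = card {l\<in>L. l < k}"
      using a up r kL by metis
  qed
qed

lemma rcode_finite:
  assumes "bij \<sigma>" "charged 0 (upset \<sigma> 0)"
  shows "finite {i. i < x \<and> z < \<sigma> i}"
proof -
  \<comment> \<open>The level is truncated at 0: for positive \<open>z\<close> the positions already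
    lie in the set of the original cut.\<close>
  define s where "s = nat (- z)"
  have "maya (upset \<sigma> (int s))" using charged_upset[OF assms] by (simp add: charged_def)
  from maya_finite(2)[OF this, of x] show ?thesis
    by (rule rev_finite_subset) (auto simp: upset_def s_def)
qed

section \<open>Discrete random variables\<close>

lemma (in prob_space) emeasure_discrete_split:
  fixes X :: "'a \<Rightarrow> 'b"
  assumes E: "E \<in> events" and I: "countable I"
    and X: "\<And>y. y \<in> I \<Longrightarrow> {\<omega>\<in>E. X \<omega> = y} \<in> events" "\<And>\<omega>. \<omega> \<in> E \<Longrightarrow> X \<omega> \<in> I"
  shows "emeasure M E = (\<integral>\<^sup>+y. emeasure M {\<omega>\<in>E. X \<omega> = y} \<partial>count_space I)"
proof -
  have "E = (\<Union>y\<in>I. {\<omega>\<in>E. X \<omega> = y})" using X(2) by auto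
  then have "emeasure M E = emeasure M (\<Union>y\<in>I. {\<omega>\<in>E. X \<omega> = y})" by simp
  also have "\<dots> = (\<integral>\<^sup>+y. emeasure M {\<omega>\<in>E. X \<omega> = y} \<partial>count_space I)"
    by (rule emeasure_UN_countable) (use I X(1) in \<open>auto simp: disjoint_family_on_def\<close>)
  finally show ?thesis .
qed

lemma (in prob_space) indep_vars_prob_Ball:
  assumes "indep_vars (\<lambda>_. count_space UNIV) X I" "finite J" "J \<subseteq> I"
  shows "prob {\<omega>\<in>space M. \<forall>i\<in>J. X i \<omega> \<in> A i} = (\<Prod>i\<in>J. prob {\<omega>\<in>space M. X i \<omega> \<in> A i})"
proof (cases "J = {}")
  case True
  then show ?thesis by (simp add: prob_space)
next
  case False
  have "{\<omega>\<in>space M. \<forall>i\<in>J. X i \<omega> \<in> A i} = (\<Inter>i\<in>J. X i -` A i \<inter> space M)"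
    using False by auto
  moreover have "X i -` A i \<inter> space M = {\<omega>\<in>space M. X i \<omega> \<in> A i}" for i by auto
  ultimately show ?thesis
    using indep_varsD[OF assms(1) False assms(2,3), of A] by simp
qed

text \<open>The coordinates in \<open>D\<close> are summed out one at a time; each disappears
  because \<open>p j\<close> has total mass one.\<close>

lemma (in prob_space) joint_law_marginal:
  fixes X :: "'i \<Rightarrow> 'a \<Rightarrow> 'b::countable" and p :: "'i \<Rightarrow> 'b \<Rightarrow> real"
  assumes [measurable]: "\<And>i. X i \<in> measurable M (count_space UNIV)"
    and p0: "\<And>i y. 0 \<le> p i y" and p1: "\<And>i. (\<integral>\<^sup>+y. ennreal (p i y) \<partial>count_space UNIV) = 1"
    and J: "finite J" and D: "finite D"
    and joint: "\<And>x. prob {\<omega>\<in>space M. \<forall>i\<in>J \<union> D. X i \<omega> = x i} = (\<Prod>i\<in>J \<union> D. p i (x i))"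
  shows "prob {\<omega>\<in>space M. \<forall>i\<in>J. X i \<omega> = x i} = (\<Prod>i\<in>J. p i (x i))"
  using D joint
proof (induction D arbitrary: x rule: finite_induct)
  case (insert j D)
  show ?case
  proof (cases "j \<in> J \<union> D")
    case True
    then have "J \<union> insert j D = J \<union> D" by auto
    then have "prob {\<omega>\<in>space M. \<forall>i\<in>J \<union> D. X i \<omega> = x i} = (\<Prod>i\<in>J \<union> D. p i (x i))" for x
      using insert.prems[of x] by simp
    then show ?thesis by (rule insert.IH)
  next
    case False
    have "prob {\<omega>\<in>space M. \<forall>i\<in>J \<union> D. X i \<omega> = x i} = (\<Prod>i\<in>J \<union> D. p i (x i))" for x
    proof -
      let ?E = "{\<omega>\<in>space M. \<forall>i\<in>J \<union> D. X i \<omega> = x i}"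
      have fin: "finite (J \<union> D)" using J insert by simp
      have [measurable]: "?E \<in> events"
        using fin by measurable
      have eq: "emeasure M {\<omega>\<in>?E. X j \<omega> = y} = ennreal (\<Prod>i\<in>J \<union> D. p i (x i)) * ennreal (p j y)" for y
      proof -
        have "{\<omega>\<in>?E. X j \<omega> = y} = {\<omega>\<in>space M. \<forall>i\<in>J \<union> insert j D. X i \<omega> = (x(j := y)) i}"
          using False by auto
        also have "emeasure M \<dots> = ennreal (\<Prod>i\<in>J \<union> insert j D. p i ((x(j := y)) i))"
          using insert.prems[of "x(j := y)"] by (simp add: emeasure_eq_measure)
        also have "(\<Prod>i\<in>J \<union> insert j D. p i ((x(j := y)) i)) = p j y * (\<Prod>i\<in>J \<union> D. p i ((x(j := y)) i))"
          using fin False by simp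
        also have "(\<Prod>i\<in>J \<union> D. p i ((x(j := y)) i)) = (\<Prod>i\<in>J \<union> D. p i (x i))"
          by (rule prod.cong) (use False in auto)
        finally show ?thesis using p0 by (simp add: ennreal_mult mult.commute prod_nonneg)
      qed
      have "emeasure M ?E = (\<integral>\<^sup>+y. emeasure M {\<omega>\<in>?E. X j \<omega> = y} \<partial>count_space UNIV)"
        by (rule emeasure_discrete_split) auto
      also have "\<dots> = ennreal (\<Prod>i\<in>J \<union> D. p i (x i))"
        unfolding eq by (simp add: nn_integral_cmult p1)
      finally show ?thesis
        using p0 by (simp add: emeasure_eq_measure prod_nonneg)
    qed
    then show ?thesis by (rule insert.IH)
  qed
qed simp

text \<open>A product law on a cofinal family of finite index sets is enough, because smaller sets
  are reached by summing out. Joint laws below are computed only on windows around 0, so this is the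
  form that fits.\<close>

lemma (in prob_space) indep_vars_of_joint_law:
  fixes X :: "'i \<Rightarrow> 'a \<Rightarrow> 'b::countable" and p :: "'i \<Rightarrow> 'b \<Rightarrow> real"
  assumes [measurable]: "\<And>i. X i \<in> measurable M (count_space UNIV)"
    and p0: "\<And>i y. 0 \<le> p i y" and p1: "\<And>i. (\<integral>\<^sup>+y. ennreal (p i y) \<partial>count_space UNIV) = 1"
    and joint: "\<And>J. finite J \<Longrightarrow> \<exists>J'. finite J' \<and> J \<subseteq> J' \<and>
      (\<forall>x. prob {\<omega>\<in>space M. \<forall>i\<in>J'. X i \<omega> = x i} = (\<Prod>i\<in>J'. p i (x i)))"
  shows "indep_vars (\<lambda>_. count_space UNIV) X UNIV"
    and "prob {\<omega>\<in>space M. X i \<omega> = y} = p i y"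
proof -
  have law: "prob {\<omega>\<in>space M. \<forall>i\<in>J. X i \<omega> = x i} = (\<Prod>i\<in>J. p i (x i))" if J: "finite J" for J x
  proof -
    obtain J' where J': "finite J'" "J \<subseteq> J'"
      and j: "\<And>x. prob {\<omega>\<in>space M. \<forall>i\<in>J'. X i \<omega> = x i} = (\<Prod>i\<in>J'. p i (x i))"
      using joint[OF J] by blast
    have "J \<union> J' = J'" using J'(2) by blast
    then have "prob {\<omega>\<in>space M. \<forall>i\<in>J \<union> J'. X i \<omega> = x i} = (\<Prod>i\<in>J \<union> J'. p i (x i))" for x
      using j[of x] by simp
    then show ?thesis by (rule joint_law_marginal[OF assms(1) p0 p1 J J'(1)])
  qed
  show marg: "prob {\<omega>\<in>space M. X i \<omega> = y} = p i y" for i y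
    using law[of "{i}" "\<lambda>_. y"] by simp
  \<comment> \<open>The atoms alone are not closed under intersection, as different atoms are
    disjoint; adding the empty set makes them an intersection-stable generator.\<close>
  define F where "F i = insert {} (range (\<lambda>y. X i -` {y} \<inter> space M))" for i
  have F_ev: "F i \<subseteq> events" for i
    by (auto simp: F_def)
  have ind: "indep_sets F UNIV"
  proof (rule indep_setsI)
    show "F i \<subseteq> events" for i by (rule F_ev)
    fix A J assume J: "J \<noteq> {}" "J \<subseteq> UNIV" "finite J" and A: "\<forall>j\<in>J. A j \<in> F j"
    show "prob (\<Inter>j\<in>J. A j) = (\<Prod>j\<in>J. prob (A j))"
    proof (cases "\<exists>j\<in>J. A j = {}")
      case True
      then have "(\<Inter>j\<in>J. A j) = {}" by auto
      moreover have "(\<Prod>j\<in>J. prob (A j)) = 0"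
        using True J(3) by (intro prod_zero) (auto, metis measure_empty)
      ultimately show ?thesis by (simp only: measure_empty)
    next
      case False
      then have "\<forall>j\<in>J. \<exists>y. A j = X j -` {y} \<inter> space M" using A by (simp add: F_def image_iff)
      then obtain x where x: "\<And>j. j \<in> J \<Longrightarrow> A j = X j -` {x j} \<inter> space M" by metis
      then have "(\<Inter>j\<in>J. A j) = {\<omega>\<in>space M. \<forall>i\<in>J. X i \<omega> = x i}" using J by auto
      moreover have "prob (A j) = p j (x j)" if "j \<in> J" for j
      proof -
        have "A j = {\<omega>\<in>space M. X j \<omega> = x j}" using x[OF that] by auto
        then show ?thesis using marg by simp
      qed
      ultimately show ?thesis using law[OF J(3)] by simp
    qed
  qed
  have "Int_stable (F i)" for i
  proof (rule Int_stableI)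
    fix a b assume "a \<in> F i" "b \<in> F i"
    then have "a \<inter> b = {} \<or> a \<inter> b = a" by (auto simp: F_def)
    then show "a \<inter> b \<in> F i" using \<open>a \<in> F i\<close> by (metis F_def insertI1)
  qed
  then have "indep_sets (\<lambda>i. sigma_sets (space M) (F i)) UNIV"
    by (intro indep_sets_sigma[OF ind])
  moreover have "{X i -` A \<inter> space M |A. A \<in> sets (count_space UNIV)} \<subseteq> sigma_sets (space M) (F i)" for i
  proof safe
    fix A :: "'b set"
    have "X i -` A \<inter> space M = \<Union>((\<lambda>y. X i -` {y} \<inter> space M) ` A)" by auto
    also have "\<dots> \<in> sigma_sets (space M) (F i)"
      by (rule sigma_sets_UNION) (auto simp: F_def)
    finally show "X i -` A \<inter> space M \<in> sigma_sets (space M) (F i)" .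
  qed
  ultimately have "indep_sets (\<lambda>i. {X i -` A \<inter> space M |A. A \<in> sets (count_space UNIV)}) UNIV"
    by (rule indep_sets_mono_sets)
  then show "indep_vars (\<lambda>_. count_space UNIV) X UNIV"
    unfolding indep_vars_def2 using assms(1) by blast
qed

lemma nn_integral_geom:
  assumes "0 \<le> q" "q < 1"
  shows "(\<integral>\<^sup>+n. ennreal (q ^ n * (1 - q)) \<partial>count_space UNIV) = 1"
proof -
  have "(\<lambda>n. q ^ n * (1 - q)) sums (1 / (1 - q) * (1 - q))"
    using assms by (intro sums_mult2 geometric_sums) auto
  then have "(\<lambda>n. q ^ n * (1 - q)) sums 1" using assms by simp
  then have "(\<Sum>n. ennreal (q ^ n * (1 - q))) = ennreal 1"
    using assms by (intro suminf_ennreal_eq) auto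
  then show ?thesis by (simp add: nn_integral_count_space_nat)
qed

section \<open>Enumerating unbounded sets of integers\<close>

lemma int_enumeration_exists:
  fixes S :: "int set"
  assumes lo: "\<And>x. \<exists>y\<in>S. y < x" and hi: "\<And>x. \<exists>y\<in>S. x < y" and x0: "x0 \<in> S"
  shows "\<exists>r. strict_mono r \<and> range r = S \<and> r (0::int) = x0"
proof -
  define U where "U = {n. x0 + int n \<in> S}"
  define D where "D = {n. x0 - int n \<in> S}"
  have U: "infinite U" unfolding infinite_nat_iff_unbounded
  proof
    fix m obtain y where "y \<in> S" "x0 + int m < y" using hi by blast
    then show "\<exists>n>m. n \<in> U" by (intro exI[of _ "nat (y - x0)"]) (auto simp: U_def)
  qed
  have D: "infinite D" unfolding infinite_nat_iff_unbounded
  proof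
    fix m obtain y where "y \<in> S" "y < x0 - int m" using lo by blast
    then show "\<exists>n>m. n \<in> D" by (intro exI[of _ "nat (x0 - y)"]) (auto simp: D_def)
  qed
  have U0: "enumerate U 0 = 0" and D0: "enumerate D 0 = 0"
    unfolding enumerate_0 using x0 by (auto simp: U_def D_def intro!: Least_equality)
  define r where "r k = (if 0 \<le> k then x0 + int (enumerate U (nat k)) else x0 - int (enumerate D (nat (- k))))" for k
  have "strict_mono r"
  proof (rule strict_monoI)
    fix i j :: int assume ij: "i < j"
    consider "0 \<le> i" | "i < 0" "0 \<le> j" | "j < 0" by linarith
    then show "r i < r j"
    proof cases
      case 2
      have "0 < enumerate D (nat (- i))"
        using enumerate_mono[of 0 "nat (- i)" D] D D0 2 by simp
      then show ?thesis using 2 by (simp add: r_def)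
    qed (use ij U D in \<open>auto simp: r_def\<close>)
  qed
  moreover have "range r = S"
  proof (intro set_eqI iffI)
    fix y assume "y \<in> range r"
    then show "y \<in> S"
      using enumerate_in_set[OF U] enumerate_in_set[OF D] by (auto simp: r_def U_def D_def)
  next
    fix y assume y: "y \<in> S"
    show "y \<in> range r"
    proof (cases "x0 \<le> y")
      case True
      then have "nat (y - x0) \<in> U" using y by (simp add: U_def)
      then obtain n where "enumerate U n = nat (y - x0)" using enumerate_Ex[OF U] by blast
      then have "r (int n) = y" using True by (simp add: r_def)
      then show ?thesis by blast
    next
      case False
      then have "nat (x0 - y) \<in> D" using y by (simp add: D_def)
      then obtain n where n: "enumerate D n = nat (x0 - y)" using enumerate_Ex[OF D] by blast
      then have "n \<noteq> 0" using D0 False by (metis diff_gt_0_iff_gt linorder_not_le zero_less_nat_eq less_irrefl)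
      then have "r (- int n) = y" using False n by (simp add: r_def)
      then show ?thesis by blast
    qed
  qed
  moreover have "r 0 = x0" by (simp add: r_def U0)
  ultimately show ?thesis by blast
qed

lemma strict_mono_int_gap:
  fixes r :: "int \<Rightarrow> int"
  assumes "strict_mono r" "r k < w" "w < r (k + 1)"
  shows "w \<notin> range r"
proof
  assume "w \<in> range r"
  then obtain j where "w = r j" by blast
  then have "k < j" "j < k + 1" using assms by (auto simp: strict_mono_less)
  then show False by simp
qed

text \<open>Determines the next term from the current one and the range alone. This drives
  inductions on the index, both for uniqueness and for measurability.\<close>

lemma int_enumeration_next:
  fixes r :: "int \<Rightarrow> int"
  assumes "strict_mono r"
  shows "r (k + 1) = x \<longleftrightarrow> x \<in> range r \<and> r k < x \<and> (\<forall>w. r k < w \<and> w < x \<longrightarrow> w \<notin> range r)"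
proof
  assume "r (k + 1) = x"
  moreover have "r k < r (k + 1)" using assms by (simp add: strict_mono_less)
  ultimately show "x \<in> range r \<and> r k < x \<and> (\<forall>w. r k < w \<and> w < x \<longrightarrow> w \<notin> range r)"
    using strict_mono_int_gap[OF assms, of k] by auto
next
  assume x: "x \<in> range r \<and> r k < x \<and> (\<forall>w. r k < w \<and> w < x \<longrightarrow> w \<notin> range r)"
  have "r k < r (k + 1)" using assms by (simp add: strict_mono_less)
  then show "r (k + 1) = x"
    using x strict_mono_int_gap[OF assms, of k x] by (meson linorder_neqE_linordered_idom rangeI)
qed

lemma int_enumeration_prev:
  fixes r :: "int \<Rightarrow> int"
  assumes "strict_mono r"
  shows "r (k - 1) = x \<longleftrightarrow> x \<in> range r \<and> x < r k \<and> (\<forall>w. x < w \<and> w < r k \<longrightarrow> w \<notin> range r)"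
proof
  assume "r (k - 1) = x"
  moreover have "r (k - 1) < r k" using assms by (simp add: strict_mono_less)
  ultimately show "x \<in> range r \<and> x < r k \<and> (\<forall>w. x < w \<and> w < r k \<longrightarrow> w \<notin> range r)"
    using strict_mono_int_gap[OF assms, of "k - 1"] by auto
next
  assume x: "x \<in> range r \<and> x < r k \<and> (\<forall>w. x < w \<and> w < r k \<longrightarrow> w \<notin> range r)"
  have "r (k - 1) < r k" using assms by (simp add: strict_mono_less)
  then show "r (k - 1) = x"
    using x strict_mono_int_gap[OF assms, of "k - 1" x] by (metis diff_add_cancel linorder_neqE_linordered_idom rangeI)
qed

lemma int_enumeration_unique:
  fixes r r' :: "int \<Rightarrow> int"
  assumes "strict_mono r" "strict_mono r'" "range r = range r'" "r 0 = r' 0"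
  shows "r = r'"
proof
  fix k show "r k = r' k"
  proof (induction k rule: int_induct[where k = 0])
    case (step1 i)
    then show ?case
      using int_enumeration_next[OF assms(1), of i "r' (i + 1)"] int_enumeration_next[OF assms(2), of i "r' (i + 1)"]
        assms(3) by simp
  next
    case (step2 i)
    then show ?case
      using int_enumeration_prev[OF assms(1), of i "r' (i - 1)"] int_enumeration_prev[OF assms(2), of i "r' (i - 1)"]
        assms(3) by simp
  qed (rule assms)
qed

section \<open>Record enumerations\<close>

definition is_rec_enum :: "(int \<Rightarrow> int) \<Rightarrow> (int \<Rightarrow> int) \<Rightarrow> bool" where
  "is_rec_enum \<sigma> r \<longleftrightarrow> strict_mono r \<and> range r = records \<sigma> \<and> \<sigma> (r 0) \<le> 0 \<and> 0 < \<sigma> (r 1)"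

text \<open>Countably many conditions on single values, hence measurable, and equivalent to the
  existence of a standard enumeration.\<close>

definition enumerable_records :: "(int \<Rightarrow> int) \<Rightarrow> bool" where
  "enumerable_records \<sigma> \<longleftrightarrow> (\<forall>x. \<exists>y. y \<in> records \<sigma> \<and> y < x) \<and> (\<forall>x. \<exists>y. y \<in> records \<sigma> \<and> x < y) \<and>
     (\<exists>y. y \<in> records \<sigma> \<and> \<sigma> y \<le> 0) \<and> (\<exists>y. y \<in> records \<sigma> \<and> 0 < \<sigma> y)"

lemma records_mono: "r' \<in> records \<sigma> \<Longrightarrow> r < r' \<Longrightarrow> \<sigma> r < \<sigma> r'"
  by (simp add: records_def)

text \<open>Values increase along records, so the last record with value \<le> 0 is well determined
  and anchors the numbering.\<close>

lemma is_rec_enum_0: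
  assumes "is_rec_enum \<sigma> r"
  shows "r 0 = x \<longleftrightarrow> x \<in> records \<sigma> \<and> \<sigma> x \<le> 0 \<and> (\<forall>y. y \<in> records \<sigma> \<and> x < y \<longrightarrow> 0 < \<sigma> y)"
proof -
  have r: "strict_mono r" "range r = records \<sigma>" "\<sigma> (r 0) \<le> 0" "0 < \<sigma> (r 1)"
    using assms unfolding is_rec_enum_def by simp_all
  have in_rec: "r k \<in> records \<sigma>" for k using r(2) by (metis rangeI)
  have up: "0 < \<sigma> y" if "y \<in> records \<sigma>" "r 0 < y" for y
  proof -
    have "y \<in> range r" using that r(2) by simp
    then obtain j where j: "y = r j" by (rule rangeE)
    then have "0 < j" using that r(1) by (simp add: strict_mono_less)
    then have "r 1 \<le> r j" using r(1) by (simp add: strict_mono_less_eq)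
    then show ?thesis using r(4) records_mono[OF that(1), of "r 1"] j by (cases "r 1 = r j") auto
  qed
  show ?thesis
  proof
    assume "r 0 = x"
    then show "x \<in> records \<sigma> \<and> \<sigma> x \<le> 0 \<and> (\<forall>y. y \<in> records \<sigma> \<and> x < y \<longrightarrow> 0 < \<sigma> y)"
      using r(3) up in_rec[of 0] by simp
  next
    assume x: "x \<in> records \<sigma> \<and> \<sigma> x \<le> 0 \<and> (\<forall>y. y \<in> records \<sigma> \<and> x < y \<longrightarrow> 0 < \<sigma> y)"
    show "r 0 = x"
      using x up[of x] r(3) in_rec[of 0] by (cases "r 0" x rule: linorder_cases) auto
  qed
qed

lemma is_rec_enum_unique: "is_rec_enum \<sigma> r \<Longrightarrow> is_rec_enum \<sigma> r' \<Longrightarrow> r = r'"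
  using is_rec_enum_0[of \<sigma> r "r 0"] is_rec_enum_0[of \<sigma> r' "r 0"]
  by (intro int_enumeration_unique) (simp_all add: is_rec_enum_def)

lemma rec_enum_eq: "is_rec_enum \<sigma> r \<Longrightarrow> rec_enum \<sigma> = r"
  unfolding rec_enum_def is_rec_enum_def[symmetric]
  by (rule the_equality) (simp_all add: is_rec_enum_unique)

lemma enumerable_records_iff: "(\<exists>r. is_rec_enum \<sigma> r) \<longleftrightarrow> enumerable_records \<sigma>"
proof
  assume "\<exists>r. is_rec_enum \<sigma> r"
  then obtain r :: "int \<Rightarrow> int" where r: "strict_mono r" "range r = records \<sigma>" "\<sigma> (r 0) \<le> 0" "0 < \<sigma> (r 1)"
    unfolding is_rec_enum_def by (elim exE conjE)
  have in_rec: "r k \<in> records \<sigma>" for k using r(2) by (metis rangeI)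
  have up: "x < r (max 0 (x - r 0 + 1))" for x
  proof -
    have "r 0 + int n \<le> r (int n)" for n
    proof (induction n)
      case (Suc n)
      have "r (int n) < r (int (Suc n))" using r(1) by (simp add: strict_mono_less)
      then show ?case using Suc by simp
    qed simp
    from this[of "nat (max 0 (x - r 0 + 1))"] show ?thesis by auto
  qed
  have down: "r (- max 0 (r 0 - x + 1)) < x" for x
  proof -
    have "r (- int n) \<le> r 0 - int n" for n
    proof (induction n)
      case (Suc n)
      have "r (- int (Suc n)) < r (- int n)" using r(1) by (simp add: strict_mono_less)
      then show ?case using Suc by simp
    qed simp
    from this[of "nat (max 0 (r 0 - x + 1))"] show ?thesis by auto
  qed
  show "enumerable_records \<sigma>"
    unfolding enumerable_records_def using up down in_rec r(3,4) by meson
next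
  assume e: "enumerable_records \<sigma>"
  then obtain y1 y2 where y1: "y1 \<in> records \<sigma>" "\<sigma> y1 \<le> 0" and y2: "y2 \<in> records \<sigma>" "0 < \<sigma> y2"
    by (auto simp: enumerable_records_def)
  have lt: "y < y2" if "\<sigma> y \<le> 0" "y \<in> records \<sigma>" for y
    using records_mono[OF that(2), of y2] y2 that by (cases y y2 rule: linorder_cases) auto
  define A where "A = {y \<in> records \<sigma>. \<sigma> y \<le> 0 \<and> y1 \<le> y}"
  \<comment> \<open>Records with value \<le> 0 lie to the left of the record \<open>y2\<close> with
    positive value, so there is a last one.\<close>
  have "A \<subseteq> {y1..y2}" using lt by (auto simp: A_def less_imp_le)
  then have fin: "finite A" by (rule finite_subset) simp
  have ne: "A \<noteq> {}" using y1 by (auto simp: A_def)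
  define x0 where "x0 = Max A"
  have x0: "x0 \<in> A" using Max_in[OF fin ne] by (simp add: x0_def)
  have above: "0 < \<sigma> y" if "y \<in> records \<sigma>" "x0 < y" for y
  proof (rule ccontr)
    assume "\<not> 0 < \<sigma> y"
    then have "y \<in> A" using that x0 by (auto simp: A_def)
    then show False using that Max_ge[OF fin, of y] by (simp add: x0_def)
  qed
  have "\<exists>r. strict_mono r \<and> range r = records \<sigma> \<and> r (0::int) = x0"
    by (rule int_enumeration_exists)
      (use e x0 in \<open>simp_all add: enumerable_records_def A_def Bex_def\<close>)
  then obtain r :: "int \<Rightarrow> int" where r: "strict_mono r" "range r = records \<sigma>" "r 0 = x0"
    by (elim exE conjE)
  have "r 0 < r 1" using r(1) by (simp add: strict_mono_less)
  then have "is_rec_enum \<sigma> r"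
    using r x0 above[of "r 1"] rangeI[of r 1] unfolding is_rec_enum_def A_def by simp
  then show "\<exists>r. is_rec_enum \<sigma> r" by blast
qed

lemma rec_enum_valid: "enumerable_records \<sigma> \<Longrightarrow> is_rec_enum \<sigma> (rec_enum \<sigma>)"
  using enumerable_records_iff[of \<sigma>] rec_enum_eq[of \<sigma>] by auto

text \<open>Without an enumeration the description has no solution and denotes one fixed function,
  the same for all such \<sigma>, so measurability survives off the good event.\<close>

lemma rec_enum_junk:
  assumes "\<not> enumerable_records \<sigma>"
  shows "rec_enum \<sigma> = (THE r. False)"
proof -
  have "\<not> is_rec_enum \<sigma> r" for r using assms enumerable_records_iff by blast
  then show ?thesis unfolding rec_enum_def is_rec_enum_def[symmetric] by simp
qed

section \<open>Measurability of the redwood tree\<close>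

text \<open>A countable type has only countably many finite subsets, so the events that
  \<open>S\<close> equals a given finite set suffice; all infinite values share the default
  \<open>c\<close>. This covers \<open>card\<close>, finite sums and
  \<open>sorted_list_of_set\<close>, whose values on infinite sets are constants.\<close>

lemma measurable_finite_set_fun:
  fixes S :: "'a \<Rightarrow> 'b::countable set" and h :: "'b set \<Rightarrow> 'c"
  assumes [measurable]: "\<And>i. Measurable.pred M (\<lambda>\<omega>. i \<in> S \<omega>)"
    and h: "\<And>X. infinite X \<Longrightarrow> h X = c"
  shows "(\<lambda>\<omega>. h (S \<omega>)) \<in> measurable M (count_space UNIV)"
proof -
  have S: "{\<omega>\<in>space M. S \<omega> = F} \<in> sets M" for F
  proof -
    have "{\<omega>\<in>space M. S \<omega> = F} = {\<omega>\<in>space M. \<forall>i. i \<in> S \<omega> \<longleftrightarrow> i \<in> F}" by blast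
    also have "\<dots> \<in> sets M" by measurable
    finally show ?thesis .
  qed
  have U: "{\<omega>\<in>space M. S \<omega> \<in> \<F>} \<in> sets M" if "\<F> \<subseteq> Collect finite" for \<F>
  proof -
    have "countable \<F>" using that countable_Collect_finite countable_subset by blast
    then have "(\<Union>F\<in>\<F>. {\<omega>\<in>space M. S \<omega> = F}) \<in> sets M" using S by (intro sets.countable_UN'') auto
    moreover have "(\<Union>F\<in>\<F>. {\<omega>\<in>space M. S \<omega> = F}) = {\<omega>\<in>space M. S \<omega> \<in> \<F>}" by blast
    ultimately show ?thesis by simp
  qed
  have "(\<lambda>\<omega>. h (S \<omega>)) -` A \<inter> space M \<in> sets M" for A
  proof -
    have "(\<lambda>\<omega>. h (S \<omega>)) -` A \<inter> space M = {\<omega>\<in>space M. S \<omega> \<in> {F. finite F \<and> h F \<in> A}}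
      \<union> (if c \<in> A then space M - {\<omega>\<in>space M. S \<omega> \<in> Collect finite} else {})"
      using h by (auto split: if_splits)
    also have "\<dots> \<in> sets M" using U[of "{F. finite F \<and> h F \<in> A}"] U[of "Collect finite"] by auto
    finally show ?thesis .
  qed
  then show ?thesis unfolding measurable_def by auto
qed

lemma measurable_card_countable:
  fixes S :: "'a \<Rightarrow> 'b::countable set"
  assumes "\<And>i. Measurable.pred M (\<lambda>\<omega>. i \<in> S \<omega>)"
  shows "(\<lambda>\<omega>. card (S \<omega>)) \<in> measurable M (count_space UNIV)"
  by (rule measurable_finite_set_fun[OF assms]) simp

lemma measurable_count_comp:
  assumes "f \<in> measurable M (count_space UNIV)"
  shows "(\<lambda>\<omega>. g (f \<omega>)) \<in> measurable M (count_space UNIV)"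
  using measurable_compose[OF assms, of g "count_space UNIV"] by simp

lemma measurable_count_comp2:
  fixes f :: "'a \<Rightarrow> 'b::countable"
  assumes "f \<in> measurable M (count_space UNIV)" "\<And>x. g x \<in> measurable M (count_space UNIV)"
  shows "(\<lambda>\<omega>. g (f \<omega>) \<omega>) \<in> measurable M (count_space UNIV)"
  by (rule measurable_compose_countable[OF assms(2,1)])

lemma measurable_mallows_perm:
  fixes B :: "'a \<Rightarrow> nat \<Rightarrow> nat \<Rightarrow> bool"
  assumes B: "\<And>i j. 1 \<le> i \<Longrightarrow> 1 \<le> j \<Longrightarrow> Measurable.pred M (\<lambda>\<omega>. B \<omega> i j)"
  shows "(\<lambda>\<omega>. mallows_perm (B \<omega>) n) \<in> measurable M (count_space UNIV)"
proof -
  have "(\<lambda>\<omega>. mall_list (B \<omega>) n) \<in> measurable M (count_space UNIV)" for n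
  proof (induction n)
    case (Suc n)
    have "Measurable.pred M (\<lambda>\<omega>. 1 \<le> j \<and> j \<notin> set xs \<and> B \<omega> (Suc n) j)" for j and xs :: "nat list"
    proof (cases "1 \<le> j \<and> j \<notin> set xs")
      case True
      then show ?thesis using B[of "Suc n" j] by simp
    next
      case False
      then have "(\<lambda>\<omega>. 1 \<le> j \<and> j \<notin> set xs \<and> B \<omega> (Suc n) j) = (\<lambda>\<omega>. False)" by auto
      then show ?thesis by (simp only: measurable_const space_count_space UNIV_I)
    qed
    then have "(\<lambda>\<omega>. LEAST j. 1 \<le> j \<and> j \<notin> set xs \<and> B \<omega> (Suc n) j) \<in> measurable M (count_space UNIV)"
      for xs :: "nat list"
      by (rule measurable_Least)
    then have "(\<lambda>\<omega>. xs @ [LEAST j. 1 \<le> j \<and> j \<notin> set xs \<and> B \<omega> (Suc n) j]) \<in> measurable M (count_space UNIV)"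
      for xs :: "nat list"
      by (rule measurable_count_comp)
    then show ?case
      unfolding mall_list.simps Let_def by (rule measurable_count_comp2[OF Suc])
  qed simp
  then show ?thesis unfolding mallows_perm_def by (rule measurable_count_comp)
qed

text \<open>With infinitely many nonzero multiplicities each \<open>tailsum\<close> ranges over an
  infinite set and is 0 by convention, so nothing is shifted. Hence \<open>ell\<close> is injective
  for every outcome, and the \<open>THE\<close> in \<open>two_sided_mallows\<close> is measurable
  everywhere.\<close>

lemma ell_junk:
  assumes "\<not> fin_mult mv" "1 \<le> i"
  shows "ell mv i = int i"
proof -
  have "tailsum mv i' = 0" if "1 \<le> i'" for i'
  proof -
    have "{i. 1 \<le> i \<and> mv i \<noteq> 0} \<subseteq> {1..<i'} \<union> {i''. i' \<le> i'' \<and> mv i'' \<noteq> 0}" by auto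
    then have "infinite {i''. i' \<le> i'' \<and> mv i'' \<noteq> 0}"
      using assms(1) unfolding fin_mult_def by (meson finite_UnI finite_atLeastLessThan finite_subset)
    then show ?thesis by (simp add: tailsum_def)
  qed
  then have "{i'. 1 \<le> i' \<and> i \<le> tailsum mv i'} = {}" using assms(2) by auto
  then show ?thesis by (simp only: ell_def Lam_def card.empty of_nat_0 diff_zero)
qed

lemma ell_inj_total: "inj_on (ell mv) {1..}"
proof (cases "fin_mult mv")
  case True then show ?thesis by (rule ell_inj)
next
  case False
  then show ?thesis by (auto simp: inj_on_def ell_junk)
qed

lemma measurable_ell:
  fixes mv :: "'a \<Rightarrow> nat \<Rightarrow> nat"
  assumes mv: "\<And>i. 1 \<le> i \<Longrightarrow> (\<lambda>\<omega>. mv \<omega> i) \<in> measurable M (count_space UNIV)"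
  shows "(\<lambda>\<omega>. ell (mv \<omega>) j) \<in> measurable M (count_space UNIV)"
proof -
  have t: "(\<lambda>\<omega>. tailsum (mv \<omega>) i) \<in> measurable M (count_space UNIV)" if i: "1 \<le> i" for i
  proof -
    \<comment> \<open>Recording index and multiplicity together makes the tail sum a function of one
      random set.\<close>
    define S where "S \<omega> = (\<lambda>i'. (i', mv \<omega> i')) ` {i'. i \<le> i' \<and> mv \<omega> i' \<noteq> 0}" for \<omega>
    have eq: "tailsum (mv \<omega>) i = (\<Sum>x\<in>S \<omega>. snd x)" for \<omega>
      unfolding S_def tailsum_def by (subst sum.reindex) (auto simp: inj_on_def)
    have "Measurable.pred M (\<lambda>\<omega>. x \<in> S \<omega>)" for x
    proof (cases "i \<le> fst x \<and> snd x \<noteq> 0")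
      case True
      then have [measurable]: "(\<lambda>\<omega>. mv \<omega> (fst x)) \<in> measurable M (count_space UNIV)" using mv i by simp
      have "(\<lambda>\<omega>. x \<in> S \<omega>) = (\<lambda>\<omega>. mv \<omega> (fst x) = snd x)"
        using True by (auto simp: S_def fun_eq_iff image_iff)
      then show ?thesis by simp
    next
      case False
      then have "(\<lambda>\<omega>. x \<in> S \<omega>) = (\<lambda>\<omega>. False)" by (auto simp: S_def fun_eq_iff image_iff)
      then show ?thesis by simp
    qed
    then show ?thesis unfolding eq by (rule measurable_finite_set_fun) simp
  qed
  have "Measurable.pred M (\<lambda>\<omega>. i \<in> {i. 1 \<le> i \<and> j \<le> tailsum (mv \<omega>) i})" for i
    using measurable_count_comp[OF t, of i "\<lambda>x. j \<le> x"] by (cases "1 \<le> i") auto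
  then have "(\<lambda>\<omega>. Lam (mv \<omega>) j) \<in> measurable M (count_space UNIV)"
    unfolding Lam_def by (rule measurable_card_countable)
  then show ?thesis unfolding ell_def by (rule measurable_count_comp)
qed

lemma measurable_two_sided_mallows:
  fixes Bp Bm :: "'a \<Rightarrow> nat \<Rightarrow> nat \<Rightarrow> bool" and mv :: "'a \<Rightarrow> nat \<Rightarrow> nat"
  assumes Bp: "\<And>i j. 1 \<le> i \<Longrightarrow> 1 \<le> j \<Longrightarrow> Measurable.pred M (\<lambda>\<omega>. Bp \<omega> i j)"
    and Bm: "\<And>i j. 1 \<le> i \<Longrightarrow> 1 \<le> j \<Longrightarrow> Measurable.pred M (\<lambda>\<omega>. Bm \<omega> i j)"
    and mv: "\<And>i. 1 \<le> i \<Longrightarrow> (\<lambda>\<omega>. mv \<omega> i) \<in> measurable M (count_space UNIV)"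
  shows "(\<lambda>\<omega>. two_sided_mallows (Bp \<omega>) (Bm \<omega>) (mv \<omega>) z) \<in> measurable M (count_space UNIV)"
proof -
  note [measurable] = measurable_ell[of mv M, OF mv]
  have [measurable]: "Measurable.pred M (\<lambda>\<omega>. z \<in> ell (mv \<omega>) ` {1..})" for z
  proof -
    have "(\<lambda>\<omega>. z \<in> ell (mv \<omega>) ` {1..}) = (\<lambda>\<omega>. \<exists>i. 1 \<le> i \<and> ell (mv \<omega>) i = z)" by (auto simp: fun_eq_iff)
    also have "Measurable.pred M \<dots>" by measurable
    finally show ?thesis .
  qed
  have the: "(\<lambda>\<omega>. THE i. 1 \<le> i \<and> ell (mv \<omega>) i = z) \<in> measurable M (count_space UNIV)"
    by (rule measurable_THE[where I = UNIV]) (use ell_inj_total in \<open>auto dest: inj_onD\<close>)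
  have crd: "(\<lambda>\<omega>. card {w. w \<notin> ell (mv \<omega>) ` {1..} \<and> z < w}) \<in> measurable M (count_space UNIV)"
    by (rule measurable_card_countable) (unfold mem_Collect_eq, measurable)
  have 1: "(\<lambda>\<omega>. mallows_perm (Bp \<omega>) (THE i. 1 \<le> i \<and> ell (mv \<omega>) i = z)) \<in> measurable M (count_space UNIV)"
    by (rule measurable_count_comp2[OF the]) (rule measurable_mallows_perm[OF Bp])
  have 2: "(\<lambda>\<omega>. mallows_perm (Bm \<omega>) (1 + card {w. w \<notin> ell (mv \<omega>) ` {1..} \<and> z < w})) \<in> measurable M (count_space UNIV)"
    by (rule measurable_count_comp2[OF crd, where g = "\<lambda>n \<omega>. mallows_perm (Bm \<omega>) (1 + n)"])
      (rule measurable_mallows_perm[OF Bm])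
  show ?thesis unfolding two_sided_mallows_def Let_def
  proof (rule measurable_If)
    show "{\<omega>\<in>space M. z \<in> ell (mv \<omega>) ` {1..}} \<in> sets M" by measurable
  qed (use measurable_count_comp[OF 1, of int] measurable_count_comp[OF 2, of "\<lambda>n. 1 - int n"] in auto)
qed

section \<open>From a measurable random permutation to its measurable redwood tree\<close>

context
  fixes \<sigma> :: "'a \<Rightarrow> int \<Rightarrow> int" and M :: "'a measure"
  assumes \<sigma>[measurable]: "\<And>z. (\<lambda>\<omega>. \<sigma> \<omega> z) \<in> measurable M (count_space UNIV)"
begin

lemma pred_records[measurable]: "Measurable.pred M (\<lambda>\<omega>. r \<in> records (\<sigma> \<omega>))"
  unfolding records_def mem_Collect_eq by measurable

lemma pred_enumerable_records[measurable]: "Measurable.pred M (\<lambda>\<omega>. enumerable_records (\<sigma> \<omega>))"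
  unfolding enumerable_records_def by measurable

text \<open>Induction on the index, away from 0 in both directions; each step names the adjacent
  record through quantifiers over integers only.\<close>

lemma pred_rec_enum: "Measurable.pred M (\<lambda>\<omega>. enumerable_records (\<sigma> \<omega>) \<and> rec_enum (\<sigma> \<omega>) k = x)"
proof (induction k arbitrary: x rule: int_induct[where k = 0])
  case base
  have "(\<lambda>\<omega>. enumerable_records (\<sigma> \<omega>) \<and> rec_enum (\<sigma> \<omega>) 0 = x) = (\<lambda>\<omega>. enumerable_records (\<sigma> \<omega>) \<and>
    x \<in> records (\<sigma> \<omega>) \<and> \<sigma> \<omega> x \<le> 0 \<and> (\<forall>y. y \<in> records (\<sigma> \<omega>) \<and> x < y \<longrightarrow> 0 < \<sigma> \<omega> y))"
    using is_rec_enum_0[OF rec_enum_valid] by (auto simp: fun_eq_iff)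
  also have "Measurable.pred M \<dots>" by measurable
  finally show ?case .
next
  case (step1 i)
  note [measurable] = step1(2)
  have "(\<lambda>\<omega>. enumerable_records (\<sigma> \<omega>) \<and> rec_enum (\<sigma> \<omega>) (i + 1) = x) =
    (\<lambda>\<omega>. \<exists>y. (enumerable_records (\<sigma> \<omega>) \<and> rec_enum (\<sigma> \<omega>) i = y) \<and> x \<in> records (\<sigma> \<omega>) \<and> y < x \<and>
       (\<forall>w. y < w \<and> w < x \<longrightarrow> w \<notin> records (\<sigma> \<omega>)))"
  proof
    fix \<omega>
    show "(enumerable_records (\<sigma> \<omega>) \<and> rec_enum (\<sigma> \<omega>) (i + 1) = x) =
      (\<exists>y. (enumerable_records (\<sigma> \<omega>) \<and> rec_enum (\<sigma> \<omega>) i = y) \<and> x \<in> records (\<sigma> \<omega>) \<and> y < x \<and>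
       (\<forall>w. y < w \<and> w < x \<longrightarrow> w \<notin> records (\<sigma> \<omega>)))"
    proof (cases "enumerable_records (\<sigma> \<omega>)")
      case True
      from rec_enum_valid[OF this] have r: "strict_mono (rec_enum (\<sigma> \<omega>))" "range (rec_enum (\<sigma> \<omega>)) = records (\<sigma> \<omega>)"
        unfolding is_rec_enum_def by simp_all
      show ?thesis using int_enumeration_next[OF r(1), of i x] True unfolding r(2) by simp
    qed simp
  qed
  also have "Measurable.pred M \<dots>" by measurable
  finally show ?case .
next
  case (step2 i)
  note [measurable] = step2(2)
  have "(\<lambda>\<omega>. enumerable_records (\<sigma> \<omega>) \<and> rec_enum (\<sigma> \<omega>) (i - 1) = x) =
    (\<lambda>\<omega>. \<exists>y. (enumerable_records (\<sigma> \<omega>) \<and> rec_enum (\<sigma> \<omega>) i = y) \<and> x \<in> records (\<sigma> \<omega>) \<and> x < y \<and>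
       (\<forall>w. x < w \<and> w < y \<longrightarrow> w \<notin> records (\<sigma> \<omega>)))"
  proof
    fix \<omega>
    show "(enumerable_records (\<sigma> \<omega>) \<and> rec_enum (\<sigma> \<omega>) (i - 1) = x) =
      (\<exists>y. (enumerable_records (\<sigma> \<omega>) \<and> rec_enum (\<sigma> \<omega>) i = y) \<and> x \<in> records (\<sigma> \<omega>) \<and> x < y \<and>
       (\<forall>w. x < w \<and> w < y \<longrightarrow> w \<notin> records (\<sigma> \<omega>)))"
    proof (cases "enumerable_records (\<sigma> \<omega>)")
      case True
      from rec_enum_valid[OF this] have r: "strict_mono (rec_enum (\<sigma> \<omega>))" "range (rec_enum (\<sigma> \<omega>)) = records (\<sigma> \<omega>)"
        unfolding is_rec_enum_def by simp_all
      show ?thesis using int_enumeration_prev[OF r(1), of i x] True unfolding r(2) by simp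
    qed simp
  qed
  also have "Measurable.pred M \<dots>" by measurable
  finally show ?case .
qed

lemma measurable_rec_enum: "(\<lambda>\<omega>. rec_enum (\<sigma> \<omega>) k) \<in> measurable M (count_space UNIV)"
proof -
  have "Measurable.pred M (\<lambda>\<omega>. rec_enum (\<sigma> \<omega>) k = x)" for x
  proof -
    note [measurable] = pred_rec_enum
    have "(\<lambda>\<omega>. rec_enum (\<sigma> \<omega>) k = x) = (\<lambda>\<omega>. (enumerable_records (\<sigma> \<omega>) \<and> rec_enum (\<sigma> \<omega>) k = x) \<or>
       (\<not> enumerable_records (\<sigma> \<omega>) \<and> (THE r. False) k = x))"
      using rec_enum_junk by (intro ext) metis
    also have "Measurable.pred M \<dots>" by measurable
    finally show ?thesis .
  qed
  then have "(\<lambda>\<omega>. rec_enum (\<sigma> \<omega>) k) -` {x} \<inter> space M \<in> sets M" for x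
    unfolding vimage_def Int_def by (simp add: conj_commute pred_def)
  then show ?thesis by (simp add: measurable_count_space_eq2_countable)
qed

lemma measurable_seg: "(\<lambda>\<omega>. seg (\<sigma> \<omega>) k) \<in> measurable M (count_space UNIV)"
proof -
  have rv[measurable]: "(\<lambda>\<omega>. \<sigma> \<omega> (rec_enum (\<sigma> \<omega>) j)) \<in> measurable M (count_space UNIV)" for j
    by (rule measurable_count_comp2[OF measurable_rec_enum]) measurable
  have S: "(\<lambda>\<omega>. sorted_list_of_set {i. \<sigma> \<omega> (rec_enum (\<sigma> \<omega>) k) < \<sigma> \<omega> i \<and> \<sigma> \<omega> i < \<sigma> \<omega> (rec_enum (\<sigma> \<omega>) (k + 1))})
    \<in> measurable M (count_space UNIV)"
    by (rule measurable_finite_set_fun[where c = "[]"]) (unfold mem_Collect_eq, measurable)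
  have "(\<lambda>\<omega>. map (\<sigma> \<omega>) xs) \<in> measurable M (count_space UNIV)" for xs
  proof (induction xs)
    case (Cons x xs)
    have "(\<lambda>\<omega>. y # map (\<sigma> \<omega>) xs) \<in> measurable M (count_space UNIV)" for y
      by (rule measurable_count_comp[OF Cons])
    then show ?case
      unfolding list.map by (rule measurable_count_comp2[OF \<sigma>])
  qed simp
  then show ?thesis unfolding seg_def Let_def
    by (rule measurable_count_comp2[OF S])
qed

lemma measurable_RW: "(\<lambda>\<omega>. RW (\<sigma> \<omega>)) \<in> measurable M tree_space"
  unfolding tree_space_def
proof (rule measurable_measure_of)
  fix A assume "A \<in> range (\<lambda>w::word. {S. w \<in> S})"
  then obtain w :: word where w: "A = {S. w \<in> S}" by blast
  have "Measurable.pred M (\<lambda>\<omega>. w = one_pow k \<or> w \<in> (\<lambda>w. one_pow k @ L0 # w) ` bst (seg (\<sigma> \<omega>) k))" for k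
    using measurable_count_comp[OF measurable_seg, of "\<lambda>xs. w = one_pow k \<or> w \<in> (\<lambda>w. one_pow k @ L0 # w) ` bst xs" k]
    by simp
  then have [measurable]: "Measurable.pred M (\<lambda>\<omega>. \<exists>k. w = one_pow k \<or> w \<in> (\<lambda>w. one_pow k @ L0 # w) ` bst (seg (\<sigma> \<omega>) k))"
    by measurable
  have "(\<lambda>\<omega>. RW (\<sigma> \<omega>)) -` A \<inter> space M =
    {\<omega>\<in>space M. \<exists>k. w = one_pow k \<or> w \<in> (\<lambda>w. one_pow k @ L0 # w) ` bst (seg (\<sigma> \<omega>) k)}"
    unfolding w RW_def by blast
  also have "\<dots> \<in> sets M" by measurable
  finally show "(\<lambda>\<omega>. RW (\<sigma> \<omega>)) -` A \<inter> space M \<in> sets M" .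
qed auto

end

section \<open>The law of the inversion codes\<close>

locale mallows_driver = prob_space M for M :: "'a measure" +
  fixes q :: real and Z :: "drv_idx \<Rightarrow> 'a \<Rightarrow> nat"
  assumes q: "0 \<le> q" "q < 1"
    and indep: "indep_vars (\<lambda>_. count_space UNIV) Z drv_index_set"
    and lawBP: "\<And>i j. 1 \<le> i \<Longrightarrow> 1 \<le> j \<Longrightarrow> prob {\<omega> \<in> space M. Z (BP i j) \<omega> = 1} = 1 - q"
    and lawBM: "\<And>i j. 1 \<le> i \<Longrightarrow> 1 \<le> j \<Longrightarrow> prob {\<omega> \<in> space M. Z (BM i j) \<omega> = 1} = 1 - q"
    and lawMV: "\<And>i m. 1 \<le> i \<Longrightarrow> prob {\<omega> \<in> space M. Z (MV i) \<omega> = m} = q ^ (i * m) * (1 - q ^ i)"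
begin

definition Bp :: "'a \<Rightarrow> nat \<Rightarrow> nat \<Rightarrow> bool" where "Bp \<omega> i j \<longleftrightarrow> Z (BP i j) \<omega> = 1"
definition Bm :: "'a \<Rightarrow> nat \<Rightarrow> nat \<Rightarrow> bool" where "Bm \<omega> i j \<longleftrightarrow> Z (BM i j) \<omega> = 1"
definition mv :: "'a \<Rightarrow> nat \<Rightarrow> nat" where "mv \<omega> i = Z (MV i) \<omega>"
definition perm :: "'a \<Rightarrow> int \<Rightarrow> int" where "perm \<omega> = two_sided_mallows (Bp \<omega>) (Bm \<omega>) (mv \<omega>)"

lemma Z_measurable: "x \<in> drv_index_set \<Longrightarrow> Z x \<in> measurable M (count_space UNIV)"
  using indep by (auto simp: indep_vars_def)

lemma Z_BP_measurable: "1 \<le> i \<Longrightarrow> 1 \<le> j \<Longrightarrow> Z (BP i j) \<in> measurable M (count_space UNIV)"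
  and Z_BM_measurable: "1 \<le> i \<Longrightarrow> 1 \<le> j \<Longrightarrow> Z (BM i j) \<in> measurable M (count_space UNIV)"
  and Z_MV_measurable: "1 \<le> i \<Longrightarrow> Z (MV i) \<in> measurable M (count_space UNIV)"
  by (rule Z_measurable, simp add: drv_index_set_def)+

lemma perm_measurable [measurable]: "(\<lambda>\<omega>. perm \<omega> z) \<in> measurable M (count_space UNIV)"
  unfolding perm_def
proof (rule measurable_two_sided_mallows)
  fix i j :: nat assume ij: "1 \<le> i" "1 \<le> j"
  show "Measurable.pred M (\<lambda>\<omega>. Bp \<omega> i j)" "Measurable.pred M (\<lambda>\<omega>. Bm \<omega> i j)"
    unfolding Bp_def Bm_def
    using measurable_count_comp[OF Z_BP_measurable[OF ij], of "\<lambda>x. x = 1"]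
      measurable_count_comp[OF Z_BM_measurable[OF ij], of "\<lambda>x. x = 1"] by simp_all
next
  fix i :: nat assume "1 \<le> i"
  then show "(\<lambda>\<omega>. mv \<omega> i) \<in> measurable M (count_space UNIV)"
    unfolding mv_def by (rule Z_MV_measurable)
qed

text \<open>Failure at \<open>n\<close> given indices has probability \<open>q ^ n\<close>, which
  tends to 0. The sequence \<open>x\<close> runs along a row or a column of either array.\<close>

lemma AE_infinitely_often:
  fixes x :: "nat \<Rightarrow> drv_idx"
  assumes x: "\<And>j. 1 \<le> j \<Longrightarrow> x j \<in> drv_index_set" and inj: "inj x"
    and law: "\<And>j. 1 \<le> j \<Longrightarrow> prob {\<omega> \<in> space M. Z (x j) \<omega> = 1} = 1 - q"
  shows "AE \<omega> in M. infinite {j. Z (x j) \<omega> = 1}"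
proof -
  have meas: "{\<omega> \<in> space M. Z (x j) \<omega> \<noteq> 1} \<in> events" if "1 \<le> j" for j
  proof -
    have [measurable]: "Z (x j) \<in> measurable M (count_space UNIV)" using Z_measurable[OF x[OF that]] .
    show ?thesis by measurable
  qed
  have ne: "prob {\<omega> \<in> space M. Z (x j) \<omega> \<noteq> 1} = q" if "1 \<le> j" for j
  proof -
    have [measurable]: "Z (x j) \<in> measurable M (count_space UNIV)" using Z_measurable[OF x[OF that]] .
    have "prob {\<omega> \<in> space M. \<not> Z (x j) \<omega> = 1} = 1 - prob {\<omega> \<in> space M. Z (x j) \<omega> = 1}"
      by (rule prob_neg) measurable
    then show ?thesis using law[OF that] by simp
  qed
  have "AE \<omega> in M. \<exists>j>m. Z (x j) \<omega> = 1" for m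
  proof -
    define N where "N = {\<omega> \<in> space M. \<forall>j\<in>{m<..}. Z (x j) \<omega> \<noteq> 1}"
    have N: "N \<in> events"
    proof -
      have "{\<omega> \<in> space M. m < j \<longrightarrow> Z (x j) \<omega> \<noteq> 1} \<in> events" for j
        using meas[of j] by (cases "m < j") auto
      from sets.sets_Collect_countable_All[of M "\<lambda>j \<omega>. m < j \<longrightarrow> Z (x j) \<omega> \<noteq> 1", OF this]
      show ?thesis unfolding N_def Ball_def greaterThan_iff .
    qed
    have le: "prob N \<le> q ^ n" for n
    proof -
      let ?J = "x ` {m<..m + n}"
      have "prob N \<le> prob {\<omega> \<in> space M. \<forall>i\<in>?J. Z i \<omega> \<in> - {1}}"
      proof (rule finite_measure_mono)
        have "{\<omega> \<in> space M. \<forall>i\<in>?J. Z i \<omega> \<in> - {1}} = {\<omega> \<in> space M. \<forall>j\<in>{m<..m + n}. Z (x j) \<omega> \<noteq> 1}" by auto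
        also have "\<dots> \<in> events" by (rule sets.sets_Collect_finite_All) (use meas in auto)
        finally show "{\<omega> \<in> space M. \<forall>i\<in>?J. Z i \<omega> \<in> - {1}} \<in> events" .
      qed (auto simp: N_def)
      also have "\<dots> = (\<Prod>i\<in>?J. prob {\<omega> \<in> space M. Z i \<omega> \<in> - {1}})"
        by (rule indep_vars_prob_Ball[OF indep]) (use x in auto)
      also have "\<dots> = (\<Prod>j\<in>{m<..m + n}. q)"
        using inj ne by (subst prod.reindex) (auto simp: inj_on_def inj_def intro!: prod.cong)
      finally show ?thesis by simp
    qed
    have "(\<lambda>n. q ^ n) \<longlonglongrightarrow> 0" using q by (intro LIMSEQ_power_zero) simp
    then have "prob N \<le> 0" by (rule LIMSEQ_le_const) (use le in blast)
    then have "prob N = 0" by (simp add: antisym)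
    then have "AE \<omega> in M. \<omega> \<notin> N" using N by (simp add: AE_iff_measurable emeasure_eq_measure prob_eq_0 AE_not_in null_setsI)
    then show ?thesis
      by (rule AE_mp) (auto simp: N_def intro!: AE_I2)
  qed
  then have "AE \<omega> in M. \<forall>m. \<exists>j>m. Z (x j) \<omega> = 1"
    by (simp add: AE_all_countable)
  then show ?thesis by (simp add: infinite_nat_iff_unbounded)
qed

definition good :: "'a \<Rightarrow> bool" where
  "good \<omega> \<longleftrightarrow> rich (Bp \<omega>) \<and> rich (Bm \<omega>) \<and> fin_mult (mv \<omega>)"

lemma AE_good: "AE \<omega> in M. good \<omega>"
proof -
  have 1: "AE \<omega> in M. infinite {j. Z (BP i j) \<omega> = 1}" "AE \<omega> in M. infinite {j. Z (BP j i) \<omega> = 1}"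
    "AE \<omega> in M. infinite {j. Z (BM i j) \<omega> = 1}" "AE \<omega> in M. infinite {j. Z (BM j i) \<omega> = 1}" if "1 \<le> i" for i
    by (rule AE_infinitely_often; use that lawBP lawBM in \<open>simp add: drv_index_set_def inj_def\<close>)+
  have "AE \<omega> in M. rich (Bp \<omega>)" "AE \<omega> in M. rich (Bm \<omega>)"
    unfolding rich_def Bp_def Bm_def using 1
    by (auto simp: AE_all_countable)
  moreover have "AE \<omega> in M. fin_mult (mv \<omega>)"
  proof -
    \<comment> \<open>A part of size \<open>i\<close> occurs with probability \<open>q ^ i\<close>,
      which is summable; Borel-Cantelli leaves finitely many sizes.\<close>
    define A where "A n = {\<omega> \<in> space M. Z (MV (Suc n)) \<omega> \<noteq> 0}" for n
    have A: "A n \<in> events" "prob (A n) = q ^ Suc n" for n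
    proof -
      have [measurable]: "Z (MV (Suc n)) \<in> measurable M (count_space UNIV)" by (rule Z_MV_measurable) simp
      show "A n \<in> events" unfolding A_def by measurable
      have "prob {\<omega> \<in> space M. \<not> Z (MV (Suc n)) \<omega> = 0} = 1 - prob {\<omega> \<in> space M. Z (MV (Suc n)) \<omega> = 0}"
        by (rule prob_neg) measurable
      then show "prob (A n) = q ^ Suc n" using lawMV[of "Suc n" 0] by (simp add: A_def)
    qed
    have "summable (\<lambda>n. q ^ Suc n)"
      using q by (subst summable_Suc_iff) (auto intro: summable_geometric)
    then have "AE \<omega> in M. eventually (\<lambda>n. \<omega> \<in> space M - A n) sequentially"
      using A by (intro borel_cantelli_AE1) (auto simp: emeasure_eq_measure)
    then show ?thesis
    proof (rule AE_mp, intro AE_I2 impI)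
      fix \<omega> assume "\<omega> \<in> space M" "\<forall>\<^sub>F n in sequentially. \<omega> \<in> space M - A n"
      then obtain N where N: "\<And>n. N \<le> n \<Longrightarrow> Z (MV (Suc n)) \<omega> = 0"
        by (auto simp: eventually_sequentially A_def)
      have "i \<le> N" if "1 \<le> i" "mv \<omega> i \<noteq> 0" for i
        using N[of "i - 1"] that by (cases i; cases "N \<le> i - 1") (auto simp: mv_def)
      then have "{i. 1 \<le> i \<and> mv \<omega> i \<noteq> 0} \<subseteq> {..N}" by auto
      then show "fin_mult (mv \<omega>)" unfolding fin_mult_def by (rule finite_subset) simp
    qed
  qed
  ultimately show ?thesis unfolding good_def by auto
qed

lemma good_perm:
  assumes "good \<omega>"
  shows "bij (perm \<omega>)" "upset (perm \<omega>) 0 = particles (mv \<omega>)" "charged 0 (upset (perm \<omega>) 0)"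
    "\<And>v. 1 \<le> v \<Longrightarrow> rcode (perm \<omega>) (int v) = mcode (Bp \<omega>) v"
    "\<And>v. 1 \<le> v \<Longrightarrow> lcode (perm \<omega>) (1 - int v) = mcode (Bm \<omega>) v"
proof -
  have g: "rich (Bp \<omega>)" "rich (Bm \<omega>)" "fin_mult (mv \<omega>)" using assms by (auto simp: good_def)
  show "bij (perm \<omega>)" "upset (perm \<omega>) 0 = particles (mv \<omega>)"
    "\<And>v. 1 \<le> v \<Longrightarrow> rcode (perm \<omega>) (int v) = mcode (Bp \<omega>) v"
    "\<And>v. 1 \<le> v \<Longrightarrow> lcode (perm \<omega>) (1 - int v) = mcode (Bm \<omega>) v"
    unfolding perm_def by (simp_all add: bij_tsm[OF g] upset_0[OF g] rcode_tsm[OF g] lcode_tsm[OF g])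
  then show "charged 0 (upset (perm \<omega>) 0)" using charged_particles[OF g(3)] by simp
qed

text \<open>Measurable versions of the two codes: the inverse of a map that is not bijective would be
  an arbitrary choice.\<close>

definition rc :: "int \<Rightarrow> 'a \<Rightarrow> nat" where
  "rc z \<omega> = card {i. (\<exists>p. perm \<omega> p = z \<and> i < p) \<and> z < perm \<omega> i}"

definition lc :: "int \<Rightarrow> 'a \<Rightarrow> nat" where
  "lc z \<omega> = card {i. (\<exists>p. perm \<omega> p = z \<and> p < i) \<and> perm \<omega> i < z}"

lemma rc_measurable [measurable]: "rc z \<in> measurable M (count_space UNIV)"
  unfolding rc_def by (rule measurable_card_countable) (unfold mem_Collect_eq, measurable)

lemma lc_measurable [measurable]: "lc z \<in> measurable M (count_space UNIV)"
  unfolding lc_def by (rule measurable_card_countable) (unfold mem_Collect_eq, measurable)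

lemma upset_measurable [measurable]: "Measurable.pred M (\<lambda>\<omega>. upset (perm \<omega>) s = L)"
proof -
  have "(\<lambda>\<omega>. upset (perm \<omega>) s = L) = (\<lambda>\<omega>. \<forall>i. - s < perm \<omega> i \<longleftrightarrow> i \<in> L)"
    by (auto simp: upset_def fun_eq_iff)
  also have "Measurable.pred M \<dots>" by measurable
  finally show ?thesis .
qed

lemma good_codes:
  assumes "good \<omega>"
  shows "rc z \<omega> = rcode (perm \<omega>) z" "lc z \<omega> = lcode (perm \<omega>) z"
proof -
  have "(\<exists>p. perm \<omega> p = z \<and> P p) \<longleftrightarrow> P (inv (perm \<omega>) z)" for P
    using good_perm(1)[OF assms] by (metis bij_inv_eq_iff)
  then show "rc z \<omega> = rcode (perm \<omega>) z" "lc z \<omega> = lcode (perm \<omega>) z"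
    by (simp_all add: rc_def lc_def rcode_def lcode_def)
qed

text \<open>The cells that \<open>mcode_event\<close> requires to succeed; \<open>code_idx\<close>
  collects these together with the cells required to fail. \<open>K\<close> stands for
  \<open>BP\<close> or \<open>BM\<close>.\<close>

definition code_ones :: "(nat \<Rightarrow> nat \<Rightarrow> drv_idx) \<Rightarrow> nat \<Rightarrow> (nat \<Rightarrow> nat) \<Rightarrow> drv_idx set" where
  "code_ones K V T = (\<lambda>v. K (T v) v) ` {1..V}"

definition code_idx :: "(nat \<Rightarrow> nat \<Rightarrow> drv_idx) \<Rightarrow> nat \<Rightarrow> (nat \<Rightarrow> nat) \<Rightarrow> drv_idx set" where
  "code_idx K V T = (\<lambda>(v, i). K i v) ` (SIGMA v:{1..V}. insert (T v) ({1..<T v} - T ` {1..<v}))"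

lemma mcode_event_idx:
  assumes B: "rich (\<lambda>i j. Z (K i j) \<omega> = 1)" and T: "places a V T"
    and K: "\<And>i j i' j'. K i j = K i' j' \<longleftrightarrow> i = i' \<and> j = j'"
  shows "(\<forall>v\<in>{1..V}. mcode (\<lambda>i j. Z (K i j) \<omega> = 1) v = a v) \<longleftrightarrow>
    (\<forall>x\<in>code_idx K V T. Z x \<omega> \<in> (if x \<in> code_ones K V T then {1} else - {1}))"
proof -
  have "K i v \<in> code_ones K V T \<longleftrightarrow> i = T v" if "v \<in> {1..V}" for i v
    using that K by (auto simp: code_ones_def)
  then show ?thesis
    unfolding mcode_event[OF B T] code_idx_def by auto
qed

text \<open>Column \<open>v\<close> contributes one success and \<open>a v\<close> failures.\<close>

lemma prod_code_idx:
  assumes K: "\<And>i j i' j'. K i j = K i' j' \<longleftrightarrow> i = i' \<and> j = j'"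
    and law: "\<And>i j. 1 \<le> i \<Longrightarrow> 1 \<le> j \<Longrightarrow> K i j \<in> drv_index_set"
       "\<And>i j. 1 \<le> i \<Longrightarrow> 1 \<le> j \<Longrightarrow> prob {\<omega> \<in> space M. Z (K i j) \<omega> = 1} = 1 - q"
    and T: "places a V T"
  shows "(\<Prod>x\<in>code_idx K V T. prob {\<omega> \<in> space M. Z x \<omega> \<in> (if x \<in> code_ones K V T then {1} else - {1})})
    = (\<Prod>v\<in>{1..V}. q ^ a v * (1 - q))"
proof -
  let ?f = "\<lambda>x. prob {\<omega> \<in> space M. Z x \<omega> \<in> (if x \<in> code_ones K V T then {1} else - {1})}"
  have f: "?f (K i v) = (if i = T v then 1 - q else q)" if "v \<in> {1..V}" "1 \<le> i" for i v
  proof -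
    have [measurable]: "Z (K i v) \<in> measurable M (count_space UNIV)"
      using Z_measurable law(1) that by simp
    have "prob {\<omega> \<in> space M. \<not> Z (K i v) \<omega> = 1} = 1 - prob {\<omega> \<in> space M. Z (K i v) \<omega> = 1}"
      by (rule prob_neg) measurable
    moreover have "K i v \<in> code_ones K V T \<longleftrightarrow> i = T v"
      using that K by (auto simp: code_ones_def)
    ultimately show ?thesis using law(2)[of i v] that by auto
  qed
  have "(\<Prod>x\<in>code_idx K V T. ?f x)
    = (\<Prod>(v, i)\<in>(SIGMA v:{1..V}. insert (T v) ({1..<T v} - T ` {1..<v})). ?f (K i v))"
    unfolding code_idx_def by (subst prod.reindex) (auto simp: inj_on_def K case_prod_beta)
  also have "\<dots> = (\<Prod>v\<in>{1..V}. \<Prod>i\<in>insert (T v) ({1..<T v} - T ` {1..<v}). ?f (K i v))"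
    by (subst prod.Sigma) auto
  also have "\<dots> = (\<Prod>v\<in>{1..V}. q ^ a v * (1 - q))"
  proof (rule prod.cong[OF refl])
    fix v assume v: "v \<in> {1..V}"
    have Tv: "1 \<le> T v" "card ({1..<T v} - T ` {1..<v}) = a v" using T v by (auto simp: places_def)
    have "(\<Prod>i\<in>insert (T v) ({1..<T v} - T ` {1..<v}). ?f (K i v))
      = (\<Prod>i\<in>insert (T v) ({1..<T v} - T ` {1..<v}). if i = T v then 1 - q else q)"
      by (rule prod.cong[OF refl], rule f) (use v Tv in auto)
    also have "\<dots> = (1 - q) * (\<Prod>i\<in>{1..<T v} - T ` {1..<v}. if i = T v then 1 - q else q)"
      by (subst prod.insert) auto
    also have "(\<Prod>i\<in>{1..<T v} - T ` {1..<v}. if i = T v then 1 - q else q) = (\<Prod>i\<in>{1..<T v} - T ` {1..<v}. q)"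
      by (rule prod.cong) auto
    also have "\<dots> = q ^ a v" using Tv(2) by simp
    finally show "(\<Prod>i\<in>insert (T v) ({1..<T v} - T ` {1..<v}). ?f (K i v)) = q ^ a v * (1 - q)"
      by (simp add: mult.commute)
  qed
  finally show ?thesis .
qed

text \<open>Euler's function of \<open>q\<close>, the normalising constant of the law with weight
  \<open>q\<close> to the size on partitions.\<close>

definition C :: real where "C = lim (\<lambda>n. \<Prod>i\<in>{1..n}. 1 - q ^ i)"

lemma C_limit: "(\<lambda>n. \<Prod>i\<in>{1..n}. 1 - q ^ i) \<longlonglongrightarrow> C"
  and C_nonneg: "0 \<le> C"
proof -
  let ?f = "\<lambda>n. \<Prod>i\<in>{1..n}. 1 - q ^ i"
  have f0: "0 \<le> 1 - q ^ i" "1 - q ^ i \<le> 1" for i using q by (simp_all add: power_le_one)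
  then have n0: "0 \<le> ?f n" for n by (intro prod_nonneg) auto
  have "decseq ?f"
    by (rule decseq_SucI) (use mult_left_le[OF f0(2) n0] in \<open>simp del: power_Suc\<close>)
  then have "convergent ?f"
    using n0 by (intro Bseq_monoseq_convergent decseq_imp_monoseq BseqI'[of _ "?f 0"]) (auto dest: decseqD[of _ 0] simp: abs_of_nonneg)
  then show "?f \<longlonglongrightarrow> C" unfolding C_def by (simp add: convergent_LIMSEQ_iff)
  then show "0 \<le> C" by (rule LIMSEQ_le_const) (use n0 in blast)
qed

text \<open>Infinitely many multiplicities are prescribed, so the probability is a limit over finite
  cylinders. Beyond the largest part the power of \<open>q\<close> stays constant and only the
  factors \<open>1 - q ^ i\<close> accumulate, with limit \<open>C\<close>.\<close>

lemma prob_MV_cylinder: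
  assumes J: "finite J" "J \<subseteq> drv_index_set" "\<And>i. MV i \<notin> J"
    and m: "fin_mult m"
  shows "prob {\<omega> \<in> space M. (\<forall>i\<ge>1. Z (MV i) \<omega> = m i) \<and> (\<forall>x\<in>J. Z x \<omega> \<in> A x)}
    = C * q ^ (\<Sum>i | 1 \<le> i \<and> m i \<noteq> 0. i * m i) * (\<Prod>x\<in>J. prob {\<omega> \<in> space M. Z x \<omega> \<in> A x})"
proof -
  let ?P = "\<Prod>x\<in>J. prob {\<omega> \<in> space M. Z x \<omega> \<in> A x}"
  define E where "E n = {\<omega> \<in> space M. (\<forall>i\<in>{1..n}. Z (MV i) \<omega> = m i) \<and> (\<forall>x\<in>J. Z x \<omega> \<in> A x)}" for n
  have Zm: "{\<omega> \<in> space M. Z x \<omega> \<in> B} \<in> events" if "x \<in> drv_index_set" for x B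
    using measurable_sets[OF Z_measurable[OF that], of B] by (simp add: vimage_def Int_def conj_commute)
  have MVidx: "MV i \<in> drv_index_set" if "1 \<le> i" for i using that by (simp add: drv_index_set_def)
  have E: "E n = {\<omega> \<in> space M. \<forall>x\<in>MV ` {1..n} \<union> J. Z x \<omega> \<in> (case x of MV i \<Rightarrow> {m i} | _ \<Rightarrow> A x)}" for n
  proof -
    have "(case x of MV i \<Rightarrow> {m i} | _ \<Rightarrow> A x) = A x" if "x \<in> J" for x
      using J(3) that by (cases x) auto
    then have "(\<forall>x\<in>J. Z x \<omega> \<in> (case x of MV i \<Rightarrow> {m i} | _ \<Rightarrow> A x)) \<longleftrightarrow> (\<forall>x\<in>J. Z x \<omega> \<in> A x)" for \<omega>
      by simp
    then show ?thesis by (simp add: E_def ball_Un)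
  qed
  have Eev: "E n \<in> events" for n
    unfolding E by (rule sets.sets_Collect_finite_All, rule Zm) (use J MVidx in auto)
  have Ep: "prob (E n) = (\<Prod>i\<in>{1..n}. q ^ (i * m i) * (1 - q ^ i)) * ?P" for n
  proof -
    let ?A = "\<lambda>x. case x of MV i \<Rightarrow> {m i} | _ \<Rightarrow> A x"
    have "prob (E n) = (\<Prod>x\<in>MV ` {1..n} \<union> J. prob {\<omega> \<in> space M. Z x \<omega> \<in> ?A x})"
      unfolding E by (rule indep_vars_prob_Ball[OF indep]) (use J MVidx in auto)
    also have "\<dots> = (\<Prod>x\<in>MV ` {1..n}. prob {\<omega> \<in> space M. Z x \<omega> \<in> ?A x}) *
        (\<Prod>x\<in>J. prob {\<omega> \<in> space M. Z x \<omega> \<in> ?A x})"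
      using J by (intro prod.union_disjoint) auto
    also have "(\<Prod>x\<in>MV ` {1..n}. prob {\<omega> \<in> space M. Z x \<omega> \<in> ?A x}) = (\<Prod>i\<in>{1..n}. q ^ (i * m i) * (1 - q ^ i))"
      by (subst prod.reindex) (auto simp: inj_on_def lawMV)
    also have "(\<Prod>x\<in>J. prob {\<omega> \<in> space M. Z x \<omega> \<in> ?A x}) = ?P"
      by (rule prod.cong[OF refl]) (use J(3) in \<open>auto split: drv_idx.splits\<close>)
    finally show ?thesis .
  qed
  have "decseq E" unfolding decseq_def E_def by fastforce
  then have lim: "(\<lambda>n. prob (E n)) \<longlonglongrightarrow> prob (\<Inter>n. E n)"
    using Eev by (intro finite_Lim_measure_decseq) auto
  have int: "(\<Inter>n. E n) = {\<omega> \<in> space M. (\<forall>i\<ge>1. Z (MV i) \<omega> = m i) \<and> (\<forall>x\<in>J. Z x \<omega> \<in> A x)}"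
  proof (intro set_eqI iffI)
    fix \<omega> assume w: "\<omega> \<in> (\<Inter>n. E n)"
    then have "\<omega> \<in> E i" for i by blast
    then show "\<omega> \<in> {\<omega> \<in> space M. (\<forall>i\<ge>1. Z (MV i) \<omega> = m i) \<and> (\<forall>x\<in>J. Z x \<omega> \<in> A x)}"
      unfolding E_def by fastforce
  qed (auto simp: E_def)
  let ?S = "{i. 1 \<le> i \<and> m i \<noteq> 0}"
  have fS: "finite ?S" using m by (simp add: fin_mult_def)
  then obtain N where "\<forall>i\<in>?S. i < N" using finite_nat_set_iff_bounded[of ?S] by auto
  then have N: "i < N" if "1 \<le> i" "m i \<noteq> 0" for i using that by simp
  have "prob (E n) = q ^ (\<Sum>i\<in>?S. i * m i) * ?P * (\<Prod>i\<in>{1..n}. 1 - q ^ i)" if "N \<le> n" for n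
  proof -
    have "(\<Prod>i\<in>{1..n}. q ^ (i * m i)) = q ^ (\<Sum>i\<in>{1..n}. i * m i)" by (simp add: power_sum)
    also have "(\<Sum>i\<in>{1..n}. i * m i) = (\<Sum>i\<in>?S. i * m i)"
    proof (rule sum.mono_neutral_right)
      have "i \<le> n" if "1 \<le> i" "m i \<noteq> 0" for i using N[OF that] \<open>N \<le> n\<close> by simp
      then show "?S \<subseteq> {1..n}" by auto
    qed auto
    finally show ?thesis unfolding Ep prod.distrib by simp
  qed
  then have "\<forall>\<^sub>F n in sequentially. prob (E n) = q ^ (\<Sum>i\<in>?S. i * m i) * ?P * (\<Prod>i\<in>{1..n}. 1 - q ^ i)"
    by (auto simp: eventually_sequentially)
  moreover have "(\<lambda>n. q ^ (\<Sum>i\<in>?S. i * m i) * ?P * (\<Prod>i\<in>{1..n}. 1 - q ^ i)) \<longlonglongrightarrow> q ^ (\<Sum>i\<in>?S. i * m i) * ?P * C"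
    by (intro tendsto_mult_left C_limit)
  ultimately have "(\<lambda>n. prob (E n)) \<longlonglongrightarrow> q ^ (\<Sum>i\<in>?S. i * m i) * ?P * C"
    using tendsto_cong by fast
  then show ?thesis
    using LIMSEQ_unique[OF lim] unfolding int by (simp add: mult_ac)
qed

end

context mallows_driver
begin

section \<open>Exchanging the dual code for the code across the moving cut\<close>

lemma rc_event_aux:
  assumes "good \<omega>"
  shows "(\<forall>v\<in>{1..V}. rc (int v) \<omega> = a v) \<longleftrightarrow> (\<forall>v\<in>{1..V}. mcode (\<lambda>i j. Z (BP i j) \<omega> = 1) v = a v)"
    "(\<forall>v\<in>{1..V}. lc (1 - int v) \<omega> = a v) \<longleftrightarrow> (\<forall>v\<in>{1..V}. mcode (\<lambda>i j. Z (BM i j) \<omega> = 1) v = a v)"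
proof -
  have "rc (int v) \<omega> = mcode (\<lambda>i j. Z (BP i j) \<omega> = 1) v" "lc (1 - int v) \<omega> = mcode (\<lambda>i j. Z (BM i j) \<omega> = 1) v"
    if "v \<in> {1..V}" for v
    using good_codes[OF assms] good_perm(4,5)[OF assms, of v] that
    by (auto simp: Bp_def[abs_def] Bm_def[abs_def])
  then show "(\<forall>v\<in>{1..V}. rc (int v) \<omega> = a v) \<longleftrightarrow> (\<forall>v\<in>{1..V}. mcode (\<lambda>i j. Z (BP i j) \<omega> = 1) v = a v)"
    "(\<forall>v\<in>{1..V}. lc (1 - int v) \<omega> = a v) \<longleftrightarrow> (\<forall>v\<in>{1..V}. mcode (\<lambda>i j. Z (BM i j) \<omega> = 1) v = a v)"
    by simp_all
qed

text \<open>\<open>mult_of\<close> and \<open>particles\<close> are mutually inverse at charge 0, so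
  a configuration is an event about the multiplicities alone.\<close>

lemma particles_event:
  assumes "good \<omega>" "charged 0 L"
  shows "upset (perm \<omega>) 0 = L \<longleftrightarrow> (\<forall>i\<ge>1. Z (MV i) \<omega> = mult_of L i)"
proof -
  have fm: "fin_mult (mv \<omega>)" using assms by (simp add: good_def)
  have up: "upset (perm \<omega>) 0 = particles (mv \<omega>)" using good_perm(2)[OF assms(1)] .
  show ?thesis
  proof
    assume "upset (perm \<omega>) 0 = L"
    then show "\<forall>i\<ge>1. Z (MV i) \<omega> = mult_of L i"
      using mult_of_particles[OF fm] up by (auto simp: mv_def)
  next
    assume a: "\<forall>i\<ge>1. Z (MV i) \<omega> = mult_of L i"
    \<comment> \<open>The multiplicity at index 0 is arbitrary, so the two functions need not
      coincide; \<open>Lam\<close> only reads tail sums from index 1 on.\<close>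
    have "tailsum (mv \<omega>) i = tailsum (mult_of L) i" if "1 \<le> i" for i
    proof -
      have e: "mv \<omega> i' = mult_of L i'" if "i \<le> i'" for i' using a that \<open>1 \<le> i\<close> by (simp add: mv_def)
      then have "{i'. i \<le> i' \<and> mv \<omega> i' \<noteq> 0} = {i'. i \<le> i' \<and> mult_of L i' \<noteq> 0}" by auto
      then show ?thesis unfolding tailsum_def using e by (intro sum.cong) auto
    qed
    then have "Lam (mv \<omega>) j = Lam (mult_of L) j" for j
      unfolding Lam_def by (intro arg_cong[where f = card]) auto
    then have "particles (mv \<omega>) = particles (mult_of L)"
      by (simp add: particles_def ell_def[abs_def])
    then show "upset (perm \<omega>) 0 = L"
      using up particles_mult_of[OF assms(2)] by simp
  qed
qed

text \<open>The state after \<open>V\<close> moves: the values \<open>0, ..., 1 - V\<close> have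
  crossed and are described by the code \<open>a\<close>, the values \<open>- V, ..., 1 - T\<close>
  are still described by the dual code \<open>b\<close>, and the positive values up to
  \<open>W\<close> by the code \<open>d\<close>.\<close>

definition cut_event :: "nat \<Rightarrow> nat \<Rightarrow> nat \<Rightarrow> int set \<Rightarrow> (nat \<Rightarrow> nat) \<Rightarrow> (nat \<Rightarrow> nat) \<Rightarrow> (nat \<Rightarrow> nat) \<Rightarrow> 'a \<Rightarrow> bool" where
  "cut_event V T W L a b d \<omega> \<longleftrightarrow> upset (perm \<omega>) (int V) = L \<and> (\<forall>s\<in>{..<V}. rc (- int s) \<omega> = a s) \<and>
     (\<forall>v\<in>{V+1..T}. lc (1 - int v) \<omega> = b v) \<and> (\<forall>v\<in>{1..W}. rc (int v) \<omega> = d v)"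

lemma pred_cut_event [measurable]: "Measurable.pred M (cut_event V T W L a b d)"
  unfolding cut_event_def[abs_def] by measurable

text \<open>At the original cut the configuration, the dual code and the code are read from disjoint
  parts of the independent family: multiplicities, \<open>BM\<close>-cells and
  \<open>BP\<close>-cells.\<close>

lemma prob_cut_event_0:
  assumes L: "charged 0 L"
  shows "prob {\<omega>\<in>space M. cut_event 0 T W L a b d \<omega>} =
    C * q ^ energy L * (\<Prod>v\<in>{1..T}. q ^ b v * (1 - q)) * (\<Prod>v\<in>{1..W}. q ^ d v * (1 - q))"
proof -
  obtain Tp where Tp: "places d W Tp" using places_exists by blast
  obtain Tm where Tm: "places b T Tm" using places_exists by blast
  have Lm: "maya L" using L by (simp add: charged_def)
  let ?Jp = "code_idx BP W Tp" and ?Jm = "code_idx BM T Tm"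
  let ?O = "code_ones BP W Tp \<union> code_ones BM T Tm"
  define A where "A x = (if x \<in> ?O then {1} else - {1::nat})" for x
  have Jp: "finite ?Jp" "?Jp \<subseteq> drv_index_set"
    unfolding code_idx_def using Tp by (auto simp: places_def drv_index_set_def)
  have Jm: "finite ?Jm" "?Jm \<subseteq> drv_index_set"
    unfolding code_idx_def using Tm by (auto simp: places_def drv_index_set_def)
  have Ap: "A x = (if x \<in> code_ones BP W Tp then {1} else - {1})" if "x \<in> ?Jp" for x
    using that by (auto simp: A_def code_ones_def code_idx_def)
  have Am: "A x = (if x \<in> code_ones BM T Tm then {1} else - {1})" if "x \<in> ?Jm" for x
    using that by (auto simp: A_def code_ones_def code_idx_def)
  have MVn: "MV i \<notin> ?Jp \<union> ?Jm" for i by (auto simp: code_idx_def)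
  have pp: "(\<Prod>v\<in>{1..W}. q ^ d v * (1 - q)) =
    (\<Prod>x\<in>?Jp. prob {\<omega>\<in>space M. Z x \<omega> \<in> (if x \<in> code_ones BP W Tp then {1} else - {1})})"
    by (rule prod_code_idx[OF _ _ lawBP Tp, symmetric]) (simp_all add: drv_index_set_def)
  have pm: "(\<Prod>v\<in>{1..T}. q ^ b v * (1 - q)) =
    (\<Prod>x\<in>?Jm. prob {\<omega>\<in>space M. Z x \<omega> \<in> (if x \<in> code_ones BM T Tm then {1} else - {1})})"
    by (rule prod_code_idx[OF _ _ lawBM Tm, symmetric]) (simp_all add: drv_index_set_def)
  have iff: "cut_event 0 T W L a b d \<omega> \<longleftrightarrow>
    (\<forall>i\<ge>1. Z (MV i) \<omega> = mult_of L i) \<and> (\<forall>x\<in>?Jp \<union> ?Jm. Z x \<omega> \<in> A x)" if g: "good \<omega>" for \<omega>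
  proof -
    have rp: "rich (\<lambda>i j. Z (BP i j) \<omega> = 1)" and rm: "rich (\<lambda>i j. Z (BM i j) \<omega> = 1)"
      using g by (simp_all add: good_def Bp_def[abs_def] Bm_def[abs_def])
    have p: "(\<forall>v\<in>{1..W}. rc (int v) \<omega> = d v) \<longleftrightarrow> (\<forall>x\<in>?Jp. Z x \<omega> \<in> A x)"
      unfolding rc_event_aux[OF g] using mcode_event_idx[OF rp Tp] Ap by simp
    have m: "(\<forall>v\<in>{1..T}. lc (1 - int v) \<omega> = b v) \<longleftrightarrow> (\<forall>x\<in>?Jm. Z x \<omega> \<in> A x)"
      unfolding rc_event_aux[OF g] using mcode_event_idx[OF rm Tm] Am by simp
    have "cut_event 0 T W L a b d \<omega> \<longleftrightarrow> upset (perm \<omega>) 0 = L \<and>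
      (\<forall>v\<in>{1..T}. lc (1 - int v) \<omega> = b v) \<and> (\<forall>v\<in>{1..W}. rc (int v) \<omega> = d v)"
      by (simp add: cut_event_def)
    also have "\<dots> \<longleftrightarrow> (\<forall>i\<ge>1. Z (MV i) \<omega> = mult_of L i) \<and> (\<forall>x\<in>?Jm. Z x \<omega> \<in> A x) \<and> (\<forall>x\<in>?Jp. Z x \<omega> \<in> A x)"
      unfolding particles_event[OF g L] p m ..
    finally show ?thesis by (simp only: ball_Un conj_commute conj_left_commute)
  qed
  let ?E = "{\<omega>\<in>space M. (\<forall>i\<ge>1. Z (MV i) \<omega> = mult_of L i) \<and> (\<forall>x\<in>?Jp \<union> ?Jm. Z x \<omega> \<in> A x)}"
  have Eev: "?E \<in> events"
  proof -
    have "{\<omega>\<in>space M. 1 \<le> i \<longrightarrow> Z (MV i) \<omega> = mult_of L i} \<in> events" for i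
    proof (cases "1 \<le> i")
      case True
      have [measurable]: "Z (MV i) \<in> measurable M (count_space UNIV)" by (rule Z_MV_measurable[OF True])
      show ?thesis by measurable
    qed simp
    then have 1: "{\<omega>\<in>space M. \<forall>i. 1 \<le> i \<longrightarrow> Z (MV i) \<omega> = mult_of L i} \<in> events"
      by (rule sets.sets_Collect_countable_All)
    have 2: "{\<omega>\<in>space M. \<forall>x\<in>?Jp \<union> ?Jm. Z x \<omega> \<in> A x} \<in> events"
    proof (rule sets.sets_Collect_finite_All)
      fix x assume "x \<in> ?Jp \<union> ?Jm"
      then have "Z x \<in> measurable M (count_space UNIV)" using Z_measurable Jp Jm by blast
      from measurable_sets[OF this, of "A x"] show "{\<omega>\<in>space M. Z x \<omega> \<in> A x} \<in> events"
        by (simp add: vimage_def Int_def conj_commute)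
    qed (use Jp Jm in auto)
    show ?thesis by (rule sets.sets_Collect_conj[OF 2 1])
  qed
  have "prob {\<omega>\<in>space M. cut_event 0 T W L a b d \<omega>} = prob ?E"
  proof (rule measure_eq_AE)
    show "AE \<omega> in M. (\<omega> \<in> {\<omega>\<in>space M. cut_event 0 T W L a b d \<omega>}) = (\<omega> \<in> ?E)"
      using AE_good by eventually_elim (simp only: mem_Collect_eq iff)
    show "{\<omega>\<in>space M. cut_event 0 T W L a b d \<omega>} \<in> events" by measurable
    show "?E \<in> events" by (rule Eev)
  qed
  also have "\<dots> = C * q ^ (\<Sum>i | 1 \<le> i \<and> mult_of L i \<noteq> 0. i * mult_of L i) *
     (\<Prod>x\<in>?Jp \<union> ?Jm. prob {\<omega>\<in>space M. Z x \<omega> \<in> A x})"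
    by (rule prob_MV_cylinder[OF finite_UnI[OF Jp(1) Jm(1)] Un_least[OF Jp(2) Jm(2)] MVn fin_mult_mult_of[OF Lm]])
  also have "(\<Prod>x\<in>?Jp \<union> ?Jm. prob {\<omega>\<in>space M. Z x \<omega> \<in> A x}) =
     (\<Prod>x\<in>?Jp. prob {\<omega>\<in>space M. Z x \<omega> \<in> A x}) * (\<Prod>x\<in>?Jm. prob {\<omega>\<in>space M. Z x \<omega> \<in> A x})"
    by (rule prod.union_disjoint[OF Jp(1) Jm(1)]) (auto simp: code_idx_def)
  also have "(\<Prod>x\<in>?Jp. prob {\<omega>\<in>space M. Z x \<omega> \<in> A x}) = (\<Prod>v\<in>{1..W}. q ^ d v * (1 - q))"
    unfolding pp by (rule prod.cong[OF refl]) (simp only: Ap)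
  also have "(\<Prod>x\<in>?Jm. prob {\<omega>\<in>space M. Z x \<omega> \<in> A x}) = (\<Prod>v\<in>{1..T}. q ^ b v * (1 - q))"
    unfolding pm by (rule prod.cong[OF refl]) (simp only: Am)
  finally show ?thesis unfolding energy_mult_of[OF Lm, symmetric] by simp
qed

text \<open>Induction on the number of moves. Having configuration \<open>L\<close> and code entry
  \<open>a V\<close> after the move amounts to having \<open>L - {k}\<close> and dual entry
  \<open>h\<close> before it, where \<open>k\<close> is the particle of rank \<open>a V\<close>;
  \<open>energy_remove\<close> balances the exponents of \<open>q\<close>.\<close>

lemma prob_cut_event:
  assumes "charged (int V) L" "V \<le> T"
  shows "prob {\<omega>\<in>space M. cut_event V T W L a b d \<omega>} =
    C * q ^ energy L * (\<Prod>s\<in>{..<V}. q ^ a s * (1 - q)) *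
    (\<Prod>v\<in>{V+1..T}. q ^ b v * (1 - q)) * (\<Prod>v\<in>{1..W}. q ^ d v * (1 - q))"
  using assms
proof (induction V arbitrary: L b)
  case 0
  then show ?case using prob_cut_event_0[of L T W a b d] by simp
next
  case (Suc V)
  have L: "maya L" using Suc.prems by (simp add: charged_def)
  obtain k where k: "k \<in> L" "card {l\<in>L. l < k} = a V" using maya_nth[OF L] by blast
  define h where "h = holes_above L k"
  \<comment> \<open>The value that crosses is \<open>- V\<close>, which is \<open>1 - v\<close> for
    \<open>v = V + 1\<close>.\<close>
  define b' where "b' = b(V + 1 := h)"
  have ch: "charged (int V) (L - {k})"
    by (rule charged_remove) (use Suc.prems k in \<open>simp_all add: add.commute\<close>)
  have iff: "cut_event (Suc V) T W L a b d \<omega> \<longleftrightarrow> cut_event V T W (L - {k}) a b' d \<omega>" if g: "good \<omega>" for \<omega>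
  proof -
    have "upset (perm \<omega>) (int V + 1) = L \<and> rc (- int V) \<omega> = a V \<longleftrightarrow>
      upset (perm \<omega>) (int V) = L - {k} \<and> lc (- int V) \<omega> = h"
      using upset_step[OF good_perm(1)[OF g] L k(1), of "int V"] k(2) good_codes[OF g] by (simp add: h_def)
    moreover have "(\<forall>v\<in>{V+1..T}. lc (1 - int v) \<omega> = b' v) \<longleftrightarrow>
        lc (- int V) \<omega> = h \<and> (\<forall>v\<in>{Suc V+1..T}. lc (1 - int v) \<omega> = b v)"
    proof -
      have "{V+1..T} = insert (V + 1) {Suc V+1..T}" using Suc.prems by auto
      then show ?thesis by (auto simp: b'_def)
    qed
    ultimately show ?thesis
      unfolding cut_event_def lessThan_Suc by (auto simp: add.commute)
  qed
  have "prob {\<omega>\<in>space M. cut_event (Suc V) T W L a b d \<omega>} = prob {\<omega>\<in>space M. cut_event V T W (L - {k}) a b' d \<omega>}"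
    by (rule measure_eq_AE) (use AE_good iff in auto)
  also have "\<dots> = C * q ^ energy (L - {k}) * (\<Prod>s\<in>{..<V}. q ^ a s * (1 - q)) *
    (\<Prod>v\<in>{V+1..T}. q ^ b' v * (1 - q)) * (\<Prod>v\<in>{1..W}. q ^ d v * (1 - q))"
    by (rule Suc.IH[OF ch]) (use Suc.prems in simp)
  also have "(\<Prod>v\<in>{V+1..T}. q ^ b' v * (1 - q)) = q ^ h * (1 - q) * (\<Prod>v\<in>{Suc V+1..T}. q ^ b v * (1 - q))"
  proof -
    have "{V+1..T} = insert (V + 1) {Suc V+1..T}" using Suc.prems by auto
    moreover have "(\<Prod>v\<in>{Suc V+1..T}. q ^ b' v * (1 - q)) = (\<Prod>v\<in>{Suc V+1..T}. q ^ b v * (1 - q))"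
      by (rule prod.cong) (auto simp: b'_def)
    ultimately show ?thesis by (simp add: b'_def)
  qed
  finally have "prob {\<omega>\<in>space M. cut_event (Suc V) T W L a b d \<omega>} =
    C * (q ^ energy (L - {k}) * q ^ h) * ((\<Prod>s\<in>{..<V}. q ^ a s * (1 - q)) * (1 - q)) *
    (\<Prod>v\<in>{Suc V+1..T}. q ^ b v * (1 - q)) * (\<Prod>v\<in>{1..W}. q ^ d v * (1 - q))"
    by (simp add: mult_ac)
  moreover have "q ^ energy (L - {k}) * q ^ h = q ^ energy L * q ^ a V"
    using energy_remove[OF L k(1)] k(2) by (simp add: power_add[symmetric] h_def)
  ultimately show ?case by (simp add: mult_ac)
qed

lemma AE_charged_upset: "AE \<omega> in M. charged (int V) (upset (perm \<omega>) (int V))"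
  using AE_good by (rule AE_mp) (auto intro!: AE_I2 charged_upset good_perm)

text \<open>At charge 0 these weights are the probabilities of the configurations at the original
  cut, hence sum to one; translation carries the identity to charge \<open>V\<close>. No product
  formula for partitions enters.\<close>

lemma energy_weights:
  "(\<integral>\<^sup>+L. ennreal (C * q ^ energy L) \<partial>count_space (Collect (charged (int V)))) = 1"
proof -
  have "countable (Collect (charged 0))"
    by (rule countable_subset[OF _ countable_maya]) (auto simp: charged_def)
  have meas: "{\<omega>\<in>space M. charged 0 (upset (perm \<omega>) 0)} \<in> events"
  proof -
    have "{\<omega>\<in>space M. charged 0 (upset (perm \<omega>) 0)} = (\<Union>L\<in>Collect (charged 0). {\<omega>\<in>space M. upset (perm \<omega>) 0 = L})"
      by auto
    also have "\<dots> \<in> events" by (rule sets.countable_UN'') (use \<open>countable _\<close> in auto)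
    finally show ?thesis .
  qed
  let ?G = "{\<omega>\<in>space M. charged 0 (upset (perm \<omega>) 0)}"
  have "1 = emeasure M ?G"
    using AE_charged_upset[of 0] meas by (simp add: emeasure_eq_1_AE)
  also have "\<dots> = (\<integral>\<^sup>+L. emeasure M {\<omega>\<in>?G. upset (perm \<omega>) 0 = L} \<partial>count_space (Collect (charged 0)))"
    by (rule emeasure_discrete_split) (use meas \<open>countable _\<close> in auto)
  also have "\<dots> = (\<integral>\<^sup>+L. ennreal (C * q ^ energy L) \<partial>count_space (Collect (charged 0)))"
  proof (rule nn_integral_cong)
    fix L assume "L \<in> space (count_space (Collect (charged 0)))"
    then have L: "charged 0 L" by simp
    then have "{\<omega>\<in>?G. upset (perm \<omega>) 0 = L} = {\<omega>\<in>space M. cut_event 0 0 0 L undefined undefined undefined \<omega>}"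
      by (auto simp: cut_event_def)
    then show "emeasure M {\<omega>\<in>?G. upset (perm \<omega>) 0 = L} = ennreal (C * q ^ energy L)"
      using prob_cut_event_0[OF L, of 0 0] by (simp add: emeasure_eq_measure)
  qed
  also have "\<dots> = (\<integral>\<^sup>+L. ennreal (C * q ^ energy ((+) (- int V) ` L)) \<partial>count_space (Collect (charged 0)))"
    by (simp only: energy_translate)
  also have "\<dots> = (\<integral>\<^sup>+L. ennreal (C * q ^ energy L) \<partial>count_space (Collect (charged (0 - (- int V)))))"
    by (rule nn_integral_bij_count_space[OF bij_betw_translate])
  finally show ?thesis by simp
qed

text \<open>Taking \<open>T = V\<close> leaves no dual code (hence \<open>undefined\<close> for
  \<open>b\<close>), and summing over the configurations of charge \<open>V\<close> removes
  \<open>L\<close> with total mass one.\<close>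

lemma rc_joint_law:
  "prob {\<omega>\<in>space M. (\<forall>s\<in>{..<V}. rc (- int s) \<omega> = a s) \<and> (\<forall>v\<in>{1..W}. rc (int v) \<omega> = d v)} =
    (\<Prod>s\<in>{..<V}. q ^ a s * (1 - q)) * (\<Prod>v\<in>{1..W}. q ^ d v * (1 - q))"
proof -
  let ?P = "(\<Prod>s\<in>{..<V}. q ^ a s * (1 - q)) * (\<Prod>v\<in>{1..W}. q ^ d v * (1 - q))"
  let ?X = "Collect (charged (int V))"
  have P0: "0 \<le> ?P" using q by (intro mult_nonneg_nonneg prod_nonneg) auto
  have cX: "countable ?X"
    by (rule countable_subset[OF _ countable_maya]) (auto simp: charged_def)
  let ?E = "\<lambda>L. {\<omega>\<in>space M. cut_event V V W L a undefined d \<omega>}"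
  have "emeasure M (\<Union>L\<in>?X. ?E L) = (\<integral>\<^sup>+L. emeasure M (?E L) \<partial>count_space ?X)"
    by (rule emeasure_UN_countable) (use cX in \<open>auto simp: disjoint_family_on_def cut_event_def\<close>)
  also have "\<dots> = (\<integral>\<^sup>+L. ennreal (C * q ^ energy L) * ennreal ?P \<partial>count_space ?X)"
  proof (rule nn_integral_cong)
    fix L assume "L \<in> space (count_space ?X)"
    then have "prob (?E L) = C * q ^ energy L * ?P"
      using prob_cut_event[of V L V W a undefined d] by (simp add: mult_ac)
    then show "emeasure M (?E L) = ennreal (C * q ^ energy L) * ennreal ?P"
      using P0 C_nonneg q by (simp add: emeasure_eq_measure ennreal_mult)
  qed
  also have "\<dots> = ennreal ?P"
    by (simp add: nn_integral_multc energy_weights)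
  finally have "prob (\<Union>L\<in>?X. ?E L) = ?P"
    using P0 by (simp add: emeasure_eq_measure)
  moreover have "prob {\<omega>\<in>space M. (\<forall>s\<in>{..<V}. rc (- int s) \<omega> = a s) \<and> (\<forall>v\<in>{1..W}. rc (int v) \<omega> = d v)}
    = prob (\<Union>L\<in>?X. ?E L)"
  proof (rule measure_eq_AE)
    show "AE \<omega> in M. (\<omega> \<in> {\<omega>\<in>space M. (\<forall>s\<in>{..<V}. rc (- int s) \<omega> = a s) \<and> (\<forall>v\<in>{1..W}. rc (int v) \<omega> = d v)})
      = (\<omega> \<in> (\<Union>L\<in>?X. ?E L))"
      using AE_charged_upset[of V] by (rule AE_mp) (auto intro!: AE_I2 simp: cut_event_def)
    show "(\<Union>L\<in>?X. ?E L) \<in> events" by (rule sets.countable_UN'') (use cX in auto)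
  qed measurable
  ultimately show ?thesis by simp
qed

theorem rc_iid:
  "indep_vars (\<lambda>_. count_space UNIV) rc UNIV"
  "prob {\<omega>\<in>space M. rc z \<omega> = n} = q ^ n * (1 - q)"
proof -
  have joint: "\<exists>J'. finite J' \<and> J \<subseteq> J' \<and> (\<forall>x. prob {\<omega>\<in>space M. \<forall>i\<in>J'. rc i \<omega> = x i} = (\<Prod>i\<in>J'. q ^ x i * (1 - q)))"
    if J: "finite J" for J :: "int set"
  proof -
    obtain N :: nat where N: "\<And>i. i \<in> J \<Longrightarrow> \<bar>i\<bar> \<le> int N"
    proof -
      have "finite ((\<lambda>i. nat \<bar>i\<bar>) ` J)" using J by simp
      then obtain N where "\<And>n. n \<in> (\<lambda>i. nat \<bar>i\<bar>) ` J \<Longrightarrow> n \<le> N" using finite_nat_set_iff_bounded_le[of "(\<lambda>i. nat \<bar>i\<bar>) ` J"] by auto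
      then show ?thesis by (intro that[of N]) force
    qed
    let ?A = "(\<lambda>s. - int s) ` {..<Suc N}" and ?B = "int ` {1..N}"
    have sub: "J \<subseteq> ?A \<union> ?B"
    proof
      fix i assume "i \<in> J"
      then have i: "\<bar>i\<bar> \<le> int N" by (rule N)
      show "i \<in> ?A \<union> ?B"
      proof (cases "i \<le> 0")
        case True
        then have "i = - int (nat (- i))" "nat (- i) < Suc N" using i by auto
        then show ?thesis by blast
      next
        case False
        then have "i = int (nat i)" "nat i \<in> {1..N}" using i by auto
        then show ?thesis by blast
      qed
    qed
    have "prob {\<omega>\<in>space M. \<forall>i\<in>?A \<union> ?B. rc i \<omega> = x i} = (\<Prod>i\<in>?A \<union> ?B. q ^ x i * (1 - q))" for x
    proof -
      have "{\<omega>\<in>space M. \<forall>i\<in>?A \<union> ?B. rc i \<omega> = x i} = {\<omega>\<in>space M. (\<forall>s\<in>{..<Suc N}. rc (- int s) \<omega> = x (- int s)) \<and>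
         (\<forall>v\<in>{1..N}. rc (int v) \<omega> = x (int v))}"
        unfolding ball_Un by auto
      moreover have "(\<Prod>i\<in>?A \<union> ?B. q ^ x i * (1 - q)) = (\<Prod>i\<in>?A. q ^ x i * (1 - q)) * (\<Prod>i\<in>?B. q ^ x i * (1 - q))"
        by (rule prod.union_disjoint) auto
      moreover have "(\<Prod>i\<in>?A. q ^ x i * (1 - q)) = (\<Prod>s\<in>{..<Suc N}. q ^ x (- int s) * (1 - q))"
        by (subst prod.reindex) (auto simp: inj_on_def)
      moreover have "(\<Prod>i\<in>?B. q ^ x i * (1 - q)) = (\<Prod>v\<in>{1..N}. q ^ x (int v) * (1 - q))"
        by (subst prod.reindex) (auto simp: inj_on_def)
      ultimately show ?thesis
        by (simp only: rc_joint_law)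
    qed
    then show ?thesis using sub by (intro exI[of _ "?A \<union> ?B"]) auto
  qed
  show "indep_vars (\<lambda>_. count_space UNIV) rc UNIV"
    by (rule indep_vars_of_joint_law(1)[where p = "\<lambda>_ n. q ^ n * (1 - q)"])
      (use q joint nn_integral_geom in \<open>auto intro!: mult_nonneg_nonneg\<close>)
  show "prob {\<omega>\<in>space M. rc z \<omega> = n} = q ^ n * (1 - q)"
    by (rule indep_vars_of_joint_law(2)[where p = "\<lambda>_ n. q ^ n * (1 - q)"])
      (use q joint nn_integral_geom in \<open>auto intro!: mult_nonneg_nonneg\<close>)
qed

end

section \<open>Reconstructing a permutation from its inversion code\<close>

definition larger_before :: "nat list \<Rightarrow> nat \<Rightarrow> nat" where
  "larger_before xs i = card {j. j < i \<and> xs ! i < xs ! j}"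

definition linv :: "nat list \<Rightarrow> nat" where
  "linv xs = (\<Sum>i<length xs. larger_before xs i)"

text \<open>\<open>gs\<close> counts, for each entry of \<open>xs\<close>, the values outside \<open>xs\<close> that are larger than all of
  \<open>xs\<close> and precede it; \<open>c\<close> is the resulting inversion code.\<close>

definition encodes :: "nat list \<Rightarrow> nat list \<Rightarrow> (nat \<Rightarrow> nat) \<Rightarrow> bool" where
  "encodes xs gs c \<longleftrightarrow> length gs = length xs \<and> (\<forall>i<length xs. c (xs ! i) = gs ! i + larger_before xs i)"

text \<open>The possible offsets: nondecreasing, because later positions have more predecessors, and
  at least 1, because the value of the gap that appears first is not a record although none of the
  gap precedes it.\<close>

definition gaps :: "nat \<Rightarrow> nat list set" where
  "gaps n = {gs. length gs = n \<and> sorted gs \<and> (\<forall>g\<in>set gs. 1 \<le> g)}"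

definition coded :: "nat list \<Rightarrow> (nat \<Rightarrow> nat) \<Rightarrow> bool" where
  "coded xs c \<longleftrightarrow> (\<exists>gs\<in>gaps (length xs). encodes xs gs c)"

lemma larger_before_0 [simp]: "larger_before xs 0 = 0"
  by (simp add: larger_before_def)

lemma larger_before_Cons:
  "larger_before (x # xs) (Suc i) = larger_before xs i + (if xs ! i < x then 1 else 0)"
proof -
  have "{j. j < Suc i \<and> xs ! i < (x # xs) ! j} =
    Suc ` {j. j < i \<and> xs ! i < xs ! j} \<union> (if xs ! i < x then {0} else {})"
    (is "?A = ?B")
  proof (intro set_eqI)
    fix j show "j \<in> ?A \<longleftrightarrow> j \<in> ?B" by (cases j) auto
  qed
  then have "larger_before (x # xs) (Suc i) = card (Suc ` {j. j < i \<and> xs ! i < xs ! j} \<union> (if xs ! i < x then {0} else {}))"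
    by (simp only: larger_before_def nth_Cons_Suc)
  also have "\<dots> = card (Suc ` {j. j < i \<and> xs ! i < xs ! j}) + card (if xs ! i < x then {0::nat} else {})"
    by (rule card_Un_disjoint) auto
  also have "\<dots> = larger_before xs i + (if xs ! i < x then 1 else 0)"
    by (simp add: card_image larger_before_def)
  finally show ?thesis .
qed

lemma encodes_Cons:
  "encodes (x # xs) (g # gs) c \<longleftrightarrow> c x = g \<and>
     length gs = length xs \<and> (\<forall>i<length xs. c (xs ! i) = gs ! i + larger_before xs i + (if xs ! i < x then 1 else 0))"
  unfolding encodes_def by (auto simp: All_less_Suc2 larger_before_Cons)

text \<open>A later entry has an offset at least as large, and one more larger predecessor if it is
  below \<open>x\<close>. So the head can be read from the code: it is the least value among those
  with minimal code.\<close>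

lemma encodes_Cons_min:
  assumes "encodes (x # xs) (g # gs) c" "sorted (g # gs)" "y \<in> set (x # xs)"
  shows "c x \<le> c y" "y < x \<Longrightarrow> c x < c y"
proof -
  have e: "c x = g" "length gs = length xs"
    "\<And>i. i < length xs \<Longrightarrow> c (xs ! i) = gs ! i + larger_before xs i + (if xs ! i < x then 1 else 0)"
    using assms(1) unfolding encodes_Cons by auto
  have "c x \<le> c y \<and> (y < x \<longrightarrow> c x < c y)"
  proof (cases "y = x")
    case False
    then obtain i where i: "i < length xs" "y = xs ! i"
      using assms(3) by (auto simp: in_set_conv_nth)
    have "g \<le> gs ! i" using assms(2) i e(2) by simp
    then show ?thesis using e(1) e(3)[OF i(1)] i(2) by auto
  qed simp
  then show "c x \<le> c y" "y < x \<Longrightarrow> c x < c y" by auto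
qed

text \<open>Once the head \<open>x\<close> is read off, it is discounted: values below
  \<open>x\<close> lose one larger predecessor, and the same reading applies to the tail.\<close>

lemma encodes_unique:
  assumes "encodes xs gs c" "sorted gs" "encodes ys hs c" "sorted hs"
    "distinct xs" "distinct ys" "set xs = set ys"
  shows "xs = ys"
  using assms
proof (induction xs arbitrary: gs ys hs c)
  case (Cons x xs)
  obtain g gs' where gs: "gs = g # gs'" using Cons.prems(1) by (cases gs) (auto simp: encodes_def)
  obtain y ys' where ys: "ys = y # ys'" using Cons.prems(7) by (cases ys) auto
  obtain h hs' where hs: "hs = h # hs'" using Cons.prems(3) ys by (cases hs) (auto simp: encodes_def)
  note ex = Cons.prems(1)[unfolded gs] and ey = Cons.prems(3)[unfolded hs ys]
  have sx: "sorted (g # gs')" and sy: "sorted (h # hs')" using Cons.prems gs hs by auto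
  have xy: "x \<in> set (y # ys')" "y \<in> set (x # xs)" using Cons.prems(7) ys by auto
  have "x = y"
    using encodes_Cons_min[OF ex sx xy(2)] encodes_Cons_min[OF ey sy xy(1)]
    by (cases x y rule: linorder_cases) auto
  define c' where "c' z = (if z < x then c z - 1 else c z)" for z
  have "encodes xs gs' c'"
    using ex unfolding encodes_Cons unfolding encodes_def c'_def by auto
  moreover have "encodes ys' hs' c'"
    using ey unfolding encodes_Cons unfolding encodes_def c'_def \<open>x = y\<close> by auto
  moreover have "set xs = set ys'"
    using Cons.prems(5-7) ys \<open>x = y\<close> by auto
  ultimately have "xs = ys'"
    using Cons.IH[of gs' c' ys' hs'] sx sy Cons.prems(5,6) ys by auto
  then show ?case using ys \<open>x = y\<close> by simp
qed simp

text \<open>The lower bound \<open>m\<close> is part of the induction: the offset chosen for the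
  head bounds the later ones from below, which is what makes \<open>gs\<close> sorted.\<close>

lemma encodes_exists:
  assumes "finite S" "\<And>y. y \<in> S \<Longrightarrow> m \<le> c y"
  shows "\<exists>xs gs. distinct xs \<and> set xs = S \<and> sorted gs \<and> (\<forall>g\<in>set gs. m \<le> g) \<and> encodes xs gs c"
  using assms
proof (induction "card S" arbitrary: S m c)
  case 0
  then show ?case by (intro exI[of _ "[]"]) (auto simp: encodes_def)
next
  case (Suc n)
  then have ne: "S \<noteq> {}" by auto
  define k where "k = Min (c ` S)"
  have k: "k \<in> c ` S" "\<And>y. y \<in> S \<Longrightarrow> k \<le> c y" using Suc.prems(1) ne by (auto simp: k_def)
  define x where "x = Min {y\<in>S. c y = k}"
  have fin: "finite {y\<in>S. c y = k}" using Suc.prems(1) by simp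
  have ne': "{y\<in>S. c y = k} \<noteq> {}" using k(1) by auto
  have x: "x \<in> S" "c x = k" using Min_in[OF fin ne'] by (auto simp: x_def)
  have lt: "k < c y" if "y \<in> S" "y < x" for y
  proof (rule ccontr)
    assume "\<not> k < c y"
    then have "y \<in> {y\<in>S. c y = k}" using k(2)[OF that(1)] that(1) by simp
    then have "x \<le> y" unfolding x_def by (rule Min_le[OF fin])
    then show False using that(2) by simp
  qed
  define c' where "c' z = (if z < x then c z - 1 else c z)" for z
  \<comment> \<open>Choosing the least minimiser makes the code strictly larger below
    \<open>x\<close>, so lowering it by one there does not fall under \<open>k\<close>.\<close>
  have c': "k \<le> c' y" if "y \<in> S - {x}" for y
    using that lt[of y] k(2)[of y] by (auto simp: c'_def)
  have "n = card (S - {x})" using Suc x by simp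
  from Suc.hyps(1)[of "S - {x}" k c', OF this _ c'] obtain xs gs where I: "distinct xs" "set xs = S - {x}" "sorted gs"
    "\<forall>g\<in>set gs. k \<le> g" "encodes xs gs c'"
    using Suc.prems(1) by auto
  have "encodes (x # xs) (k # gs) c"
    unfolding encodes_Cons
  proof (intro conjI allI impI)
    show "c x = k" "length gs = length xs" using x I(5) by (auto simp: encodes_def)
    fix i assume i: "i < length xs"
    then have "xs ! i \<in> S" using I(2) nth_mem by blast
    then show "c (xs ! i) = gs ! i + larger_before xs i + (if xs ! i < x then 1 else 0)"
      using I(5) i lt[of "xs ! i"] by (auto simp: encodes_def c'_def split: if_splits)
  qed
  moreover have "m \<le> k" using Suc.prems(2)[OF x(1)] x(2) by simp
  ultimately show ?case
    using I x by (intro exI[of _ "x # xs"] exI[of _ "k # gs"]) auto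
qed

lemma coded_unique:
  assumes "coded xs c" "coded ys c" "distinct xs" "distinct ys" "set xs = set ys"
  shows "xs = ys"
  using assms encodes_unique by (auto simp: coded_def gaps_def)

lemma coded_pos:
  assumes "coded xs c" "x \<in> set xs"
  shows "1 \<le> c x"
  using assms by (fastforce simp: coded_def gaps_def encodes_def in_set_conv_nth)

lemma coded_exists:
  assumes "finite S" "\<And>y. y \<in> S \<Longrightarrow> 1 \<le> c y"
  shows "\<exists>xs\<in>permutations_of_set S. coded xs c"
  using encodes_exists[of S 1 c] assms
  by (auto simp: permutations_of_set_def coded_def gaps_def encodes_def)

lemma encodes_gaps_unique: "encodes xs gs c \<Longrightarrow> encodes xs gs' c \<Longrightarrow> gs = gs'"
  by (auto simp: encodes_def intro!: nth_equalityI)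

section \<open>Finite Mallows permutations as lists\<close>

lemma bij_betw_permutes_lists:
  "bij_betw (\<lambda>\<sigma>. map \<sigma> [1..<n + 1]) {\<sigma>. \<sigma> permutes {1..n}} (permutations_of_set {1..n})"
proof -
  let ?f = "\<lambda>\<sigma>. map \<sigma> [1..<n + 1]"
  have set: "set [1..<n + 1] = {1..n}" by (simp only: set_upt) auto
  have inj: "inj_on ?f {\<sigma>. \<sigma> permutes {1..n}}"
  proof (rule inj_onI, rule ext)
    fix \<sigma> \<tau> :: "nat \<Rightarrow> nat" and x
    assume p: "\<sigma> \<in> {\<sigma>. \<sigma> permutes {1..n}}" "\<tau> \<in> {\<sigma>. \<sigma> permutes {1..n}}" and eq: "?f \<sigma> = ?f \<tau>"
    show "\<sigma> x = \<tau> x"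
    proof (cases "x \<in> {1..n}")
      case True
      then have "x \<in> set [1..<n + 1]" unfolding set .
      then show ?thesis using eq by (metis map_eq_conv)
    next
      case False
      then show ?thesis using p by (simp add: permutes_not_in)
    qed
  qed
  have sub: "?f ` {\<sigma>. \<sigma> permutes {1..n}} \<subseteq> permutations_of_set {1..n}"
  proof
    fix xs assume "xs \<in> ?f ` {\<sigma>. \<sigma> permutes {1..n}}"
    then obtain \<sigma> where s: "\<sigma> permutes {1..n}" "xs = ?f \<sigma>" by auto
    have "set xs = {1..n}" unfolding s(2) set_map set using s(1) by (rule permutes_image)
    moreover have "distinct xs" unfolding s(2) distinct_map
      using permutes_inj_on[OF s(1)] by simp
    ultimately show "xs \<in> permutations_of_set {1..n}" by (simp add: permutations_of_set_def)
  qed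
  have "card (?f ` {\<sigma>. \<sigma> permutes {1..n}}) = card (permutations_of_set {1..n})"
    unfolding card_image[OF inj] using card_permutations[of "{1..n}" n] by simp
  then have "?f ` {\<sigma>. \<sigma> permutes {1..n}} = permutations_of_set {1..n}"
    using sub by (intro card_subset_eq) auto
  then show ?thesis using inj by (simp add: bij_betw_def)
qed

lemma inversions_conv: "inversions n \<sigma> = linv (map \<sigma> [1..<n + 1])"
proof -
  let ?xs = "map \<sigma> [1..<n + 1]"
  have nth: "?xs ! i = \<sigma> (Suc i)" if "i < n" for i using that by (simp add: nth_append del: upt_Suc)
  let ?S = "SIGMA j:{..<n}. {i. i < j \<and> ?xs ! j < ?xs ! i}"
  have "linv ?xs = card ?S"
    unfolding linv_def larger_before_def by (subst card_SigmaI) (auto simp del: upt_Suc)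
  also have "\<dots> = card ((\<lambda>(j, i). (Suc i, Suc j)) ` ?S)"
    by (rule card_image[symmetric]) (auto simp: inj_on_def)
  also have "(\<lambda>(j, i). (Suc i, Suc j)) ` ?S = {(i, j). 1 \<le> i \<and> i < j \<and> j \<le> n \<and> \<sigma> i > \<sigma> j}"
  proof (intro set_eqI iffI)
    fix p assume "p \<in> (\<lambda>(j, i). (Suc i, Suc j)) ` ?S"
    then obtain i j where ij: "p = (Suc i, Suc j)" "j < n" "i < j" "?xs ! j < ?xs ! i" by auto
    then show "p \<in> {(i, j). 1 \<le> i \<and> i < j \<and> j \<le> n \<and> \<sigma> i > \<sigma> j}" using nth[of i] nth[of j] by simp
  next
    fix p assume "p \<in> {(i, j). 1 \<le> i \<and> i < j \<and> j \<le> n \<and> \<sigma> i > \<sigma> j}"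
    then obtain i j where ij: "p = (i, j)" "1 \<le> i" "i < j" "j \<le> n" "\<sigma> j < \<sigma> i" by auto
    then have "(j - 1, i - 1) \<in> ?S" using nth[of "i - 1"] nth[of "j - 1"] by auto
    moreover have "p = (\<lambda>(j, i). (Suc i, Suc j)) (j - 1, i - 1)" using ij by simp
    ultimately show "p \<in> (\<lambda>(j, i). (Suc i, Suc j)) ` ?S" by blast
  qed
  finally show ?thesis by (simp add: inversions_def)
qed

lemma mallows_Z_conv: "mallows_Z n q = (\<Sum>xs\<in>permutations_of_set {1..n}. q ^ linv xs)"
  unfolding mallows_Z_def inversions_conv
  by (rule sum.reindex_bij_betw[OF bij_betw_permutes_lists])

lemma mallows_bst_prob_conv:
  "mallows_bst_prob q n t = (\<Sum>xs | xs \<in> permutations_of_set {1..n} \<and> bst xs = t. q ^ linv xs / mallows_Z n q)"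
proof -
  have "mallows_bst_prob q n t = (\<Sum>\<sigma> | \<sigma> permutes {1..n} \<and> bst (map \<sigma> [1..<n + 1]) = t.
      q ^ linv (map \<sigma> [1..<n + 1]) / mallows_Z n q)"
    unfolding mallows_bst_prob_def by (rule sum.cong) (auto simp: mallows_pmf_def inversions_conv)
  also have "\<dots> = (\<Sum>xs | xs \<in> permutations_of_set {1..n} \<and> bst xs = t. q ^ linv xs / mallows_Z n q)"
  proof (rule sum.reindex_bij_betw)
    have "bij_betw (\<lambda>\<sigma>. map \<sigma> [1..<n + 1])
      {\<sigma>. \<sigma> permutes {1..n} \<and> bst (map \<sigma> [1..<n + 1]) = t}
      ((\<lambda>\<sigma>. map \<sigma> [1..<n + 1]) ` {\<sigma>. \<sigma> permutes {1..n} \<and> bst (map \<sigma> [1..<n + 1]) = t})"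
      by (rule bij_betw_subset[OF bij_betw_permutes_lists]) auto
    also have "(\<lambda>\<sigma>. map \<sigma> [1..<n + 1]) ` {\<sigma>. \<sigma> permutes {1..n} \<and> bst (map \<sigma> [1..<n + 1]) = t}
      = {xs. xs \<in> (\<lambda>\<sigma>. map \<sigma> [1..<n + 1]) ` {\<sigma>. \<sigma> permutes {1..n}} \<and> bst xs = t}"
      by blast
    also have "(\<lambda>\<sigma>. map \<sigma> [1..<n + 1]) ` {\<sigma>. \<sigma> permutes {1..n}} = permutations_of_set {1..n}"
      using bij_betw_permutes_lists by (rule bij_betw_imp_surj_on)
    finally show "bij_betw (\<lambda>\<sigma>. map \<sigma> [1..<n + 1]) {\<sigma>. \<sigma> permutes {1..n} \<and> bst (map \<sigma> [1..<n + 1]) = t}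
      {xs. xs \<in> permutations_of_set {1..n} \<and> bst xs = t}" .
  qed
  finally show ?thesis .
qed

lemma mallows_Z_pos:
  assumes "0 \<le> q"
  shows "0 < mallows_Z n q"
proof -
  have "inversions n id = 0"
  proof -
    have "{(i, j). 1 \<le> i \<and> i < j \<and> j \<le> n \<and> id j < (id i :: nat)} = {}" by auto
    then show ?thesis by (simp only: inversions_def card.empty)
  qed
  then have "q ^ inversions n id \<le> mallows_Z n q"
    unfolding mallows_Z_def using assms
    by (intro member_le_sum) (auto simp del: id_apply simp: permutes_id finite_permutations id_def[symmetric])
  then show ?thesis using \<open>inversions n id = 0\<close> by simp
qed

section \<open>The law of the order inside a gap\<close>

context mallows_driver
begin

text \<open>Given the offsets, every code entry is a single prescribed number; the exponents add up
  to the offsets plus the inversions of \<open>xs\<close>.\<close>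

lemma prob_encodes:
  assumes xs: "distinct xs" and len: "length gs = length xs"
  shows "prob {\<omega>\<in>space M. encodes xs gs (\<lambda>x. rc (u + int x) \<omega>)} =
    q ^ linv xs * (q ^ sum_list gs * (1 - q) ^ length xs)"
proof -
  let ?n = "length xs" and ?z = "\<lambda>i. u + int (xs ! i)"
  define A where "A z = {k. \<forall>i<?n. z = ?z i \<longrightarrow> k = gs ! i + larger_before xs i}" for z
  have inj: "inj_on ?z {..<?n}" using xs by (auto simp: inj_on_def nth_eq_iff_index_eq)
  have A: "A (?z i) = {gs ! i + larger_before xs i}" if "i < ?n" for i
    using that xs by (auto simp: A_def nth_eq_iff_index_eq)
  have "{\<omega>\<in>space M. encodes xs gs (\<lambda>x. rc (u + int x) \<omega>)} = {\<omega>\<in>space M. \<forall>z\<in>?z ` {..<?n}. rc z \<omega> \<in> A z}"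
    using A len by (auto simp: encodes_def)
  also have "prob \<dots> = (\<Prod>z\<in>?z ` {..<?n}. prob {\<omega>\<in>space M. rc z \<omega> \<in> A z})"
    by (rule indep_vars_prob_Ball[OF rc_iid(1)]) auto
  also have "\<dots> = (\<Prod>i<?n. prob {\<omega>\<in>space M. rc (?z i) \<omega> \<in> A (?z i)})"
    by (subst prod.reindex[OF inj]) simp
  also have "\<dots> = (\<Prod>i<?n. q ^ (gs ! i + larger_before xs i) * (1 - q))"
    by (rule prod.cong) (auto simp: A rc_iid(2))
  also have "\<dots> = q ^ (\<Sum>i<?n. gs ! i + larger_before xs i) * (1 - q) ^ ?n"
    by (simp add: prod.distrib power_sum)
  also have "(\<Sum>i<?n. gs ! i + larger_before xs i) = sum_list gs + linv xs"
    using len by (simp add: sum.distrib linv_def sum_list_sum_nth atLeast0LessThan)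
  finally show ?thesis by (simp add: power_add mult_ac)
qed

lemma pred_encodes [measurable]: "Measurable.pred M (\<lambda>\<omega>. encodes xs gs (\<lambda>x. rc (u + int x) \<omega>))"
  unfolding encodes_def by measurable

lemma pred_coded [measurable]: "Measurable.pred M (\<lambda>\<omega>. coded xs (\<lambda>x. rc (u + int x) \<omega>))"
  unfolding coded_def by measurable

lemma emeasure_coded:
  assumes xs: "distinct xs"
  shows "emeasure M {\<omega>\<in>space M. coded xs (\<lambda>x. rc (u + int x) \<omega>)} =
    ennreal (q ^ linv xs) * (\<integral>\<^sup>+gs. ennreal (q ^ sum_list gs * (1 - q) ^ length xs) \<partial>count_space (gaps (length xs)))"
proof -
  let ?G = "gaps (length xs)" and ?E = "\<lambda>gs. {\<omega>\<in>space M. encodes xs gs (\<lambda>x. rc (u + int x) \<omega>)}"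
  have "{\<omega>\<in>space M. coded xs (\<lambda>x. rc (u + int x) \<omega>)} = (\<Union>gs\<in>?G. ?E gs)"
    by (auto simp: coded_def)
  also have "emeasure M \<dots> = (\<integral>\<^sup>+gs. emeasure M (?E gs) \<partial>count_space ?G)"
    by (rule emeasure_UN_countable) (auto simp: disjoint_family_on_def dest: encodes_gaps_unique)
  also have "\<dots> = (\<integral>\<^sup>+gs. ennreal (q ^ linv xs) * ennreal (q ^ sum_list gs * (1 - q) ^ length xs) \<partial>count_space ?G)"
    by (rule nn_integral_cong)
      (use q xs in \<open>auto simp: emeasure_eq_measure prob_encodes gaps_def ennreal_mult[symmetric]\<close>)
  also have "\<dots> = ennreal (q ^ linv xs) * (\<integral>\<^sup>+gs. ennreal (q ^ sum_list gs * (1 - q) ^ length xs) \<partial>count_space ?G)"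
    by (rule nn_integral_cmult) simp
  finally show ?thesis .
qed

text \<open>The gap sum enters the law of every pattern through the same factor, so total mass one
  identifies it without computing it.\<close>

lemma prob_coded:
  assumes xs: "xs \<in> permutations_of_set {1..n}"
  shows "prob {\<omega>\<in>space M. coded xs (\<lambda>x. rc (u + int x) \<omega>)} = q ^ n * (q ^ linv xs / mallows_Z n q)"
proof -
  let ?P = "permutations_of_set {1..n}"
  let ?E = "\<lambda>ys. {\<omega>\<in>space M. coded ys (\<lambda>x. rc (u + int x) \<omega>)}"
  define I where "I = (\<integral>\<^sup>+gs. ennreal (q ^ sum_list gs * (1 - q) ^ n) \<partial>count_space (gaps n))"
  have Pd: "distinct ys" "set ys = {1..n}" "length ys = n" if "ys \<in> ?P" for ys
    using that distinct_card[of ys] by (auto simp: permutations_of_set_def)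
  have E: "emeasure M (?E ys) = ennreal (q ^ linv ys) * I" if "ys \<in> ?P" for ys
    using emeasure_coded[OF Pd(1)[OF that], of u] Pd(3)[OF that] by (simp add: I_def)
  \<comment> \<open>Each code without zeros on these \<open>n\<close> values comes from exactly one
    order, so the pattern events partition an event of probability \<open>q ^ n\<close>.\<close>
  have U: "(\<Union>ys\<in>?P. ?E ys) = {\<omega>\<in>space M. \<forall>z\<in>{u<..u + int n}. rc z \<omega> \<in> {1..}}"
  proof (intro set_eqI iffI)
    fix \<omega> assume "\<omega> \<in> (\<Union>ys\<in>?P. ?E ys)"
    then obtain ys where ys: "ys \<in> ?P" "\<omega> \<in> space M" "coded ys (\<lambda>x. rc (u + int x) \<omega>)" by auto
    have "rc z \<omega> \<in> {1..}" if "z \<in> {u<..u + int n}" for z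
    proof -
      have "nat (z - u) \<in> set ys" using Pd(2)[OF ys(1)] that by auto
      from coded_pos[OF ys(3) this] show ?thesis using that by simp
    qed
    then show "\<omega> \<in> {\<omega>\<in>space M. \<forall>z\<in>{u<..u + int n}. rc z \<omega> \<in> {1..}}" using ys by blast
  next
    fix \<omega> assume w: "\<omega> \<in> {\<omega>\<in>space M. \<forall>z\<in>{u<..u + int n}. rc z \<omega> \<in> {1..}}"
    have "\<exists>ys\<in>?P. coded ys (\<lambda>x. rc (u + int x) \<omega>)"
      by (rule coded_exists) (use w in auto)
    then show "\<omega> \<in> (\<Union>ys\<in>?P. ?E ys)" using w by blast
  qed
  have pq: "prob {\<omega>\<in>space M. \<forall>z\<in>{u<..u + int n}. rc z \<omega> \<in> {1..}} = q ^ n"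
  proof -
    have q1: "prob {\<omega>\<in>space M. rc z \<omega> \<in> {1..}} = q" for z
    proof -
      have "prob {\<omega>\<in>space M. \<not> rc z \<omega> = 0} = 1 - prob {\<omega>\<in>space M. rc z \<omega> = 0}"
        by (rule prob_neg) measurable
      moreover have "{\<omega>\<in>space M. rc z \<omega> \<in> {1..}} = {\<omega>\<in>space M. \<not> rc z \<omega> = 0}" by auto
      ultimately show ?thesis by (simp add: rc_iid(2))
    qed
    have "prob {\<omega>\<in>space M. \<forall>z\<in>{u<..u + int n}. rc z \<omega> \<in> {1..}} = (\<Prod>z\<in>{u<..u + int n}. prob {\<omega>\<in>space M. rc z \<omega> \<in> {1..}})"
      by (rule indep_vars_prob_Ball[OF rc_iid(1)]) auto
    then show ?thesis unfolding q1 by simp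
  qed
  have em: "emeasure M (\<Union>ys\<in>?P. ?E ys) = (\<Sum>ys\<in>?P. emeasure M (?E ys))"
  proof (rule sum_emeasure[symmetric])
    show "disjoint_family_on ?E ?P"
      unfolding disjoint_family_on_def
    proof (intro ballI impI equals0I)
      fix ys zs \<omega> assume y: "ys \<in> ?P" "zs \<in> ?P" "ys \<noteq> zs" and w: "\<omega> \<in> ?E ys \<inter> ?E zs"
      then have "ys = zs"
        using coded_unique[of ys "\<lambda>x. rc (u + int x) \<omega>" zs] Pd(1,2)[OF y(1)] Pd(1,2)[OF y(2)] by simp
      then show False using y(3) by simp
    qed
  qed auto
  have "ennreal (q ^ n) = emeasure M (\<Union>ys\<in>?P. ?E ys)"
    unfolding U by (simp only: emeasure_eq_measure pq)
  also have "\<dots> = (\<Sum>ys\<in>?P. ennreal (q ^ linv ys) * I)"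
    unfolding em by (rule sum.cong[OF refl E])
  also have "\<dots> = (\<Sum>ys\<in>?P. ennreal (q ^ linv ys)) * I"
    by (rule sum_distrib_right[symmetric])
  also have "(\<Sum>ys\<in>?P. ennreal (q ^ linv ys)) = ennreal (mallows_Z n q)"
    unfolding mallows_Z_conv by (rule sum_ennreal) (use q in simp)
  finally have eq: "ennreal (q ^ n) = ennreal (mallows_Z n q) * I" .
  have Z: "0 < mallows_Z n q" by (rule mallows_Z_pos[OF q(1)])
  have "I = ennreal (q ^ n / mallows_Z n q)"
  proof -
    have "ennreal (1 / mallows_Z n q) * ennreal (mallows_Z n q) = 1"
      using Z by (simp add: ennreal_mult[symmetric])
    then have "I = ennreal (1 / mallows_Z n q) * (ennreal (mallows_Z n q) * I)"
      by (simp add: mult.assoc[symmetric])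
    also have "\<dots> = ennreal (1 / mallows_Z n q * q ^ n)"
      unfolding eq[symmetric] using Z q by (intro ennreal_mult[symmetric]) auto
    finally show ?thesis by simp
  qed
  then have "emeasure M (?E xs) = ennreal (q ^ linv xs) * ennreal (q ^ n / mallows_Z n q)"
    using E[OF xs] by simp
  also have "\<dots> = ennreal (q ^ linv xs * (q ^ n / mallows_Z n q))"
    using q Z by (intro ennreal_mult[symmetric]) auto
  finally have "emeasure M (?E xs) = ennreal (q ^ linv xs * (q ^ n / mallows_Z n q))" .
  moreover have "0 \<le> q ^ linv xs * (q ^ n / mallows_Z n q)" using q Z by simp
  ultimately have "prob (?E xs) = q ^ linv xs * (q ^ n / mallows_Z n q)"
    by (simp only: measure_def enn2real_ennreal)
  then show ?thesis by (simp add: mult_ac)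
qed

lemma AE_zeros: "AE \<omega> in M. (\<forall>x. \<exists>y>x. rc y \<omega> = 0) \<and> (\<forall>x. \<exists>y<x. rc y \<omega> = 0)"
proof -
  have block: "AE \<omega> in M. \<exists>j. rc (f j) \<omega> = 0" if f: "inj f" for f :: "nat \<Rightarrow> int"
  proof -
    define N where "N = {\<omega>\<in>space M. \<forall>j. rc (f j) \<omega> \<noteq> 0}"
    have N: "N \<in> events" unfolding N_def by measurable
    have ne: "prob {\<omega>\<in>space M. rc z \<omega> \<in> - {0}} = q" for z
    proof -
      have "prob {\<omega>\<in>space M. \<not> rc z \<omega> = 0} = 1 - prob {\<omega>\<in>space M. rc z \<omega> = 0}"
        by (rule prob_neg) measurable
      then show ?thesis by (simp add: rc_iid(2))
    qed
    have le: "prob N \<le> q ^ n" for n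
    proof -
      have "prob N \<le> prob {\<omega>\<in>space M. \<forall>z\<in>f ` {..<n}. rc z \<omega> \<in> - {0}}"
        by (rule finite_measure_mono) (auto simp: N_def)
      also have "\<dots> = (\<Prod>z\<in>f ` {..<n}. prob {\<omega>\<in>space M. rc z \<omega> \<in> - {0}})"
        by (rule indep_vars_prob_Ball[OF rc_iid(1)]) auto
      also have "\<dots> = q ^ n" unfolding ne using f by (simp add: card_image inj_on_subset)
      finally show ?thesis .
    qed
    have "(\<lambda>n. q ^ n) \<longlonglongrightarrow> 0" using q by (intro LIMSEQ_power_zero) simp
    then have "prob N \<le> 0" by (rule LIMSEQ_le_const) (use le in blast)
    then have "N \<in> null_sets M" using N by (simp add: null_sets_def emeasure_eq_measure antisym)
    then show ?thesis by (rule AE_I') (auto simp: N_def)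
  qed
  have "AE \<omega> in M. \<exists>j. rc (x + 1 + int j) \<omega> = 0" "AE \<omega> in M. \<exists>j. rc (x - 1 - int j) \<omega> = 0" for x
    by (rule block; simp add: inj_def)+
  then have "AE \<omega> in M. \<forall>x. (\<exists>j. rc (x + 1 + int j) \<omega> = 0) \<and> (\<exists>j. rc (x - 1 - int j) \<omega> = 0)"
    by (simp add: AE_all_countable)
  then show ?thesis
  proof eventually_elim
    case (elim \<omega>)
    show ?case
    proof (intro conjI allI)
      fix x
      obtain i j where "rc (x + 1 + int j) \<omega> = 0" "rc (x - 1 - int i) \<omega> = 0" using elim by blast
      then show "\<exists>y>x. rc y \<omega> = 0" "\<exists>y<x. rc y \<omega> = 0"
        by (auto intro: exI[of _ "x + 1 + int j"] exI[of _ "x - 1 - int i"])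
    qed
  qed
qed

end

section \<open>Records, gaps and patterns\<close>

text \<open>A search tree sees only the relative order of the entries, so a segment may be replaced
  by its standardisation.\<close>

lemma bst_map_mono:
  fixes f :: "'a::linorder \<Rightarrow> 'b::linorder"
  assumes "\<And>x y. x \<in> set xs \<Longrightarrow> y \<in> set xs \<Longrightarrow> f x < f y \<longleftrightarrow> x < y"
  shows "bst (map f xs) = bst xs"
  using assms
proof (induction xs rule: bst.induct)
  case (2 x xs)
  have 1: "filter (\<lambda>y. y < f x) (map f xs) = map f (filter (\<lambda>y. y < x) xs)"
    "filter (\<lambda>y. f x < y) (map f xs) = map f (filter (\<lambda>y. x < y) xs)"
    unfolding filter_map o_def using 2(3) by (auto intro!: arg_cong[where f = "map f"] filter_cong)
  have "bst (map f (filter (\<lambda>y. y < x) xs)) = bst (filter (\<lambda>y. y < x) xs)"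
    "bst (map f (filter (\<lambda>y. x < y) xs)) = bst (filter (\<lambda>y. x < y) xs)"
    using 2 by auto
  then show ?case by (simp add: 1)
qed simp

text \<open>Records in value space. The codes are indexed by values, so the random zeros of the code
  are the points \<open>zeta \<sigma> k\<close>.\<close>

definition zeta :: "(int \<Rightarrow> int) \<Rightarrow> int \<Rightarrow> int" where
  "zeta \<sigma> k = \<sigma> (rec_enum \<sigma> k)"

definition pat :: "(int \<Rightarrow> int) \<Rightarrow> int \<Rightarrow> nat list" where
  "pat \<sigma> k = map (\<lambda>v. nat (v - zeta \<sigma> k)) (seg \<sigma> k)"

context
  fixes \<sigma> :: "int \<Rightarrow> int"
  assumes \<sigma>: "bij \<sigma>" and fin: "\<And>x z. finite {i. i < x \<and> z < \<sigma> i}"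
    and up: "\<And>x. \<exists>y>x. rcode \<sigma> y = 0" and down: "\<And>x. \<exists>y<x. rcode \<sigma> y = 0"
begin

lemma inv_simps: "\<sigma> (inv \<sigma> z) = z" "inv \<sigma> (\<sigma> i) = i"
  using \<sigma> by (simp_all add: bij_is_surj surj_f_inv_f bij_is_inj)

lemma records_iff: "r \<in> records \<sigma> \<longleftrightarrow> rcode \<sigma> (\<sigma> r) = 0"
proof -
  have "rcode \<sigma> (\<sigma> r) = 0 \<longleftrightarrow> {i. i < r \<and> \<sigma> r < \<sigma> i} = {}"
    unfolding rcode_def inv_simps using fin by (simp only: card_eq_0_iff) simp
  also have "\<dots> \<longleftrightarrow> (\<forall>k<r. \<not> \<sigma> r < \<sigma> k)" by auto
  also have "\<dots> \<longleftrightarrow> (\<forall>k<r. \<sigma> k < \<sigma> r)"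
    using \<sigma> by (metis bij_is_inj injD linorder_neqE_linordered_idom order_less_asym order_less_irrefl)
  finally show ?thesis by (simp add: records_def)
qed

text \<open>Along records, positions and values increase together, so each further zero of the code
  moves the record position by at least one. Zeros unbounded in both directions therefore give
  record positions unbounded in both directions.\<close>

lemma zeta_enum:
  "strict_mono (zeta \<sigma>)" "range (zeta \<sigma>) = {z. rcode \<sigma> z = 0}" "zeta \<sigma> 0 \<le> 0" "0 < zeta \<sigma> 1"
proof -
  have "enumerable_records \<sigma>" unfolding enumerable_records_def
  proof (intro conjI allI)
    fix x
    have inv_rec: "inv \<sigma> z \<in> records \<sigma>" if "rcode \<sigma> z = 0" for z
      using that records_iff[of "inv \<sigma> z"] by (simp add: inv_simps)
    have lt: "inv \<sigma> z < inv \<sigma> z'" if "rcode \<sigma> z = 0" "rcode \<sigma> z' = 0" "z < z'" for z z'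
      using records_mono[OF inv_rec[OF that(1)], of "inv \<sigma> z'"] that(3)
      by (cases "inv \<sigma> z" "inv \<sigma> z'" rule: linorder_cases) (auto simp: inv_simps, metis inv_simps(1) less_irrefl)
    show "\<exists>y. y \<in> records \<sigma> \<and> \<sigma> y \<le> 0" "\<exists>y. y \<in> records \<sigma> \<and> 0 < \<sigma> y"
      using up[of 0] down[of 0] inv_rec inv_simps(1) by (metis less_imp_le)+
    obtain z1 where z1: "rcode \<sigma> z1 = 0" using up[of 0] by blast
    have "\<exists>y. y \<in> records \<sigma> \<and> inv \<sigma> z1 - int n > y \<and> (\<exists>z<z1. y = inv \<sigma> z \<and> rcode \<sigma> z = 0)" for n
    proof (induction n)
      case 0
      obtain z where "z < z1" "rcode \<sigma> z = 0" using down by blast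
      then show ?case using lt[OF _ z1] inv_rec by (intro exI[of _ "inv \<sigma> z"]) auto
    next
      case (Suc n)
      then obtain z where z: "inv \<sigma> z1 - int n > inv \<sigma> z" "z < z1" "rcode \<sigma> z = 0" by blast
      obtain z' where z': "z' < z" "rcode \<sigma> z' = 0" using down by blast
      have "inv \<sigma> z' < inv \<sigma> z" using lt[OF z'(2) z(3) z'(1)] .
      then show ?case using z z' inv_rec by (intro exI[of _ "inv \<sigma> z'"] conjI exI[of _ z']) auto
    qed
    from this[of "nat (inv \<sigma> z1 - x)"] obtain y where
      y: "y \<in> records \<sigma>" "y < inv \<sigma> z1 - int (nat (inv \<sigma> z1 - x))" by blast
    then have "y < x" by linarith
    then show "\<exists>y. y \<in> records \<sigma> \<and> y < x" using y by blast
    have "\<exists>y. y \<in> records \<sigma> \<and> inv \<sigma> z1 + int n < y \<and> (\<exists>z>z1. y = inv \<sigma> z \<and> rcode \<sigma> z = 0)" for n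
    proof (induction n)
      case 0
      obtain z where "z1 < z" "rcode \<sigma> z = 0" using up by blast
      then show ?case using lt[OF z1] inv_rec by (intro exI[of _ "inv \<sigma> z"]) auto
    next
      case (Suc n)
      then obtain z where z: "inv \<sigma> z1 + int n < inv \<sigma> z" "z1 < z" "rcode \<sigma> z = 0" by blast
      obtain z' where z': "z < z'" "rcode \<sigma> z' = 0" using up by blast
      have "inv \<sigma> z < inv \<sigma> z'" using lt[OF z(3) z'(2) z'(1)] .
      then show ?case using z z' inv_rec by (intro exI[of _ "inv \<sigma> z'"] conjI exI[of _ z']) auto
    qed
    from this[of "nat (x - inv \<sigma> z1)"] obtain y where
      y: "y \<in> records \<sigma>" "inv \<sigma> z1 + int (nat (x - inv \<sigma> z1)) < y" by blast
    then have "x < y" by linarith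
    then show "\<exists>y. y \<in> records \<sigma> \<and> x < y" using y by blast
  qed
  from rec_enum_valid[OF this] have r: "strict_mono (rec_enum \<sigma>)" "range (rec_enum \<sigma>) = records \<sigma>"
    "\<sigma> (rec_enum \<sigma> 0) \<le> 0" "0 < \<sigma> (rec_enum \<sigma> 1)"
    unfolding is_rec_enum_def by simp_all
  show "strict_mono (zeta \<sigma>)"
  proof (rule strict_monoI)
    fix i j :: int assume "i < j"
    then have "rec_enum \<sigma> i < rec_enum \<sigma> j" using r(1) by (simp add: strict_mono_less)
    moreover have "rec_enum \<sigma> j \<in> records \<sigma>" using r(2) by (metis rangeI)
    ultimately show "zeta \<sigma> i < zeta \<sigma> j"
      using records_mono[of "rec_enum \<sigma> j" \<sigma> "rec_enum \<sigma> i"] by (simp add: zeta_def)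
  qed
  have "range (zeta \<sigma>) = \<sigma> ` range (rec_enum \<sigma>)" unfolding zeta_def by (simp add: image_image)
  also have "\<dots> = \<sigma> ` records \<sigma>" by (simp only: r(2))
  also have "\<dots> = {z. rcode \<sigma> z = 0}"
  proof (intro set_eqI iffI)
    fix z assume "z \<in> {z. rcode \<sigma> z = 0}"
    then show "z \<in> \<sigma> ` records \<sigma>"
      using records_iff[of "inv \<sigma> z"] by (intro image_eqI[of _ _ "inv \<sigma> z"]) (simp_all add: inv_simps)
  qed (auto simp: records_iff)
  finally show "range (zeta \<sigma>) = {z. rcode \<sigma> z = 0}" .
  show "zeta \<sigma> 0 \<le> 0" "0 < zeta \<sigma> 1" using r by (simp_all add: zeta_def)
qed

lemma zeta_zero: "rcode \<sigma> (zeta \<sigma> k) = 0"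
  using zeta_enum(2) by blast

lemma zeta_gap: "zeta \<sigma> k < z \<Longrightarrow> z < zeta \<sigma> (k + 1) \<Longrightarrow> 1 \<le> rcode \<sigma> z"
  using strict_mono_int_gap[OF zeta_enum(1), of k z] zeta_enum(2) by (metis (mono_tags, lifting) less_one linorder_not_le mem_Collect_eq)

lemma pat_props:
  defines "n k \<equiv> nat (zeta \<sigma> (k + 1) - zeta \<sigma> k - 1)"
  shows "pat \<sigma> k \<in> permutations_of_set {1..n k}"
    "coded (pat \<sigma> k) (\<lambda>x. rcode \<sigma> (zeta \<sigma> k + int x))"
    "bst (seg \<sigma> k) = bst (pat \<sigma> k)"
proof -
  let ?z = "zeta \<sigma> k" and ?z' = "zeta \<sigma> (k + 1)"
  define S where "S = {i. ?z < \<sigma> i \<and> \<sigma> i < ?z'}"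
  have Sim: "\<sigma> ` S = {?z<..<?z'}"
  proof (intro set_eqI iffI)
    fix v assume "v \<in> {?z<..<?z'}"
    then show "v \<in> \<sigma> ` S" by (intro image_eqI[of _ _ "inv \<sigma> v"]) (auto simp: S_def inv_simps)
  qed (auto simp: S_def)
  have inj: "inj_on \<sigma> A" for A by (rule inj_on_subset[OF bij_is_inj[OF \<sigma>]]) simp
  have finS: "finite S" using Sim inj[of S] by (metis finite_greaterThanLessThan_int finite_imageD)
  define ps where "ps = sorted_list_of_set S"
  have ps: "set ps = S" "sorted ps" "distinct ps" using finS by (simp_all add: ps_def)
  have sps: "ps ! i < ps ! j \<longleftrightarrow> i < j" if "i < length ps" "j < length ps" for i j
    using ps that by (metis linorder_neqE_nat nth_eq_iff_index_eq order_less_asym order_less_irrefl sorted_nth_mono nless_le)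
  have seg: "seg \<sigma> k = map \<sigma> ps" by (simp add: seg_def Let_def ps_def S_def zeta_def)
  let ?f = "\<lambda>i. nat (\<sigma> i - ?z)"
  have pat: "pat \<sigma> k = map ?f ps" by (simp add: pat_def seg)
  have f: "\<sigma> i = ?z + int (?f i)" if "i \<in> S" for i using that by (simp add: S_def)
  have f_less: "?f i < ?f j \<longleftrightarrow> \<sigma> i < \<sigma> j" if "i \<in> S" "j \<in> S" for i j using f[OF that(1)] f[OF that(2)] by linarith
  have injf: "inj_on ?f S" using f inj[of S] by (metis (no_types, lifting) inj_on_def)
  show "pat \<sigma> k \<in> permutations_of_set {1..n k}"
  proof (rule permutations_of_setI)
    have "set (pat \<sigma> k) = (\<lambda>v. nat (v - ?z)) ` (\<sigma> ` S)" by (simp add: pat ps image_image)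
    also have "\<dots> = {1..n k}" unfolding Sim
    proof (intro set_eqI iffI)
      fix x assume "x \<in> {1..n k}"
      then show "x \<in> (\<lambda>v. nat (v - ?z)) ` {?z<..<?z'}"
        by (intro image_eqI[of _ _ "?z + int x"]) (auto simp: n_def)
    qed (auto simp: n_def)
    finally show "set (pat \<sigma> k) = {1..n k}" .
    show "distinct (pat \<sigma> k)" unfolding pat distinct_map using ps injf by simp
  qed
  show "bst (seg \<sigma> k) = bst (pat \<sigma> k)"
  proof -
    have "bst (map (\<lambda>v. nat (v - ?z)) (seg \<sigma> k)) = bst (seg \<sigma> k)"
      by (rule bst_map_mono) (auto simp: seg ps S_def)
    then show ?thesis by (simp add: pat_def)
  qed
  \<comment> \<open>Larger predecessors of an entry of the gap are either at least the next record
    value, counted here, or lie in the gap, counted by \<open>larger_before\<close>.\<close>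
  define gs where "gs = map (\<lambda>p. card {j. j < p \<and> ?z' \<le> \<sigma> j}) ps"
  have finp: "finite {j. j < p \<and> ?z' \<le> \<sigma> j}" for p
    by (rule finite_subset[OF _ fin[of p "?z' - 1"]]) auto
  have enc: "encodes (pat \<sigma> k) gs (\<lambda>x. rcode \<sigma> (?z + int x))"
    unfolding encodes_def
  proof (intro conjI allI impI)
    show "length gs = length (pat \<sigma> k)" by (simp add: gs_def pat)
    fix i assume "i < length (pat \<sigma> k)"
    then have i: "i < length ps" by (simp add: pat)
    define p where "p = ps ! i"
    have pS: "p \<in> S" using i ps by (auto simp: p_def)
    have "rcode \<sigma> (?z + int (pat \<sigma> k ! i)) = rcode \<sigma> (\<sigma> p)"
      using f[OF pS] i by (simp add: pat p_def)
    also have "\<dots> = card {j. j < p \<and> \<sigma> p < \<sigma> j}" by (simp add: rcode_def inv_simps)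
    also have "{j. j < p \<and> \<sigma> p < \<sigma> j} = {j. j < p \<and> ?z' \<le> \<sigma> j} \<union> {j. j < p \<and> j \<in> S \<and> \<sigma> p < \<sigma> j}"
      using pS by (auto simp: S_def)
    also have "card \<dots> = card {j. j < p \<and> ?z' \<le> \<sigma> j} + card {j. j < p \<and> j \<in> S \<and> \<sigma> p < \<sigma> j}"
    proof (rule card_Un_disjoint[OF finp])
      show "finite {j. j < p \<and> j \<in> S \<and> \<sigma> p < \<sigma> j}" by (rule finite_subset[OF _ finS]) auto
    qed (auto simp: S_def)
    also have "{j. j < p \<and> j \<in> S \<and> \<sigma> p < \<sigma> j} = (\<lambda>j. ps ! j) ` {j. j < i \<and> pat \<sigma> k ! i < pat \<sigma> k ! j}"
    proof (intro set_eqI iffI)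
      fix x assume x: "x \<in> {j. j < p \<and> j \<in> S \<and> \<sigma> p < \<sigma> j}"
      then obtain j where j: "j < length ps" "x = ps ! j" using ps(1) by (auto simp: in_set_conv_nth)
      then have "j < i" using x sps[OF j(1) i] by (simp add: p_def)
      then show "x \<in> (\<lambda>j. ps ! j) ` {j. j < i \<and> pat \<sigma> k ! i < pat \<sigma> k ! j}"
        using x j i f_less[OF pS, of x] by (auto simp: pat p_def)
    next
      fix x assume "x \<in> (\<lambda>j. ps ! j) ` {j. j < i \<and> pat \<sigma> k ! i < pat \<sigma> k ! j}"
      then obtain j where j: "j < i" "x = ps ! j" "pat \<sigma> k ! i < pat \<sigma> k ! j" by auto
      then have "x \<in> S" using ps(1) i by auto
      then show "x \<in> {j. j < p \<and> j \<in> S \<and> \<sigma> p < \<sigma> j}"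
        using j i sps[of j i] f_less[OF pS, of x] by (auto simp: pat p_def)
    qed
    also have "card \<dots> = larger_before (pat \<sigma> k) i"
      unfolding larger_before_def
      by (rule card_image) (use ps(3) i in \<open>auto simp: inj_on_def nth_eq_iff_index_eq\<close>)
    finally show "rcode \<sigma> (?z + int (pat \<sigma> k ! i)) = gs ! i + larger_before (pat \<sigma> k) i"
      using i by (simp add: gs_def p_def)
  qed
  have sgs: "sorted gs"
    unfolding sorted_iff_nth_mono
  proof (intro allI impI)
    fix i j assume ij: "i \<le> j" "j < length gs"
    then have "ps ! i \<le> ps ! j" using ps(2) by (simp add: gs_def sorted_nth_mono)
    then have "card {l. l < ps ! i \<and> ?z' \<le> \<sigma> l} \<le> card {l. l < ps ! j \<and> ?z' \<le> \<sigma> l}"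
      by (intro card_mono finp) auto
    then show "gs ! i \<le> gs ! j" using ij by (simp add: gs_def)
  qed
  \<comment> \<open>By sortedness only the first offset matters; it is the entire code of the first
    entry, which is nonzero because that value lies strictly between consecutive records.\<close>
  have "1 \<le> g" if "g \<in> set gs" for g
  proof -
    obtain j where j: "j < length gs" "g = gs ! j" using \<open>g \<in> set gs\<close> by (auto simp: in_set_conv_nth)
    then have l: "0 < length ps" "0 < length gs" by (auto simp: gs_def)
    have "ps ! 0 \<in> S" using l ps by auto
    then have "1 \<le> rcode \<sigma> (\<sigma> (ps ! 0))" by (intro zeta_gap[of k]) (auto simp: S_def)
    also have "rcode \<sigma> (\<sigma> (ps ! 0)) = gs ! 0"
      using enc l f[OF \<open>ps ! 0 \<in> S\<close>] by (auto simp: encodes_def pat)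
    also have "gs ! 0 \<le> g" using sgs j l by (simp add: sorted_nth_mono)
    finally show ?thesis .
  qed
  then have "gs \<in> gaps (length (pat \<sigma> k))" using sgs enc by (simp add: gaps_def encodes_def)
  then show "coded (pat \<sigma> k) (\<lambda>x. rcode \<sigma> (?z + int x))" unfolding coded_def using enc by blast
qed

end

section \<open>The joint law of the patterns\<close>

text \<open>Each \<open>P j\<close> reads only the coordinates in \<open>K j\<close>, and on a
  finite product of countable discrete spaces every set is measurable, so independence of the
  restrictions applies to arbitrary predicates.\<close>

lemma (in prob_space) indep_vars_blocks:
  fixes X :: "'i \<Rightarrow> 'a \<Rightarrow> 'b::countable"
  assumes ind: "indep_vars (\<lambda>_. count_space UNIV) X UNIV"
    and L: "finite L" and K: "\<And>j. j \<in> L \<Longrightarrow> finite (K j)" "disjoint_family_on K L"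
    and P: "\<And>j f g. j \<in> L \<Longrightarrow> (\<And>i. i \<in> K j \<Longrightarrow> f i = g i) \<Longrightarrow> P j f \<longleftrightarrow> P j g"
  shows "prob {\<omega>\<in>space M. \<forall>j\<in>L. P j (\<lambda>i. X i \<omega>)} = (\<Prod>j\<in>L. prob {\<omega>\<in>space M. P j (\<lambda>i. X i \<omega>)})"
proof (cases "L = {}")
  case True
  then show ?thesis by (simp add: prob_space)
next
  case False
  let ?Y = "\<lambda>j \<omega>. restrict (\<lambda>i. X i \<omega>) (K j)"
  let ?M = "\<lambda>j. PiM (K j) (\<lambda>_. count_space UNIV :: 'b measure)"
  let ?A = "\<lambda>j. {f \<in> space (?M j). P j f}"
  have iv: "indep_vars ?M ?Y L"
    by (rule indep_vars_restrict[OF ind _ K(2)]) simp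
  have A: "?A j \<in> sets (?M j)" if "j \<in> L" for j
    unfolding count_space_PiM_finite[OF K(1)[OF that], of "\<lambda>_. UNIV", OF countableI_type] by simp
  have pre: "?Y j -` ?A j \<inter> space M = {\<omega>\<in>space M. P j (\<lambda>i. X i \<omega>)}" if "j \<in> L" for j
    using P[OF that, of "restrict (\<lambda>i. X i _) (K j)" "\<lambda>i. X i _"]
    by (auto simp: space_PiM)
  have "{\<omega>\<in>space M. \<forall>j\<in>L. P j (\<lambda>i. X i \<omega>)} = (\<Inter>j\<in>L. ?Y j -` ?A j \<inter> space M)"
    using False pre by auto
  also have "prob \<dots> = (\<Prod>j\<in>L. prob (?Y j -` ?A j \<inter> space M))"
    by (rule indep_varsD[OF iv False L order_refl]) (rule A)
  also have "\<dots> = (\<Prod>j\<in>L. prob {\<omega>\<in>space M. P j (\<lambda>i. X i \<omega>)})"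
    by (rule prod.cong[OF refl]) (simp only: pre)
  finally show ?thesis .
qed

lemma coded_cong:
  assumes "\<And>x. x \<in> set xs \<Longrightarrow> c x = c' x"
  shows "coded xs c \<longleftrightarrow> coded xs c'"
  using assms by (simp add: coded_def encodes_def)

text \<open>Where the zeros of the code must be if zero number 0 is at \<open>z0\<close> and
  \<open>n k\<close> values separate the zeros number \<open>k\<close> and
  \<open>k + 1\<close>.\<close>

definition zero_pos :: "int \<Rightarrow> (int \<Rightarrow> nat) \<Rightarrow> int \<Rightarrow> int" where
  "zero_pos z0 n k = z0 + (if 0 \<le> k then (\<Sum>j\<in>{0..<k}. int (n j) + 1) else - (\<Sum>j\<in>{k..<0}. int (n j) + 1))"

lemma zero_pos_0 [simp]: "zero_pos z0 n 0 = z0"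
  by (simp add: zero_pos_def)

lemma zero_pos_Suc: "zero_pos z0 n (k + 1) = zero_pos z0 n k + int (n k) + 1"
proof (cases "0 \<le> k")
  case True
  then have "{0..<k + 1} = insert k {0..<k}" by auto
  then show ?thesis using True by (simp add: zero_pos_def)
next
  case False
  then have "{k..<0} = insert k {k + 1..<0}" by auto
  then have "zero_pos z0 n k = z0 - (\<Sum>j\<in>{k + 1..<0}. int (n j) + 1) - int (n k) - 1"
    using False by (simp add: zero_pos_def)
  moreover have "zero_pos z0 n (k + 1) = z0 - (\<Sum>j\<in>{k + 1..<0}. int (n j) + 1)"
    using False by (cases "k + 1 = 0") (auto simp: zero_pos_def)
  ultimately show ?thesis by simp
qed

lemma strict_mono_intI:
  fixes f :: "int \<Rightarrow> int"
  assumes "\<And>k. f k < f (k + 1)"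
  shows "strict_mono f"
proof (rule strict_monoI)
  fix i j :: int assume "i < j"
  then show "f i < f j"
  proof (induction j rule: int_gr_induct)
    case base
    show ?case by (rule assms)
  next
    case (step j)
    then show ?case using assms[of j] by simp
  qed
qed

lemma strict_mono_zero_pos: "strict_mono (zero_pos z0 n)"
  by (rule strict_mono_intI) (simp add: zero_pos_Suc)

lemma int_propagate:
  fixes N :: int
  assumes "f 0 = g 0" "\<And>k. k \<in> {- N..N} \<Longrightarrow> f k = g k \<longleftrightarrow> f (k + 1) = g (k + 1)" "k \<in> {- N..N + 1}"
  shows "f k = g k"
  using assms(3)
proof (induction k rule: int_induct[where k = 0])
  case base show ?case by (rule assms)
next
  case (step1 i)
  then show ?case using assms(2)[of i] by simp
next
  case (step2 i)
  then show ?case using assms(2)[of "i - 1"] by simp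
qed

definition regular :: "(int \<Rightarrow> int) \<Rightarrow> bool" where
  "regular \<sigma> \<longleftrightarrow> bij \<sigma> \<and> (\<forall>x z. finite {i. i < x \<and> z < \<sigma> i}) \<and>
     (\<forall>x. \<exists>y>x. rcode \<sigma> y = 0) \<and> (\<forall>x. \<exists>y<x. rcode \<sigma> y = 0)"

lemma regularD:
  assumes "regular \<sigma>"
  shows "strict_mono (zeta \<sigma>)" "range (zeta \<sigma>) = {z. rcode \<sigma> z = 0}" "zeta \<sigma> 0 \<le> 0" "0 < zeta \<sigma> 1"
    "rcode \<sigma> (zeta \<sigma> k) = 0"
    "pat \<sigma> k \<in> permutations_of_set {1..nat (zeta \<sigma> (k + 1) - zeta \<sigma> k - 1)}"
    "coded (pat \<sigma> k) (\<lambda>x. rcode \<sigma> (zeta \<sigma> k + int x))"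
    "bst (seg \<sigma> k) = bst (pat \<sigma> k)"
proof -
  have a: "bij \<sigma>" "\<And>x z. finite {i. i < x \<and> z < \<sigma> i}"
    "\<And>x. \<exists>y>x. rcode \<sigma> y = 0" "\<And>x. \<exists>y<x. rcode \<sigma> y = 0"
    using assms unfolding regular_def by blast+
  show "strict_mono (zeta \<sigma>)" "range (zeta \<sigma>) = {z. rcode \<sigma> z = 0}" "zeta \<sigma> 0 \<le> 0" "0 < zeta \<sigma> 1"
    by (rule zeta_enum[OF a])+
  show "rcode \<sigma> (zeta \<sigma> k) = 0" by (rule zeta_zero[OF a])
  show "pat \<sigma> k \<in> permutations_of_set {1..nat (zeta \<sigma> (k + 1) - zeta \<sigma> k - 1)}"
    "coded (pat \<sigma> k) (\<lambda>x. rcode \<sigma> (zeta \<sigma> k + int x))" "bst (seg \<sigma> k) = bst (pat \<sigma> k)"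
    by (rule pat_props[OF a])+
qed

lemma length_pat:
  assumes "regular \<sigma>"
  shows "zeta \<sigma> (k + 1) = zeta \<sigma> k + int (length (pat \<sigma> k)) + 1"
proof -
  have "length (pat \<sigma> k) = card {1..nat (zeta \<sigma> (k + 1) - zeta \<sigma> k - 1)}"
    using regularD(6)[OF assms, of k] by (auto dest: permutations_of_setD simp: distinct_card[symmetric] permutations_of_set_def)
  moreover have "zeta \<sigma> k < zeta \<sigma> (k + 1)" using regularD(1)[OF assms] by (simp add: strict_mono_less)
  ultimately show ?thesis by simp
qed

text \<open>The pattern lengths and record value number 0 locate all zeros of the window. Conversely
  \<open>coded\<close> forces nonzero code inside each gap, so prescribed zeros are consecutive, and
  the bounds on \<open>a\<close> make gap 0 straddle the cut, which fixes the numbering.\<close>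

lemma pat_event:
  fixes N a :: int
  assumes reg: "regular \<sigma>" and N: "0 \<le> N"
    and xs: "\<And>k. k \<in> {- N..N} \<Longrightarrow> xs k \<in> permutations_of_set {1..length (xs k)}"
    and a: "0 \<le> a" "a \<le> int (length (xs 0))"
  defines "z \<equiv> zero_pos (- a) (\<lambda>k. length (xs k))"
  shows "(\<forall>k\<in>{- N..N}. pat \<sigma> k = xs k) \<and> zeta \<sigma> 0 = - a \<longleftrightarrow>
    (\<forall>k\<in>{- N..N + 1}. rcode \<sigma> (z k) = 0) \<and> (\<forall>k\<in>{- N..N}. coded (xs k) (\<lambda>x. rcode \<sigma> (z k + int x)))"
    (is "?L \<longleftrightarrow> ?R")
proof -
  note r = regularD[OF reg]
  have zS: "z (k + 1) = z k + int (length (xs k)) + 1" for k by (simp add: z_def zero_pos_Suc)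
  have z0: "z 0 = - a" by (simp add: z_def)
  show ?thesis
  proof
    assume L: ?L
    have eq: "zeta \<sigma> k = z k" if "k \<in> {- N..N + 1}" for k
    proof (rule int_propagate[OF _ _ that])
      show "zeta \<sigma> 0 = z 0" using L z0 by simp
      fix k assume "k \<in> {- N..N}"
      then have "pat \<sigma> k = xs k" using L by blast
      then show "zeta \<sigma> k = z k \<longleftrightarrow> zeta \<sigma> (k + 1) = z (k + 1)"
        using length_pat[OF reg, of k] zS[of k] by simp
    qed
    show ?R
    proof (intro conjI ballI)
      fix k assume "k \<in> {- N..N + 1}"
      then show "rcode \<sigma> (z k) = 0" using eq[of k] r(5)[of k] by simp
    next
      fix k assume k: "k \<in> {- N..N}"
      then show "coded (xs k) (\<lambda>x. rcode \<sigma> (z k + int x))"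
        using eq[of k] r(7)[of k] L by simp
    qed
  next
    assume R: ?R
    have zr: "z k \<in> range (zeta \<sigma>)" if "k \<in> {- N..N + 1}" for k using R that r(2) by simp
    have gap: "w \<notin> range (zeta \<sigma>)" if k: "k \<in> {- N..N}" and w: "z k < w" "w < z (k + 1)" for k w
    proof -
      have "nat (w - z k) \<in> set (xs k)"
        using w zS[of k] permutations_of_setD(1)[OF xs[OF k]] by auto
      moreover have "coded (xs k) (\<lambda>x. rcode \<sigma> (z k + int x))" using R k by blast
      ultimately have "1 \<le> rcode \<sigma> (z k + int (nat (w - z k)))" by (rule coded_pos[rotated])
      then show ?thesis unfolding r(2) using w by simp
    qed
    have next_iff: "zeta \<sigma> k = z k \<longleftrightarrow> zeta \<sigma> (k + 1) = z (k + 1)" if k: "k \<in> {- N..N}" for k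
    proof
      have lt: "z k < z (k + 1)" using zS[of k] by simp
      assume e: "zeta \<sigma> k = z k"
      show "zeta \<sigma> (k + 1) = z (k + 1)"
        unfolding int_enumeration_next[OF r(1)] e using zr[of "k + 1"] gap[OF k] lt k by auto
    next
      have lt: "z k < z (k + 1)" using zS[of k] by simp
      assume e: "zeta \<sigma> (k + 1) = z (k + 1)"
      have "zeta \<sigma> (k + 1 - 1) = z k"
        unfolding int_enumeration_prev[OF r(1)] e using zr[of k] gap[OF k] lt k by auto
      then show "zeta \<sigma> k = z k" by simp
    qed
    \<comment> \<open>Since \<open>z 0\<close> is \<le> 0, \<open>z (0 + 1)\<close> is positive and
      no zero lies strictly between them, the standard numbering assigns index 0 to
      \<open>z 0\<close>.\<close>
    have "zeta \<sigma> 0 = z 0"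
    proof -
      have "z 0 \<in> range (zeta \<sigma>)" by (rule zr) (use N in simp)
      then obtain j where j: "zeta \<sigma> j = z 0" by (metis rangeE)
      have "zeta \<sigma> j < zeta \<sigma> 1" using j z0 a r(4) by simp
      then have "j \<le> 0" using r(1) by (simp add: strict_mono_less)
      moreover have "\<not> j < 0"
      proof
        assume "j < 0"
        then have "zeta \<sigma> j < zeta \<sigma> 0" using r(1) by (simp add: strict_mono_less)
        moreover have "zeta \<sigma> 0 < z (0 + 1)" using r(3) zS[of 0] z0 a by simp
        ultimately have "zeta \<sigma> 0 \<notin> range (zeta \<sigma>)" using j N by (intro gap[of 0]) auto
        then show False by simp
      qed
      ultimately show ?thesis using j by simp
    qed
    then have eq: "zeta \<sigma> k = z k" if "k \<in> {- N..N + 1}" for k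
      using int_propagate[of "zeta \<sigma>" z N k] next_iff that by blast
    show ?L
    proof (intro conjI ballI)
      fix k assume k: "k \<in> {- N..N}"
      then have e: "zeta \<sigma> k = z k" "zeta \<sigma> (k + 1) = z (k + 1)" using eq[of k] eq[of "k + 1"] by auto
      show "pat \<sigma> k = xs k"
      proof (rule coded_unique)
        show "coded (pat \<sigma> k) (\<lambda>x. rcode \<sigma> (z k + int x))" using r(7)[of k] e by simp
        show "coded (xs k) (\<lambda>x. rcode \<sigma> (z k + int x))" using R k by blast
        have "nat (zeta \<sigma> (k + 1) - zeta \<sigma> k - 1) = length (xs k)" using e zS[of k] by simp
        then have p: "pat \<sigma> k \<in> permutations_of_set {1..length (xs k)}" using r(6)[of k] by simp
        show "distinct (pat \<sigma> k)" "distinct (xs k)" "set (pat \<sigma> k) = set (xs k)"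
          using permutations_of_setD[OF p] permutations_of_setD[OF xs[OF k]] by simp_all
      qed
    next
      show "zeta \<sigma> 0 = - a" using eq[of 0] N z0 by simp
    qed
  qed
qed

section \<open>Windows of patterns and the size bias at the cut\<close>

context mallows_driver
begin

lemma AE_regular: "AE \<omega> in M. regular (perm \<omega>) \<and> (\<forall>z. rc z \<omega> = rcode (perm \<omega>) z)"
  using AE_good AE_zeros
proof eventually_elim
  case (elim \<omega>)
  then show ?case
    using good_perm[OF elim(1)] rcode_finite[OF good_perm(1,3)[OF elim(1)]] good_codes(1)[OF elim(1)]
    by (simp add: regular_def)
qed

lemma zeta_measurable [measurable]: "(\<lambda>\<omega>. zeta (perm \<omega>) k) \<in> measurable M (count_space UNIV)"
  unfolding zeta_def
  by (rule measurable_count_comp2[OF measurable_rec_enum[OF perm_measurable] perm_measurable])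

lemma pat_measurable [measurable]: "(\<lambda>\<omega>. pat (perm \<omega>) k) \<in> measurable M (count_space UNIV)"
  unfolding pat_def
  by (rule measurable_count_comp2[OF zeta_measurable]) (rule measurable_count_comp[OF measurable_seg[OF perm_measurable]])

definition pat_weight :: "nat list \<Rightarrow> real" where
  "pat_weight xs = q ^ length xs * (q ^ linv xs / mallows_Z (length xs) q)"

lemma pat_weight_nonneg: "0 \<le> pat_weight xs"
  using q mallows_Z_pos[OF q(1), of "length xs"] by (simp add: pat_weight_def)

text \<open>The \<open>2 * N + 1\<close> gaps are bounded by \<open>2 * N + 2\<close> zeros, which
  leaves one unpaired factor \<open>1 - q\<close>. The result does not depend on
  \<open>a\<close>.\<close>

lemma prob_window:
  fixes N a :: int
  assumes xs: "\<And>k. k \<in> {- N..N} \<Longrightarrow> xs k \<in> permutations_of_set {1..length (xs k)}" and N: "0 \<le> N"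
  defines "z \<equiv> zero_pos (- a) (\<lambda>k. length (xs k))"
  shows "prob {\<omega>\<in>space M. (\<forall>k\<in>{- N..N + 1}. rc (z k) \<omega> = 0) \<and>
      (\<forall>k\<in>{- N..N}. coded (xs k) (\<lambda>x. rc (z k + int x) \<omega>))}
    = (1 - q) * (\<Prod>k\<in>{- N..N}. (1 - q) * pat_weight (xs k))"
proof -
  \<comment> \<open>Blocks tagged \<open>False\<close> are single zeros, blocks tagged
    \<open>True\<close> the open gaps between them.\<close>
  let ?L = "{False} \<times> {- N..N + 1} \<union> {True} \<times> {- N..N}"
  define K where "K j = (if fst j then {z (snd j)<..<z (snd j + 1)} else {z (snd j)})" for j :: "bool \<times> int"
  define P where "P j f \<longleftrightarrow> (if fst j then coded (xs (snd j)) (\<lambda>x. f (z (snd j) + int x)) else f (z (snd j)) = 0)"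
    for j :: "bool \<times> int" and f :: "int \<Rightarrow> nat"
  have zS: "z (k + 1) = z k + int (length (xs k)) + 1" for k by (simp add: z_def zero_pos_Suc)
  have sm: "strict_mono z" unfolding z_def by (rule strict_mono_zero_pos)
  have disj: "disjoint_family_on K ?L"
    unfolding disjoint_family_on_def
  proof (intro ballI impI)
    have 1: "{z k<..<z (k + 1)} \<inter> {z j} = {}" for k j
      using strict_mono_int_gap[OF sm, of k "z j"] by auto
    have 2: "{z k<..<z (k + 1)} \<inter> {z j<..<z (j + 1)} = {}" if "k < j" for k j
    proof -
      have "z (k + 1) \<le> z j" using that sm by (simp add: strict_mono_less_eq)
      then show ?thesis by auto
    qed
    have 3: "{z k<..<z (k + 1)} \<inter> {z j<..<z (j + 1)} = {}" if "k \<noteq> j" for k j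
      using 2[of k j] 2[of j k] that by (cases k j rule: linorder_cases) (auto simp: Int_commute)
    have 4: "z k \<noteq> z j" if "k \<noteq> j" for k j using sm that by (simp add: strict_mono_eq)
    fix m n assume "m \<in> ?L" "n \<in> ?L" "m \<noteq> n"
    then show "K m \<inter> K n = {}"
      using 1[of "snd m" "snd n"] 1[of "snd n" "snd m"] 3[of "snd m" "snd n"] 4[of "snd m" "snd n"]
      by (cases m; cases n) (auto simp: K_def)
  qed
  have Pdep: "P j f \<longleftrightarrow> P j g" if "j \<in> ?L" "\<And>i. i \<in> K j \<Longrightarrow> f i = g i" for j f g
  proof (cases "fst j")
    case True
    then have k: "snd j \<in> {- N..N}" using that(1) by auto
    have "coded (xs (snd j)) (\<lambda>x. f (z (snd j) + int x)) \<longleftrightarrow> coded (xs (snd j)) (\<lambda>x. g (z (snd j) + int x))"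
    proof (rule coded_cong, rule that(2))
      fix x assume "x \<in> set (xs (snd j))"
      then have "x \<in> {1..length (xs (snd j))}" using permutations_of_setD(1)[OF xs[OF k]] by simp
      then show "z (snd j) + int x \<in> K j" using True zS[of "snd j"] by (simp add: K_def)
    qed
    then show ?thesis using True by (simp add: P_def)
  next
    case False
    then show ?thesis using that(2) by (simp add: P_def K_def)
  qed
  have ev: "{\<omega>\<in>space M. (\<forall>k\<in>{- N..N + 1}. rc (z k) \<omega> = 0) \<and>
      (\<forall>k\<in>{- N..N}. coded (xs k) (\<lambda>x. rc (z k + int x) \<omega>))} = {\<omega>\<in>space M. \<forall>j\<in>?L. P j (\<lambda>i. rc i \<omega>)}"
    unfolding ball_Un P_def by auto
  have "prob {\<omega>\<in>space M. \<forall>j\<in>?L. P j (\<lambda>i. rc i \<omega>)} = (\<Prod>j\<in>?L. prob {\<omega>\<in>space M. P j (\<lambda>i. rc i \<omega>)})"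
    by (rule indep_vars_blocks[OF rc_iid(1) _ _ disj Pdep]) (auto simp: K_def)
  also have "\<dots> = (\<Prod>j\<in>{False} \<times> {- N..N + 1}. prob {\<omega>\<in>space M. P j (\<lambda>i. rc i \<omega>)}) *
      (\<Prod>j\<in>{True} \<times> {- N..N}. prob {\<omega>\<in>space M. P j (\<lambda>i. rc i \<omega>)})"
    by (rule prod.union_disjoint) auto
  also have "(\<Prod>j\<in>{False} \<times> {- N..N + 1}. prob {\<omega>\<in>space M. P j (\<lambda>i. rc i \<omega>)}) = (\<Prod>j\<in>{False} \<times> {- N..N + 1}. 1 - q)"
    by (rule prod.cong) (auto simp: P_def rc_iid(2))
  also have "\<dots> = (1 - q) * (\<Prod>k\<in>{- N..N}. 1 - q)"
  proof -
    have "nat (2 + 2 * N) = Suc (nat (2 * N + 1))" using N by simp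
    then show ?thesis using N by (simp add: card_cartesian_product)
  qed
  also have "(\<Prod>j\<in>{True} \<times> {- N..N}. prob {\<omega>\<in>space M. P j (\<lambda>i. rc i \<omega>)}) = (\<Prod>j\<in>Pair True ` {- N..N}. pat_weight (xs (snd j)))"
    by (rule prod.cong) (auto simp: P_def pat_weight_def prob_coded[OF xs])
  also have "\<dots> = (\<Prod>k\<in>{- N..N}. pat_weight (xs k))"
    by (subst prod.reindex) (auto simp: inj_on_def)
  finally show ?thesis unfolding ev by (simp add: prod.distrib)
qed

text \<open>The unpaired factor \<open>1 - q\<close> and the \<open>length xs + 1\<close> possible
  places of the cut are both assigned to index 0.\<close>

definition pat_law :: "int \<Rightarrow> nat list \<Rightarrow> real" where
  "pat_law k xs = (if xs \<in> permutations_of_set {1..length xs}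
     then (if k = 0 then real (length xs + 1) * (1 - q) else 1) * ((1 - q) * pat_weight xs) else 0)"

text \<open>Split by the location \<open>- a\<close> of record value number 0. Given the patterns,
  \<open>a\<close> runs through \<open>0, ..., n0\<close>, and each choice has the same probability
  by \<open>prob_window\<close>.\<close>

lemma pat_joint_law:
  fixes N :: int
  assumes N: "0 \<le> N"
  shows "prob {\<omega>\<in>space M. \<forall>k\<in>{- N..N}. pat (perm \<omega>) k = xs k} = (\<Prod>k\<in>{- N..N}. pat_law k (xs k))"
proof (cases "\<forall>k\<in>{- N..N}. xs k \<in> permutations_of_set {1..length (xs k)}")
  case False
  then obtain k where k: "k \<in> {- N..N}" "xs k \<notin> permutations_of_set {1..length (xs k)}" by blast
  have "AE \<omega> in M. \<not> (\<forall>k\<in>{- N..N}. pat (perm \<omega>) k = xs k)"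
    using AE_regular
  proof eventually_elim
    case (elim \<omega>)
    then have reg: "regular (perm \<omega>)" by blast
    have "pat (perm \<omega>) k \<in> permutations_of_set {1..length (pat (perm \<omega>) k)}"
      using regularD(6)[OF reg, of k] length_pat[OF reg, of k] by simp
    then show ?case using k by metis
  qed
  then have "prob {\<omega>\<in>space M. \<forall>k\<in>{- N..N}. pat (perm \<omega>) k = xs k} = 0"
    by (subst prob_eq_0) auto
  moreover have "(\<Prod>k\<in>{- N..N}. pat_law k (xs k)) = 0"
    using k by (intro prod_zero bexI[of _ k]) (auto simp: pat_law_def)
  ultimately show ?thesis by simp
next
  case True
  define n0 where "n0 = length (xs 0)"
  let ?E = "\<lambda>a::nat. {\<omega>\<in>space M. (\<forall>k\<in>{- N..N}. pat (perm \<omega>) k = xs k) \<and> zeta (perm \<omega>) 0 = - int a}"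
  let ?Q = "(1 - q) * (\<Prod>k\<in>{- N..N}. (1 - q) * pat_weight (xs k))"
  have E: "prob (?E a) = ?Q" if "a \<le> n0" for a
  proof -
    let ?z = "zero_pos (- int a) (\<lambda>k. length (xs k))"
    have "prob (?E a) = prob {\<omega>\<in>space M. (\<forall>k\<in>{- N..N + 1}. rc (?z k) \<omega> = 0) \<and>
      (\<forall>k\<in>{- N..N}. coded (xs k) (\<lambda>x. rc (?z k + int x) \<omega>))}"
    proof (rule measure_eq_AE)
      show "AE \<omega> in M. (\<omega> \<in> ?E a) = (\<omega> \<in> {\<omega>\<in>space M. (\<forall>k\<in>{- N..N + 1}. rc (?z k) \<omega> = 0) \<and>
        (\<forall>k\<in>{- N..N}. coded (xs k) (\<lambda>x. rc (?z k + int x) \<omega>))})"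
        using AE_regular
      proof eventually_elim
        case (elim \<omega>)
        then have reg: "regular (perm \<omega>)" and c: "\<And>z. rc z \<omega> = rcode (perm \<omega>) z" by auto
        have "(\<forall>k\<in>{- N..N}. pat (perm \<omega>) k = xs k) \<and> zeta (perm \<omega>) 0 = - int a \<longleftrightarrow>
          (\<forall>k\<in>{- N..N + 1}. rc (?z k) \<omega> = 0) \<and> (\<forall>k\<in>{- N..N}. coded (xs k) (\<lambda>x. rc (?z k + int x) \<omega>))"
          unfolding c by (rule pat_event[OF reg N]) (use True that in \<open>auto simp: n0_def\<close>)
        then show ?case by (simp only: mem_Collect_eq)
      qed
      show "?E a \<in> events" by measurable
      show "{\<omega>\<in>space M. (\<forall>k\<in>{- N..N + 1}. rc (?z k) \<omega> = 0) \<and>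
        (\<forall>k\<in>{- N..N}. coded (xs k) (\<lambda>x. rc (?z k + int x) \<omega>))} \<in> events" by measurable
    qed
    also have "\<dots> = ?Q" by (rule prob_window) (use True N in auto)
    finally show ?thesis .
  qed
  have "prob {\<omega>\<in>space M. \<forall>k\<in>{- N..N}. pat (perm \<omega>) k = xs k} = prob (\<Union>a\<in>{..n0}. ?E a)"
  proof (rule measure_eq_AE)
    show "AE \<omega> in M. (\<omega> \<in> {\<omega>\<in>space M. \<forall>k\<in>{- N..N}. pat (perm \<omega>) k = xs k}) = (\<omega> \<in> (\<Union>a\<in>{..n0}. ?E a))"
      using AE_regular
    proof eventually_elim
      case (elim \<omega>)
      then have reg: "regular (perm \<omega>)" by blast
      have "\<exists>a\<in>{..n0}. zeta (perm \<omega>) 0 = - int a" if "\<forall>k\<in>{- N..N}. pat (perm \<omega>) k = xs k"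
      proof -
        have "pat (perm \<omega>) 0 = xs 0" using that N by simp
        then have "zeta (perm \<omega>) 1 = zeta (perm \<omega>) 0 + int n0 + 1"
          using length_pat[OF reg, of 0] by (simp add: n0_def)
        then show ?thesis
          using regularD(3,4)[OF reg] by (intro bexI[of _ "nat (- zeta (perm \<omega>) 0)"]) auto
      qed
      then show ?case by auto
    qed
    show "{\<omega>\<in>space M. \<forall>k\<in>{- N..N}. pat (perm \<omega>) k = xs k} \<in> events" by measurable
    show "(\<Union>a\<in>{..n0}. ?E a) \<in> events" by measurable
  qed
  also have "\<dots> = (\<Sum>a\<in>{..n0}. prob (?E a))"
    by (rule finite_measure_finite_Union) (auto simp: disjoint_family_on_def)
  also have "\<dots> = real (n0 + 1) * ?Q" using E by simp
  also have "\<dots> = (\<Prod>k\<in>{- N..N}. pat_law k (xs k))"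
  proof -
    have s: "(\<Prod>k\<in>{- N..N}. f k) = f 0 * (\<Prod>k\<in>{- N..N} - {0}. f k)" for f :: "int \<Rightarrow> real"
      by (rule prod.remove) (use N in auto)
    have "(\<Prod>k\<in>{- N..N} - {0}. pat_law k (xs k)) = (\<Prod>k\<in>{- N..N} - {0}. (1 - q) * pat_weight (xs k))"
      by (rule prod.cong) (use True in \<open>auto simp: pat_law_def\<close>)
    moreover have "pat_law 0 (xs 0) = real (n0 + 1) * (1 - q) * ((1 - q) * pat_weight (xs 0))"
      using True N by (simp add: pat_law_def n0_def)
    ultimately show ?thesis
      using s[of "\<lambda>k. pat_law k (xs k)"] s[of "\<lambda>k. (1 - q) * pat_weight (xs k)"] by (simp add: mult_ac)
  qed
  finally show ?thesis .
qed

end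

section \<open>Binary search trees and parts of the redwood tree\<close>

lemma finite_bst [simp]: "finite (bst xs)"
  by (induction xs rule: bst.induct) auto

lemma bst_bin_words: "bst xs \<subseteq> bin_words"
  by (induction xs rule: bst.induct) (auto simp: bin_words_def; blast)+

lemma is_bintree_bst: "is_bintree (bst xs)"
proof -
  have "\<forall>u v. u @ v \<in> bst xs \<longrightarrow> u \<in> bst xs"
  proof (induction xs rule: bst.induct)
    case (2 x xs)
    show ?case
    proof (intro allI impI)
      fix u v assume "u @ v \<in> bst (x # xs)"
      then show "u \<in> bst (x # xs)" using 2 by (cases u) auto
    qed
  qed simp
  then show ?thesis by (simp add: is_bintree_def bst_bin_words)
qed

lemma card_bst: "distinct xs \<Longrightarrow> card (bst xs) = length xs"
proof (induction xs rule: bst.induct)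
  case (2 x xs)
  let ?l = "filter (\<lambda>y. y < x) xs" and ?r = "filter (\<lambda>y. x < y) xs"
  have "bst (x # xs) = insert [] ((\<lambda>w. L0 # w) ` bst ?l \<union> (\<lambda>w. L1 # w) ` bst ?r)" by simp
  then have "card (bst (x # xs)) = Suc (card ((\<lambda>w. L0 # w) ` bst ?l \<union> (\<lambda>w. L1 # w) ` bst ?r))"
    by (simp only:) (subst card_insert_disjoint, auto)
  also have "card ((\<lambda>w. L0 # w) ` bst ?l \<union> (\<lambda>w. L1 # w) ` bst ?r) = length ?l + length ?r"
    using 2 by (subst card_Un_disjoint) (auto simp: card_image inj_on_def)
  also have "?r = filter (\<lambda>y. \<not> y < x) xs"
    by (rule filter_cong[OF refl]) (use 2(3) in \<open>auto simp: not_less le_less\<close>)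
  finally show ?case by (simp add: sum_length_filter_compl)
qed simp

lemma one_pow_L0: "L0 \<notin> set (one_pow k)"
  by (simp add: one_pow_def)

lemma one_pow_inj: "one_pow k = one_pow j \<Longrightarrow> k = j"
  by (auto simp: one_pow_def replicate_eq_replicate split: if_splits)

text \<open>The prefix contains no \<open>L0\<close>, so the first \<open>L0\<close> of a word marks
  where the prefix ends.\<close>

lemma one_pow_append_inj:
  assumes "one_pow k @ L0 # v = one_pow j @ L0 # w"
  shows "k = j" "v = w"
proof -
  have t: "takeWhile (\<lambda>x. x \<noteq> L0) (one_pow i @ L0 # u) = one_pow i" for i u
    using one_pow_L0[of i] by (subst takeWhile_append2) auto
  have "one_pow k = one_pow j" using t[of k v] t[of j w] assms by simp
  then show "k = j" by (rule one_pow_inj)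
  then show "v = w" using assms by simp
qed

abbreviation place :: "int \<Rightarrow> word set \<Rightarrow> word set" where
  "place k t \<equiv> (\<lambda>w. one_pow k @ L0 # w) ` t"

lemma place_inj: "place k t = place k t' \<longleftrightarrow> t = t'"
  by (rule inj_image_eq_iff) (auto simp: inj_def)

lemma card_place: "card (place k t) = card t"
  by (rule card_image) (auto simp: inj_on_def)

lemma Ypart_RW: "Ypart (RW \<sigma>) k = place k (bst (seg \<sigma> k))"
proof (intro set_eqI iffI)
  fix w assume "w \<in> Ypart (RW \<sigma>) k"
  then obtain v where v: "w \<in> RW \<sigma>" "v \<in> bin_words" "w = one_pow k @ L0 # v" by (auto simp: Ypart_def)
  have "w \<noteq> one_pow j" for j using v(3) one_pow_L0[of j] by (metis in_set_conv_decomp)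
  then obtain j u where "w = one_pow j @ L0 # u" "u \<in> bst (seg \<sigma> j)" using v(1) by (auto simp: RW_def)
  then show "w \<in> place k (bst (seg \<sigma> k))" using one_pow_append_inj[of k v j u] v(3) by auto
next
  fix w assume "w \<in> place k (bst (seg \<sigma> k))"
  then obtain v where "v \<in> bst (seg \<sigma> k)" "w = one_pow k @ L0 # v" by auto
  then show "w \<in> Ypart (RW \<sigma>) k" using bst_bin_words by (fastforce simp: Ypart_def RW_def)
qed

lemma RW_decompose: "RW \<sigma> = (\<Union>k. {one_pow k}) \<union> (\<Union>k. Ypart (RW \<sigma>) k)"
  unfolding Ypart_RW by (auto simp: RW_def)

section \<open>The laws of sizes and trees\<close>

context mallows_driver
begin

lemma Yq_conv: "Yq Z = (\<lambda>\<omega>. RW (perm \<omega>))"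
  by (simp add: Yq_def perm_def Bp_def[abs_def] Bm_def[abs_def] mv_def[abs_def] fun_eq_iff)

definition size_law :: "int \<Rightarrow> nat \<Rightarrow> real" where
  "size_law k n = (if k = 0 then real (n + 1) * (1 - q) else 1) * (q ^ n * (1 - q))"

lemma size_law_nonneg: "0 \<le> size_law k n"
  using q by (simp add: size_law_def)

lemma size_law_sum: "(\<integral>\<^sup>+n. ennreal (size_law k n) \<partial>count_space UNIV) = 1"
proof (cases "k = 0")
  case False
  then show ?thesis using nn_integral_geom[OF q] by (simp add: size_law_def)
next
  case True
  have "(\<lambda>n. real (Suc n) * q ^ n * (1 - q)\<^sup>2) sums (1 / (1 - q)\<^sup>2 * (1 - q)\<^sup>2)"
    using q geometric_deriv_sums[of q] by (intro sums_mult2) simp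
  then have "(\<lambda>n. size_law k n) sums 1"
    using q True by (simp add: size_law_def power2_eq_square mult_ac)
  then have "(\<Sum>n. ennreal (size_law k n)) = ennreal 1"
    using size_law_nonneg by (intro suminf_ennreal_eq)
  then show ?thesis by (simp add: nn_integral_count_space_nat)
qed

lemma pat_law_conv:
  assumes "xs \<in> permutations_of_set {1..n}"
  shows "length xs = n" "pat_law k xs = size_law k n * (q ^ linv xs / mallows_Z n q)"
proof -
  show len: "length xs = n"
    using permutations_of_setD[OF assms] distinct_card[of xs] by simp
  show "pat_law k xs = size_law k n * (q ^ linv xs / mallows_Z n q)"
    using assms len by (simp add: pat_law_def size_law_def pat_weight_def mult_ac)
qed

lemma pat_law_nonneg: "0 \<le> pat_law k xs"
  using q pat_weight_nonneg[of xs] by (simp add: pat_law_def)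

lemma mallows_total: "(\<Sum>xs\<in>permutations_of_set {1..n}. q ^ linv xs / mallows_Z n q) = 1"
  unfolding sum_divide_distrib[symmetric] mallows_Z_conv[symmetric]
  using mallows_Z_pos[OF q(1), of n] by simp

text \<open>Lists are grouped by the \<open>n\<close> for which they permute \<open>{1..n}\<close>;
  after interchanging the sums the Mallows weights add up to one and the size law remains.\<close>

lemma pat_law_sum: "(\<integral>\<^sup>+xs. ennreal (pat_law k xs) \<partial>count_space UNIV) = 1"
proof -
  let ?P = "\<lambda>n. permutations_of_set {1..n::nat}"
  let ?f = "\<lambda>n xs. if xs \<in> ?P n then ennreal (pat_law k xs) else 0"
  have "(\<integral>\<^sup>+xs. ennreal (pat_law k xs) \<partial>count_space UNIV) = (\<integral>\<^sup>+xs. \<integral>\<^sup>+n. ?f n xs \<partial>count_space UNIV \<partial>count_space UNIV)"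
  proof (rule nn_integral_cong)
    fix xs :: "nat list"
    have "(\<integral>\<^sup>+n. ?f n xs \<partial>count_space UNIV) = (\<Sum>n\<in>{length xs}. ?f n xs)"
      by (rule nn_integral_count_space') (auto dest: pat_law_conv(1)[unfolded One_nat_def])
    then show "ennreal (pat_law k xs) = (\<integral>\<^sup>+n. ?f n xs \<partial>count_space UNIV)"
      by (simp add: pat_law_def)
  qed
  also have "\<dots> = (\<integral>\<^sup>+n. \<integral>\<^sup>+xs. ?f n xs \<partial>count_space UNIV \<partial>count_space UNIV)"
    by (rule nn_integral_count_space_nn_integral) auto
  also have "\<dots> = (\<integral>\<^sup>+n. ennreal (size_law k n) \<partial>count_space UNIV)"
  proof (rule nn_integral_cong)
    fix n
    have "(\<integral>\<^sup>+xs. ?f n xs \<partial>count_space UNIV) = (\<Sum>xs\<in>?P n. ?f n xs)"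
      by (rule nn_integral_count_space') auto
    also have "\<dots> = (\<Sum>xs\<in>?P n. ennreal (size_law k n * (q ^ linv xs / mallows_Z n q)))"
      by (rule sum.cong) (auto simp: pat_law_conv(2))
    also have "\<dots> = ennreal (\<Sum>xs\<in>?P n. size_law k n * (q ^ linv xs / mallows_Z n q))"
      using q size_law_nonneg mallows_Z_pos[OF q(1), of n]
      by (intro sum_ennreal mult_nonneg_nonneg divide_nonneg_pos) auto
    also have "(\<Sum>xs\<in>?P n. size_law k n * (q ^ linv xs / mallows_Z n q)) = size_law k n"
      unfolding sum_distrib_left[symmetric] mallows_total by simp
    finally show "(\<integral>\<^sup>+xs. ?f n xs \<partial>count_space UNIV) = ennreal (size_law k n)" .
  qed
  finally show ?thesis by (simp add: size_law_sum)
qed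

lemma pat_indep: "indep_vars (\<lambda>_. count_space UNIV) (\<lambda>k \<omega>. pat (perm \<omega>) k) UNIV"
  and pat_marginal: "prob {\<omega>\<in>space M. pat (perm \<omega>) k = xs} = pat_law k xs"
proof -
  have joint: "\<exists>J'. finite J' \<and> J \<subseteq> J' \<and>
    (\<forall>x. prob {\<omega>\<in>space M. \<forall>i\<in>J'. pat (perm \<omega>) i = x i} = (\<Prod>i\<in>J'. pat_law i (x i)))"
    if J: "finite J" for J :: "int set"
  proof -
    define N where "N = Max (insert 0 (abs ` J))"
    have N0: "0 \<le> N" using J by (simp add: N_def)
    have le: "\<bar>i\<bar> \<le> N" if "i \<in> J" for i using J that by (simp add: N_def)
    have "J \<subseteq> {- N..N}"
    proof
      fix i assume "i \<in> J"
      then show "i \<in> {- N..N}" using le[of i] by auto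
    qed
    then show ?thesis using pat_joint_law[OF N0] by (intro exI[of _ "{- N..N}"]) auto
  qed
  note law = indep_vars_of_joint_law[where p = pat_law and X = "\<lambda>k \<omega>. pat (perm \<omega>) k",
      OF pat_measurable pat_law_nonneg pat_law_sum joint]
  show "indep_vars (\<lambda>_. count_space UNIV) (\<lambda>k \<omega>. pat (perm \<omega>) k) UNIV" by (rule law(1))
  show "prob {\<omega>\<in>space M. pat (perm \<omega>) k = xs} = pat_law k xs" by (rule law(2))
qed

lemma prob_pat_in:
  assumes "finite F"
  shows "prob {\<omega>\<in>space M. pat (perm \<omega>) k \<in> F} = (\<Sum>xs\<in>F. pat_law k xs)"
proof -
  have "{\<omega>\<in>space M. pat (perm \<omega>) k \<in> F} = (\<Union>xs\<in>F. {\<omega>\<in>space M. pat (perm \<omega>) k = xs})" by auto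
  also have "prob \<dots> = (\<Sum>xs\<in>F. prob {\<omega>\<in>space M. pat (perm \<omega>) k = xs})"
    by (rule finite_measure_finite_Union) (use assms in \<open>auto simp: disjoint_family_on_def\<close>)
  finally show ?thesis by (simp add: pat_marginal)
qed

lemma AE_pat:
  "AE \<omega> in M. \<forall>k. bst (seg (perm \<omega>) k) = bst (pat (perm \<omega>) k) \<and>
     pat (perm \<omega>) k \<in> permutations_of_set {1..length (pat (perm \<omega>) k)}"
  using AE_regular
proof eventually_elim
  case (elim \<omega>)
  then have reg: "regular (perm \<omega>)" by blast
  show ?case
  proof
    fix k
    have "nat (zeta (perm \<omega>) (k + 1) - zeta (perm \<omega>) k - 1) = length (pat (perm \<omega>) k)"
      using length_pat[OF reg, of k] by simp
    then show "bst (seg (perm \<omega>) k) = bst (pat (perm \<omega>) k) \<and>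
       pat (perm \<omega>) k \<in> permutations_of_set {1..length (pat (perm \<omega>) k)}"
      using regularD(6,8)[OF reg, of k] by simp
  qed
qed

lemma card_bst_perm: "xs \<in> permutations_of_set A \<Longrightarrow> card (bst xs) = length xs"
  by (rule card_bst) (rule permutations_of_setD)

lemma prob_length: "prob {\<omega>\<in>space M. length (pat (perm \<omega>) k) = n} = size_law k n"
proof -
  have "prob {\<omega>\<in>space M. length (pat (perm \<omega>) k) = n} = prob {\<omega>\<in>space M. pat (perm \<omega>) k \<in> permutations_of_set {1..n}}"
  proof (rule measure_eq_AE)
    show "AE \<omega> in M. (\<omega> \<in> {\<omega>\<in>space M. length (pat (perm \<omega>) k) = n}) =
      (\<omega> \<in> {\<omega>\<in>space M. pat (perm \<omega>) k \<in> permutations_of_set {1..n}})"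
      using AE_pat by eventually_elim (auto dest: pat_law_conv(1)[unfolded One_nat_def])
  qed measurable
  also have "\<dots> = (\<Sum>xs\<in>permutations_of_set {1..n}. size_law k n * (q ^ linv xs / mallows_Z n q))"
    unfolding prob_pat_in[OF finite_permutations_of_set] by (rule sum.cong[OF refl]) (rule pat_law_conv)
  also have "\<dots> = size_law k n" unfolding sum_distrib_left[symmetric] mallows_total by simp
  finally show ?thesis .
qed

lemma prob_tree:
  assumes "n = card t"
  shows "prob {\<omega>\<in>space M. bst (pat (perm \<omega>) k) = t} = size_law k n * mallows_bst_prob q n t"
proof -
  let ?F = "{xs. xs \<in> permutations_of_set {1..n} \<and> bst xs = t}"
  have F: "finite ?F" by (rule finite_subset[OF _ finite_permutations_of_set[of "{1..n}"]]) auto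
  have "prob {\<omega>\<in>space M. bst (pat (perm \<omega>) k) = t} = prob {\<omega>\<in>space M. pat (perm \<omega>) k \<in> ?F}"
  proof (rule measure_eq_AE)
    show "AE \<omega> in M. (\<omega> \<in> {\<omega>\<in>space M. bst (pat (perm \<omega>) k) = t}) = (\<omega> \<in> {\<omega>\<in>space M. pat (perm \<omega>) k \<in> ?F})"
      using AE_pat
    proof eventually_elim
      case (elim \<omega>)
      then have p: "pat (perm \<omega>) k \<in> permutations_of_set {1..length (pat (perm \<omega>) k)}" by blast
      show ?case using card_bst_perm[OF p] p assms by auto
    qed
  qed (use measurable_count_comp[OF pat_measurable, of "\<lambda>xs. bst xs = t" k] in \<open>measurable\<close>)
  also have "\<dots> = (\<Sum>xs\<in>?F. size_law k n * (q ^ linv xs / mallows_Z n q))"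
    unfolding prob_pat_in[OF F] by (rule sum.cong[OF refl]) (use pat_law_conv(2) in blast)
  also have "\<dots> = size_law k n * mallows_bst_prob q n t"
    unfolding mallows_bst_prob_conv sum_distrib_left ..
  finally show ?thesis .
qed

lemma prob_Ball_pat:
  assumes "finite J"
  shows "prob {\<omega>\<in>space M. \<forall>k\<in>J. pat (perm \<omega>) k \<in> A k} = (\<Prod>k\<in>J. prob {\<omega>\<in>space M. pat (perm \<omega>) k \<in> A k})"
  by (rule indep_vars_prob_Ball[OF pat_indep assms]) simp

lemma seg_tree_measurable [measurable]:
  "(\<lambda>\<omega>. h (seg (perm \<omega>) k)) \<in> measurable M (count_space UNIV)"
  by (rule measurable_count_comp[OF measurable_seg[OF perm_measurable]])

lemma pat_fun_measurable [measurable]: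
  "(\<lambda>\<omega>. h (pat (perm \<omega>) k)) \<in> measurable M (count_space UNIV)"
  by (rule measurable_count_comp[OF pat_measurable])

lemma card_Ypart: "card (Ypart (Yq Z \<omega>) k) = card (bst (seg (perm \<omega>) k))"
  by (simp add: Yq_conv Ypart_RW card_place)

lemma Ypart_eq_iff: "Ypart (Yq Z \<omega>) k = place k t \<longleftrightarrow> bst (seg (perm \<omega>) k) = t"
  by (simp add: Yq_conv Ypart_RW place_inj)

lemma card_marginal: "prob {\<omega>\<in>space M. card (Ypart (Yq Z \<omega>) k) = n} = size_law k n"
  and card_indep: "indep_vars (\<lambda>_. count_space UNIV) (\<lambda>k \<omega>. card (Ypart (Yq Z \<omega>) k)) UNIV"
proof -
  have meas: "(\<lambda>\<omega>. card (Ypart (Yq Z \<omega>) k)) \<in> measurable M (count_space UNIV)" for k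
    unfolding card_Ypart by measurable
  have joint: "prob {\<omega>\<in>space M. \<forall>k\<in>J. card (Ypart (Yq Z \<omega>) k) = x k} = (\<Prod>k\<in>J. size_law k (x k))"
    if J: "finite J" for J x
  proof -
    have "prob {\<omega>\<in>space M. \<forall>k\<in>J. card (Ypart (Yq Z \<omega>) k) = x k}
      = prob {\<omega>\<in>space M. \<forall>k\<in>J. pat (perm \<omega>) k \<in> {xs. length xs = x k}}"
    proof (rule measure_eq_AE)
      show "AE \<omega> in M. (\<omega> \<in> {\<omega>\<in>space M. \<forall>k\<in>J. card (Ypart (Yq Z \<omega>) k) = x k}) =
        (\<omega> \<in> {\<omega>\<in>space M. \<forall>k\<in>J. pat (perm \<omega>) k \<in> {xs. length xs = x k}})"
        using AE_pat
      proof eventually_elim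
        case (elim \<omega>)
        then have "card (Ypart (Yq Z \<omega>) k) = length (pat (perm \<omega>) k)" for k
          using card_bst_perm[of "pat (perm \<omega>) k"] unfolding card_Ypart by metis
        then show ?case by simp
      qed
      show "{\<omega>\<in>space M. \<forall>k\<in>J. card (Ypart (Yq Z \<omega>) k) = x k} \<in> events"
        unfolding card_Ypart using J by measurable
      show "{\<omega>\<in>space M. \<forall>k\<in>J. pat (perm \<omega>) k \<in> {xs. length xs = x k}} \<in> events"
        unfolding mem_Collect_eq using J by measurable
    qed
    also have "\<dots> = (\<Prod>k\<in>J. size_law k (x k))"
      unfolding prob_Ball_pat[OF J] by (simp add: prob_length)
    finally show ?thesis .
  qed
  then have ex: "\<exists>J'. finite J' \<and> J \<subseteq> J' \<and>
    (\<forall>x. prob {\<omega>\<in>space M. \<forall>i\<in>J'. card (Ypart (Yq Z \<omega>) i) = x i} = (\<Prod>i\<in>J'. size_law i (x i)))"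
    if "finite J" for J
    using that by blast
  note law = indep_vars_of_joint_law[where p = size_law and X = "\<lambda>k \<omega>. card (Ypart (Yq Z \<omega>) k)",
      OF meas size_law_nonneg size_law_sum ex]
  show "prob {\<omega>\<in>space M. card (Ypart (Yq Z \<omega>) k) = n} = size_law k n" by (rule law(2))
  show "indep_vars (\<lambda>_. count_space UNIV) (\<lambda>k \<omega>. card (Ypart (Yq Z \<omega>) k)) UNIV" by (rule law(1))
qed

text \<open>\<open>K\<close> and \<open>L\<close> may overlap, so the constraints at one index are
  merged into \<open>A k\<close> and \<open>B k\<close>. Independence of the patterns reduces the
  claim to one index, where inconsistent sizes make both sides zero.\<close>

lemma tree_joint_law:
  assumes K: "finite K" and L: "finite L"
  shows "prob {\<omega>\<in>space M. (\<forall>k\<in>K. Ypart (Yq Z \<omega>) k = place k (t k)) \<and> (\<forall>k\<in>L. card (Ypart (Yq Z \<omega>) k) = m k)}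
    = prob {\<omega>\<in>space M. (\<forall>k\<in>K. card (Ypart (Yq Z \<omega>) k) = card (t k)) \<and> (\<forall>k\<in>L. card (Ypart (Yq Z \<omega>) k) = m k)}
      * (\<Prod>k\<in>K. mallows_bst_prob q (card (t k)) (t k))"
proof -
  define A where "A k = {xs :: nat list. (k \<in> K \<longrightarrow> bst xs = t k) \<and> (k \<in> L \<longrightarrow> length xs = m k)}" for k
  define B where "B k = {xs :: nat list. (k \<in> K \<longrightarrow> length xs = card (t k)) \<and> (k \<in> L \<longrightarrow> length xs = m k)}" for k
  have fin: "finite (K \<union> L)" using K L by simp
  have 1: "prob {\<omega>\<in>space M. (\<forall>k\<in>K. Ypart (Yq Z \<omega>) k = place k (t k)) \<and> (\<forall>k\<in>L. card (Ypart (Yq Z \<omega>) k) = m k)}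
    = prob {\<omega>\<in>space M. \<forall>k\<in>K \<union> L. pat (perm \<omega>) k \<in> A k}"
  proof (rule measure_eq_AE)
    show "AE \<omega> in M. (\<omega> \<in> {\<omega>\<in>space M. (\<forall>k\<in>K. Ypart (Yq Z \<omega>) k = place k (t k)) \<and> (\<forall>k\<in>L. card (Ypart (Yq Z \<omega>) k) = m k)})
      = (\<omega> \<in> {\<omega>\<in>space M. \<forall>k\<in>K \<union> L. pat (perm \<omega>) k \<in> A k})"
      using AE_pat
    proof eventually_elim
      case (elim \<omega>)
      then have b: "bst (seg (perm \<omega>) k) = bst (pat (perm \<omega>) k)" "card (bst (pat (perm \<omega>) k)) = length (pat (perm \<omega>) k)" for k
        using card_bst_perm[of "pat (perm \<omega>) k"] by (blast, metis)
      show ?case unfolding mem_Collect_eq Ypart_eq_iff card_Ypart b A_def by blast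
    qed
    show "{\<omega>\<in>space M. (\<forall>k\<in>K. Ypart (Yq Z \<omega>) k = place k (t k)) \<and> (\<forall>k\<in>L. card (Ypart (Yq Z \<omega>) k) = m k)} \<in> events"
      unfolding Ypart_eq_iff card_Ypart using K L by measurable
    show "{\<omega>\<in>space M. \<forall>k\<in>K \<union> L. pat (perm \<omega>) k \<in> A k} \<in> events" using fin by measurable
  qed
  have 2: "prob {\<omega>\<in>space M. (\<forall>k\<in>K. card (Ypart (Yq Z \<omega>) k) = card (t k)) \<and> (\<forall>k\<in>L. card (Ypart (Yq Z \<omega>) k) = m k)}
    = prob {\<omega>\<in>space M. \<forall>k\<in>K \<union> L. pat (perm \<omega>) k \<in> B k}"
  proof (rule measure_eq_AE)
    show "AE \<omega> in M. (\<omega> \<in> {\<omega>\<in>space M. (\<forall>k\<in>K. card (Ypart (Yq Z \<omega>) k) = card (t k)) \<and> (\<forall>k\<in>L. card (Ypart (Yq Z \<omega>) k) = m k)})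
      = (\<omega> \<in> {\<omega>\<in>space M. \<forall>k\<in>K \<union> L. pat (perm \<omega>) k \<in> B k})"
      using AE_pat
    proof eventually_elim
      case (elim \<omega>)
      then have b: "bst (seg (perm \<omega>) k) = bst (pat (perm \<omega>) k)" "card (bst (pat (perm \<omega>) k)) = length (pat (perm \<omega>) k)" for k
        using card_bst_perm[of "pat (perm \<omega>) k"] by (blast, metis)
      show ?case unfolding mem_Collect_eq card_Ypart b B_def by blast
    qed
    show "{\<omega>\<in>space M. (\<forall>k\<in>K. card (Ypart (Yq Z \<omega>) k) = card (t k)) \<and> (\<forall>k\<in>L. card (Ypart (Yq Z \<omega>) k) = m k)} \<in> events"
      unfolding card_Ypart using K L by measurable
    show "{\<omega>\<in>space M. \<forall>k\<in>K \<union> L. pat (perm \<omega>) k \<in> B k} \<in> events" using fin by measurable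
  qed
  have AB: "prob {\<omega>\<in>space M. pat (perm \<omega>) k \<in> A k} = prob {\<omega>\<in>space M. pat (perm \<omega>) k \<in> B k} *
      (if k \<in> K then mallows_bst_prob q (card (t k)) (t k) else 1)" for k
  proof (cases "k \<in> K")
    case False
    then show ?thesis by (simp add: A_def B_def)
  next
    case True
    show ?thesis
    proof (cases "k \<in> L \<longrightarrow> m k = card (t k)")
      case ok: True
      then have "B k = {xs. length xs = card (t k)}" using True by (auto simp: B_def)
      moreover have "prob {\<omega>\<in>space M. pat (perm \<omega>) k \<in> A k} = prob {\<omega>\<in>space M. bst (pat (perm \<omega>) k) = t k}"
      proof (rule measure_eq_AE)
        show "AE \<omega> in M. (\<omega> \<in> {\<omega>\<in>space M. pat (perm \<omega>) k \<in> A k}) = (\<omega> \<in> {\<omega>\<in>space M. bst (pat (perm \<omega>) k) = t k})"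
          using AE_pat
        proof eventually_elim
          case (elim \<omega>)
          then have "card (bst (pat (perm \<omega>) k)) = length (pat (perm \<omega>) k)"
            using card_bst_perm[of "pat (perm \<omega>) k"] by metis
          then show ?case using True ok by (auto simp: A_def)
        qed
      qed measurable
      ultimately show ?thesis using True prob_tree[OF refl, of k "t k"] prob_length[of k "card (t k)"] by simp
    next
      case bad: False
      then have "B k = {}" using True by (auto simp: B_def)
      moreover have "prob {\<omega>\<in>space M. pat (perm \<omega>) k \<in> A k} = 0"
      proof -
        have "AE \<omega> in M. pat (perm \<omega>) k \<notin> A k"
          using AE_pat
        proof eventually_elim
          case (elim \<omega>)
          then have "card (bst (pat (perm \<omega>) k)) = length (pat (perm \<omega>) k)"
            using card_bst_perm[of "pat (perm \<omega>) k"] by metis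
          then show ?case using True bad by (auto simp: A_def)
        qed
        then show ?thesis by (subst prob_eq_0) auto
      qed
      ultimately show ?thesis by simp
    qed
  qed
  have "(\<Prod>k\<in>K \<union> L. if k \<in> K then mallows_bst_prob q (card (t k)) (t k) else 1) =
      (\<Prod>k\<in>K. mallows_bst_prob q (card (t k)) (t k))"
    using fin by (intro prod.mono_neutral_cong_right) auto
  then show ?thesis
    unfolding 1 2 prob_Ball_pat[OF fin] AB prod.distrib by simp
qed

lemma redwood_props_Yq: "redwood_props q M (Yq Z)"
  unfolding redwood_props_def
proof (intro conjI allI impI)
  show "Yq Z \<in> measurable M tree_space"
    unfolding Yq_conv by (rule measurable_RW[OF perm_measurable])
  show "indep_vars (\<lambda>_. count_space UNIV) (\<lambda>k \<omega>. card (Ypart (Yq Z \<omega>) k)) UNIV" by (rule card_indep)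
  show "prob {\<omega>\<in>space M. card (Ypart (Yq Z \<omega>) k) = n} = geom0_pmf (1 - q) n" if "k \<noteq> 0" for k n
    using that by (simp add: card_marginal size_law_def geom0_pmf_def)
  show "prob {\<omega>\<in>space M. card (Ypart (Yq Z \<omega>) 0) = n} = sbgeom_pmf (1 - q) n" for n
    by (simp add: card_marginal size_law_def sbgeom_pmf_def power2_eq_square mult_ac)
qed (rule tree_joint_law; blast)

end

section \<open>Uniqueness of the law\<close>

instance letter :: countable
  by countable_datatype

definition fin_trees :: "word set set" where
  "fin_trees = {t. is_bintree t \<and> finite t}"

lemma countable_fin_trees: "countable fin_trees"
  by (rule countable_subset[OF _ countable_Collect_finite]) (auto simp: fin_trees_def)

lemma sets_tree_space: "sets tree_space = sigma_sets UNIV (range (\<lambda>w::word. {S. w \<in> S}))"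
  and space_tree_space [simp]: "space tree_space = UNIV"
  by (simp_all add: tree_space_def sets_measure_of space_measure_of)

lemma pred_word_mem: "Measurable.pred tree_space (\<lambda>S. w \<in> S)"
  unfolding pred_def by (auto simp: sets_tree_space intro: sigma_sets.Basic)

lemma Ypart_measurable:
  assumes W: "W \<in> measurable N tree_space"
  shows "Measurable.pred N (\<lambda>\<omega>. Ypart (W \<omega>) k = X)"
proof -
  have [measurable]: "Measurable.pred N (\<lambda>\<omega>. w \<in> W \<omega>)" for w
    by (rule measurable_compose[OF W pred_word_mem])
  have "(\<lambda>\<omega>. Ypart (W \<omega>) k = X) =
    (\<lambda>\<omega>. \<forall>w. (w \<in> W \<omega> \<and> (\<exists>v\<in>bin_words. w = one_pow k @ L0 # v)) \<longleftrightarrow> w \<in> X)"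
    by (auto simp: Ypart_def fun_eq_iff)
  also have "Measurable.pred N \<dots>" by measurable
  finally show ?thesis .
qed

lemma subset_measurable:
  assumes W: "W \<in> measurable N tree_space"
  shows "Measurable.pred N (\<lambda>\<omega>. F \<subseteq> W \<omega>)"
proof -
  have [measurable]: "Measurable.pred N (\<lambda>\<omega>. w \<in> W \<omega>)" for w
    by (rule measurable_compose[OF W pred_word_mem])
  show ?thesis unfolding subset_eq Ball_def by measurable
qed

text \<open>Inclusion events of finite sets are closed under intersection, since \<open>F\<close>
  and \<open>G\<close> combine to their union, and they generate the sigma-algebra.\<close>

lemma tree_measure_eqI:
  assumes N: "prob_space N" "sets N = sets tree_space" and N': "prob_space N'" "sets N' = sets tree_space"
    and eq: "\<And>F. finite F \<Longrightarrow> emeasure N {S. F \<subseteq> S} = emeasure N' {S. F \<subseteq> S}"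
  shows "N = N'"
proof (rule measure_eqI_generator_eq)
  let ?E = "{{S. F \<subseteq> S} | F. finite (F :: word set)}"
  show "Int_stable ?E"
  proof (rule Int_stableI)
    fix a b assume "a \<in> ?E" "b \<in> ?E"
    then obtain F G where "finite F" "finite G" "a = {S. F \<subseteq> S}" "b = {S. G \<subseteq> S}" by auto
    then have "finite (F \<union> G)" "a \<inter> b = {S. F \<union> G \<subseteq> S}" by auto
    then show "a \<inter> b \<in> ?E" by blast
  qed
  have "sigma_sets UNIV ?E = sigma_sets UNIV (range (\<lambda>w::word. {S. w \<in> S}))"
  proof (rule sigma_sets_eqI)
    fix a assume "a \<in> ?E"
    then obtain F where F: "finite F" "a = {S. F \<subseteq> S}" by auto
    have "{S \<in> space tree_space. \<forall>w\<in>F. w \<in> S} \<in> sets tree_space"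
      by (rule sets.sets_Collect_finite_All[OF _ F(1)]) (use pred_word_mem in \<open>simp add: pred_def\<close>)
    then show "a \<in> sigma_sets UNIV (range (\<lambda>w::word. {S. w \<in> S}))"
      unfolding F(2) sets_tree_space subset_eq space_tree_space by (simp only: UNIV_I simp_thms)
  next
    fix b assume "b \<in> range (\<lambda>w::word. {S. w \<in> S})"
    then obtain w where "b = {S. {w} \<subseteq> S}" by auto
    then show "b \<in> sigma_sets UNIV ?E" by (intro sigma_sets.Basic) blast
  qed
  then show "sets N = sigma_sets UNIV ?E" "sets N' = sigma_sets UNIV ?E"
    using N N' by (simp_all add: sets_tree_space)
  show "range (\<lambda>_::nat. UNIV) \<subseteq> ?E" by (auto intro!: exI[of _ "{}"])
  interpret A: prob_space N by (rule N)
  show "emeasure N UNIV \<noteq> \<infinity>" for i :: nat by simp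
  show "emeasure N X = emeasure N' X" if "X \<in> ?E" for X using that eq by auto
qed auto

section \<open>Inclusion events in terms of finitely many parts\<close>

definition word_part :: "word set \<Rightarrow> int \<Rightarrow> word set" where
  "word_part F k = {w\<in>F. \<exists>v\<in>bin_words. w = one_pow k @ L0 # v}"

definition word_keys :: "word set \<Rightarrow> int set" where
  "word_keys F = {k. word_part F k \<noteq> {}}"

definition admissible_words :: "word set \<Rightarrow> bool" where
  "admissible_words F \<longleftrightarrow> (\<forall>w\<in>F. (\<exists>k. w = one_pow k) \<or> (\<exists>k. \<exists>v\<in>bin_words. w = one_pow k @ L0 # v))"

lemma finite_word_keys:
  assumes "finite F"
  shows "finite (word_keys F)"
proof -
  have "word_keys F = (\<Union>w\<in>F. {k. \<exists>v\<in>bin_words. w = one_pow k @ L0 # v})"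
    by (auto simp: word_keys_def word_part_def)
  moreover have "finite {k. \<exists>v\<in>bin_words. w = one_pow k @ L0 # v}" for w
  proof (cases "\<exists>k. \<exists>v\<in>bin_words. w = one_pow k @ L0 # v")
    case True
    then obtain j u where "w = one_pow j @ L0 # u" by blast
    then have "{k. \<exists>v\<in>bin_words. w = one_pow k @ L0 # v} \<subseteq> {j}" using one_pow_append_inj(1) by blast
    then show ?thesis by (rule finite_subset) simp
  next
    case False
    then have "{k. \<exists>v\<in>bin_words. w = one_pow k @ L0 # v} = {}" by blast
    then show ?thesis by simp
  qed
  ultimately show ?thesis using assms by simp
qed

text \<open>The words \<open>one_pow k\<close> belong to every such tree and inadmissible words to
  none, so only the parts meeting \<open>F\<close> decide.\<close>

lemma subset_redwood_iff:
  assumes S: "S = (\<Union>k. {one_pow k}) \<union> (\<Union>k. Ypart S k)"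
  shows "F \<subseteq> S \<longleftrightarrow> admissible_words F \<and> (\<forall>k\<in>word_keys F. word_part F k \<subseteq> Ypart S k)"
proof
  assume F: "F \<subseteq> S"
  have "admissible_words F" unfolding admissible_words_def
  proof
    fix w assume "w \<in> F"
    then have "w \<in> (\<Union>k. {one_pow k}) \<union> (\<Union>k. Ypart S k)" using F S by blast
    then show "(\<exists>k. w = one_pow k) \<or> (\<exists>k. \<exists>v\<in>bin_words. w = one_pow k @ L0 # v)"
      unfolding Ypart_def by blast
  qed
  then show "admissible_words F \<and> (\<forall>k\<in>word_keys F. word_part F k \<subseteq> Ypart S k)"
    using F by (auto simp: word_part_def Ypart_def)
next
  assume a: "admissible_words F \<and> (\<forall>k\<in>word_keys F. word_part F k \<subseteq> Ypart S k)"
  show "F \<subseteq> S"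
  proof
    fix w assume w: "w \<in> F"
    then consider k where "w = one_pow k" | k where "w \<in> word_part F k"
      using a unfolding admissible_words_def word_part_def by blast
    then show "w \<in> S"
    proof cases
      case 1
      then show ?thesis by (subst S) blast
    next
      case 2
      then have "k \<in> word_keys F" by (auto simp: word_keys_def)
      then have "w \<in> Ypart S k" using a 2 by blast
      then show ?thesis by (simp add: Ypart_def)
    qed
  qed
qed

text \<open>The conditional tree law with an empty second index set, followed by independence of the
  sizes. The value depends on \<open>q\<close> and the trees only.\<close>

lemma redwood_props_joint:
  assumes N: "prob_space N" and props: "redwood_props q N W" and K: "finite K"
    and t: "\<And>k. k \<in> K \<Longrightarrow> t k \<in> fin_trees"
  shows "measure N {\<omega>\<in>space N. \<forall>k\<in>K. Ypart (W \<omega>) k = place k (t k)} =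
    (\<Prod>k\<in>K. (if k = 0 then sbgeom_pmf (1 - q) (card (t k)) else geom0_pmf (1 - q) (card (t k))) *
       mallows_bst_prob q (card (t k)) (t k))"
proof -
  interpret N: prob_space N by (rule N)
  have ind: "N.indep_vars (\<lambda>_. count_space UNIV) (\<lambda>k \<omega>. card (Ypart (W \<omega>) k)) UNIV"
    and law: "\<And>k n. k \<noteq> 0 \<Longrightarrow> measure N {\<omega>\<in>space N. card (Ypart (W \<omega>) k) = n} = geom0_pmf (1 - q) n"
      "\<And>n. measure N {\<omega>\<in>space N. card (Ypart (W \<omega>) 0) = n} = sbgeom_pmf (1 - q) n"
    and cond: "\<And>(K :: int set) (L :: int set) (t :: int \<Rightarrow> word set) (m :: int \<Rightarrow> nat).
        finite K \<and> finite L \<and> (\<forall>k \<in> K. is_bintree (t k) \<and> finite (t k)) \<Longrightarrow>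
        measure N {\<omega> \<in> space N. (\<forall>k \<in> K. Ypart (W \<omega>) k = place k (t k)) \<and> (\<forall>k \<in> L. card (Ypart (W \<omega>) k) = m k)}
        = measure N {\<omega> \<in> space N. (\<forall>k \<in> K. card (Ypart (W \<omega>) k) = card (t k)) \<and> (\<forall>k \<in> L. card (Ypart (W \<omega>) k) = m k)}
          * (\<Prod>k \<in> K. mallows_bst_prob q (card (t k)) (t k))"
    using props unfolding redwood_props_def by blast+
  have "measure N {\<omega>\<in>space N. \<forall>k\<in>K. Ypart (W \<omega>) k = place k (t k)} =
    measure N {\<omega>\<in>space N. \<forall>k\<in>K. card (Ypart (W \<omega>) k) \<in> {card (t k)}} * (\<Prod>k\<in>K. mallows_bst_prob q (card (t k)) (t k))"
    using cond[of K "{}" t] K t by (simp add: fin_trees_def)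
  also have "measure N {\<omega>\<in>space N. \<forall>k\<in>K. card (Ypart (W \<omega>) k) \<in> {card (t k)}} =
    (\<Prod>k\<in>K. measure N {\<omega>\<in>space N. card (Ypart (W \<omega>) k) \<in> {card (t k)}})"
    by (rule N.indep_vars_prob_Ball[OF ind K]) simp
  also have "\<dots> = (\<Prod>k\<in>K. if k = 0 then sbgeom_pmf (1 - q) (card (t k)) else geom0_pmf (1 - q) (card (t k)))"
    by (rule prod.cong) (auto simp: law)
  finally show ?thesis by (simp add: prod.distrib)
qed

definition tree_families :: "int set \<Rightarrow> (int \<Rightarrow> word set) set" where
  "tree_families K = (\<Pi>\<^sub>E k\<in>K. fin_trees)"

lemma countable_tree_families: "finite K \<Longrightarrow> countable (tree_families K)"
  unfolding tree_families_def by (rule countable_PiE) (simp_all add: countable_fin_trees)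

text \<open>The integral mentions neither the measure nor the process, so it serves to compare two
  processes with the same properties.\<close>

lemma emeasure_tree_families:
  assumes N: "prob_space N" and props: "redwood_props q N W" and K: "finite K"
    and \<Theta>: "\<Theta> \<subseteq> tree_families K"
  shows "(\<Union>\<tau>\<in>\<Theta>. {\<omega>\<in>space N. \<forall>k\<in>K. Ypart (W \<omega>) k = place k (\<tau> k)}) \<in> sets N"
    and "emeasure N (\<Union>\<tau>\<in>\<Theta>. {\<omega>\<in>space N. \<forall>k\<in>K. Ypart (W \<omega>) k = place k (\<tau> k)}) =
    (\<integral>\<^sup>+\<tau>. ennreal (\<Prod>k\<in>K. (if k = 0 then sbgeom_pmf (1 - q) (card (\<tau> k)) else geom0_pmf (1 - q) (card (\<tau> k))) *
       mallows_bst_prob q (card (\<tau> k)) (\<tau> k)) \<partial>count_space \<Theta>)"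
proof -
  interpret N: prob_space N by (rule N)
  let ?E = "\<lambda>\<tau>. {\<omega>\<in>space N. \<forall>k\<in>K. Ypart (W \<omega>) k = place k (\<tau> k)}"
  have W: "W \<in> measurable N tree_space" using props by (simp add: redwood_props_def)
  have E: "?E \<tau> \<in> sets N" for \<tau>
    by (rule sets.sets_Collect_finite_All[OF _ K]) (use Ypart_measurable[OF W] in \<open>simp add: pred_def\<close>)
  have c: "countable \<Theta>" using countable_subset[OF \<Theta> countable_tree_families[OF K]] .
  show "(\<Union>\<tau>\<in>\<Theta>. ?E \<tau>) \<in> sets N" by (rule sets.countable_UN''[OF c]) (rule E)
  have "disjoint_family_on ?E \<Theta>"
    unfolding disjoint_family_on_def
  proof (intro ballI impI equals0I)
    fix \<tau> \<tau>' \<omega> assume t: "\<tau> \<in> \<Theta>" "\<tau>' \<in> \<Theta>" "\<tau> \<noteq> \<tau>'" and w: "\<omega> \<in> ?E \<tau> \<inter> ?E \<tau>'"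
    then have "place k (\<tau> k) = place k (\<tau>' k)" if "k \<in> K" for k using that by auto
    then have "\<tau> k = \<tau>' k" if "k \<in> K" for k using that by (simp add: place_inj)
    then have "\<tau> = \<tau>'"
      using t(1,2) \<Theta> unfolding tree_families_def by (meson PiE_ext subsetD)
    then show False using t by simp
  qed
  then have "emeasure N (\<Union>\<tau>\<in>\<Theta>. ?E \<tau>) = (\<integral>\<^sup>+\<tau>. emeasure N (?E \<tau>) \<partial>count_space \<Theta>)"
    by (intro emeasure_UN_countable E c)
  also have "\<dots> = (\<integral>\<^sup>+\<tau>. ennreal (\<Prod>k\<in>K. (if k = 0 then sbgeom_pmf (1 - q) (card (\<tau> k)) else geom0_pmf (1 - q) (card (\<tau> k))) *
       mallows_bst_prob q (card (\<tau> k)) (\<tau> k)) \<partial>count_space \<Theta>)"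
  proof (rule nn_integral_cong)
    fix \<tau> assume "\<tau> \<in> space (count_space \<Theta>)"
    then have "\<tau> \<in> tree_families K" using \<Theta> by auto
    then have "\<tau> k \<in> fin_trees" if "k \<in> K" for k using that by (auto simp: tree_families_def)
    from redwood_props_joint[OF N props K this]
    show "emeasure N (?E \<tau>) = ennreal (\<Prod>k\<in>K. (if k = 0 then sbgeom_pmf (1 - q) (card (\<tau> k)) else geom0_pmf (1 - q) (card (\<tau> k))) *
       mallows_bst_prob q (card (\<tau> k)) (\<tau> k))"
      by (simp add: N.emeasure_eq_measure)
  qed
  finally show "emeasure N (\<Union>\<tau>\<in>\<Theta>. ?E \<tau>) =
    (\<integral>\<^sup>+\<tau>. ennreal (\<Prod>k\<in>K. (if k = 0 then sbgeom_pmf (1 - q) (card (\<tau> k)) else geom0_pmf (1 - q) (card (\<tau> k))) *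
       mallows_bst_prob q (card (\<tau> k)) (\<tau> k)) \<partial>count_space \<Theta>)" .
qed

text \<open>The parts of \<open>Y\<close> are finite trees everywhere, so the weights of the tree families sum to one
  and the parts of \<open>W\<close> are almost surely finite trees as well.\<close>

lemma redwood_law_unique:
  fixes M :: "'a measure" and N :: "'b measure"
  assumes M: "prob_space M" and N: "prob_space N"
    and pY: "redwood_props q M Y" and pW: "redwood_props q N W"
    and Y: "\<And>\<omega>. \<omega> \<in> space M \<Longrightarrow> Y \<omega> = (\<Union>k. {one_pow k}) \<union> (\<Union>k. Ypart (Y \<omega>) k)"
    and Yfin: "\<And>\<omega> k. \<omega> \<in> space M \<Longrightarrow> \<exists>t\<in>fin_trees. Ypart (Y \<omega>) k = place k t"
    and W: "\<And>\<omega>. \<omega> \<in> space N \<Longrightarrow> W \<omega> = (\<Union>k. {one_pow k}) \<union> (\<Union>k. Ypart (W \<omega>) k)"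
  shows "distr N tree_space W = distr M tree_space Y"
proof -
  interpret M: prob_space M by (rule M)
  interpret N: prob_space N by (rule N)
  have mY: "Y \<in> measurable M tree_space" and mW: "W \<in> measurable N tree_space"
    using pY pW by (auto simp: redwood_props_def)
  show ?thesis
  proof (rule tree_measure_eqI)
    show "prob_space (distr N tree_space W)" "prob_space (distr M tree_space Y)"
      by (rule N.prob_space_distr[OF mW], rule M.prob_space_distr[OF mY])
    fix F :: "word set" assume F: "finite F"
    have set_F: "{S. F \<subseteq> S} \<in> sets tree_space"
      using subset_measurable[OF measurable_ident, of F] by (simp add: pred_def id_def)
    have eW: "emeasure (distr N tree_space W) {S. F \<subseteq> S} = emeasure N {\<omega>\<in>space N. F \<subseteq> W \<omega>}"
      by (subst emeasure_distr[OF mW set_F]) (auto intro!: arg_cong2[where f = emeasure])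
    have eY: "emeasure (distr M tree_space Y) {S. F \<subseteq> S} = emeasure M {\<omega>\<in>space M. F \<subseteq> Y \<omega>}"
      by (subst emeasure_distr[OF mY set_F]) (auto intro!: arg_cong2[where f = emeasure])
    show "emeasure (distr N tree_space W) {S. F \<subseteq> S} = emeasure (distr M tree_space Y) {S. F \<subseteq> S}"
    proof (cases "admissible_words F")
      case False
      then have "{\<omega>\<in>space N. F \<subseteq> W \<omega>} = {}" "{\<omega>\<in>space M. F \<subseteq> Y \<omega>} = {}"
        using subset_redwood_iff[OF W, of _ F] subset_redwood_iff[OF Y, of _ F] by auto
      then show ?thesis unfolding eW eY by (simp only: emeasure_empty)
    next
      case adm: True
      define K where "K = word_keys F"
      have K: "finite K" unfolding K_def by (rule finite_word_keys[OF F])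
      let ?EM = "\<lambda>\<tau>. {\<omega>\<in>space M. \<forall>k\<in>K. Ypart (Y \<omega>) k = place k (\<tau> k)}"
      let ?EN = "\<lambda>\<tau>. {\<omega>\<in>space N. \<forall>k\<in>K. Ypart (W \<omega>) k = place k (\<tau> k)}"
      define \<Theta> where "\<Theta> = {\<tau>\<in>tree_families K. \<forall>k\<in>K. word_part F k \<subseteq> place k (\<tau> k)}"
      have sub: "\<Theta> \<subseteq> tree_families K" by (auto simp: \<Theta>_def)
      have famM: "\<exists>\<tau>\<in>tree_families K. \<omega> \<in> ?EM \<tau>" if w: "\<omega> \<in> space M" for \<omega>
      proof -
        obtain t where t: "\<And>k. t k \<in> fin_trees" "\<And>k. Ypart (Y \<omega>) k = place k (t k)"
          using Yfin[OF w] by metis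
        have "restrict t K \<in> tree_families K" using t by (auto simp: tree_families_def)
        moreover have "\<omega> \<in> ?EM (restrict t K)" using w t by simp
        ultimately show ?thesis by blast
      qed
      have "(\<Union>\<tau>\<in>tree_families K. ?EM \<tau>) = space M"
        using famM by blast
      \<comment> \<open>The same sum gives the mass of the finite-tree families for
        \<open>Y\<close>, where it is everything, and for \<open>W\<close>. So the parts of
        \<open>W\<close> with index in \<open>K\<close> are almost surely finite trees.\<close>
      then have "emeasure N (\<Union>\<tau>\<in>tree_families K. ?EN \<tau>) = 1"
        unfolding emeasure_tree_families(2)[OF N pW K order_refl]
          emeasure_tree_families(2)[OF M pY K order_refl, symmetric]
        by (simp only: M.emeasure_space_1)
      then have AE: "AE \<omega> in N. \<omega> \<in> (\<Union>\<tau>\<in>tree_families K. ?EN \<tau>)"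
        unfolding N.AE_in_set_eq_1[OF emeasure_tree_families(1)[OF N pW K order_refl]]
        by (simp only: N.emeasure_eq_measure ennreal_eq_1)
      have "emeasure N {\<omega>\<in>space N. F \<subseteq> W \<omega>} = emeasure N (\<Union>\<tau>\<in>\<Theta>. ?EN \<tau>)"
      proof (rule emeasure_eq_AE)
        show "AE \<omega> in N. (\<omega> \<in> {\<omega>\<in>space N. F \<subseteq> W \<omega>}) = (\<omega> \<in> (\<Union>\<tau>\<in>\<Theta>. ?EN \<tau>))"
          using AE
        proof eventually_elim
          case (elim \<omega>)
          then obtain \<tau> where \<tau>: "\<tau> \<in> tree_families K" "\<omega> \<in> ?EN \<tau>" by blast
          then have w: "\<omega> \<in> space N" "\<And>k. k \<in> K \<Longrightarrow> Ypart (W \<omega>) k = place k (\<tau> k)" by auto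
          have iff: "F \<subseteq> W \<omega> \<longleftrightarrow> (\<forall>k\<in>K. word_part F k \<subseteq> Ypart (W \<omega>) k)"
            using subset_redwood_iff[OF W[OF w(1)], of F] adm by (simp add: K_def)
          show ?case
          proof
            assume "\<omega> \<in> {\<omega>\<in>space N. F \<subseteq> W \<omega>}"
            then have "\<tau> \<in> \<Theta>" using iff w \<tau> by (auto simp: \<Theta>_def)
            then show "\<omega> \<in> (\<Union>\<tau>\<in>\<Theta>. ?EN \<tau>)" using \<tau> by blast
          next
            assume "\<omega> \<in> (\<Union>\<tau>\<in>\<Theta>. ?EN \<tau>)"
            then obtain \<tau>' where "\<tau>' \<in> \<Theta>" "\<omega> \<in> ?EN \<tau>'" by blast
            then have "\<forall>k\<in>K. word_part F k \<subseteq> Ypart (W \<omega>) k" by (simp add: \<Theta>_def)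
            then show "\<omega> \<in> {\<omega>\<in>space N. F \<subseteq> W \<omega>}" using iff w(1) by simp
          qed
        qed
        show "{\<omega>\<in>space N. F \<subseteq> W \<omega>} \<in> sets N"
          using subset_measurable[OF mW, of F] by (simp add: pred_def)
        show "(\<Union>\<tau>\<in>\<Theta>. ?EN \<tau>) \<in> sets N" by (rule emeasure_tree_families(1)[OF N pW K sub])
      qed
      moreover have "{\<omega>\<in>space M. F \<subseteq> Y \<omega>} = (\<Union>\<tau>\<in>\<Theta>. ?EM \<tau>)"
      proof (intro set_eqI iffI)
        fix \<omega> assume w: "\<omega> \<in> {\<omega>\<in>space M. F \<subseteq> Y \<omega>}"
        then obtain \<tau> where \<tau>: "\<tau> \<in> tree_families K" "\<omega> \<in> ?EM \<tau>" using famM by blast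
        have "\<forall>k\<in>K. word_part F k \<subseteq> Ypart (Y \<omega>) k"
          using subset_redwood_iff[OF Y, of \<omega> F] w by (simp add: K_def)
        then have "\<tau> \<in> \<Theta>" using \<tau> by (simp add: \<Theta>_def)
        then show "\<omega> \<in> (\<Union>\<tau>\<in>\<Theta>. ?EM \<tau>)" using \<tau> by blast
      next
        fix \<omega> assume "\<omega> \<in> (\<Union>\<tau>\<in>\<Theta>. ?EM \<tau>)"
        then obtain \<tau> where t: "\<tau> \<in> \<Theta>" "\<omega> \<in> ?EM \<tau>" by blast
        then have "\<forall>k\<in>K. word_part F k \<subseteq> Ypart (Y \<omega>) k" by (simp add: \<Theta>_def)
        then show "\<omega> \<in> {\<omega>\<in>space M. F \<subseteq> Y \<omega>}"
          using subset_redwood_iff[OF Y, of \<omega> F] adm t by (simp add: K_def)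
      qed
      ultimately show ?thesis
        unfolding eW eY
        by (simp only: emeasure_tree_families(2)[OF N pW K sub] emeasure_tree_families(2)[OF M pY K sub])
    qed
  qed simp_all
qed

text \<open>The properties constrain only the parts \<open>Ypart\<close>. The decomposition required
  of \<open>W\<close> settles the other words: every \<open>one_pow k\<close> occurs, and nothing
  outside the parts besides these.\<close>

theorem theorem1p2:
  fixes q :: real and M :: "'a measure" and Z :: "drv_idx \<Rightarrow> 'a \<Rightarrow> nat"
  assumes q: "0 \<le> q" "q < 1"
    and P: "prob_space M"
    and indep: "prob_space.indep_vars M (\<lambda>_. count_space UNIV) Z drv_index_set"
    and lawBP: "\<And>i j. 1 \<le> i \<Longrightarrow> 1 \<le> j \<Longrightarrow>
        measure M {\<omega> \<in> space M. Z (BP i j) \<omega> = 1} = 1 - q \<and> measure M {\<omega> \<in> space M. Z (BP i j) \<omega> = 0} = q"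
    and lawBM: "\<And>i j. 1 \<le> i \<Longrightarrow> 1 \<le> j \<Longrightarrow>
        measure M {\<omega> \<in> space M. Z (BM i j) \<omega> = 1} = 1 - q \<and> measure M {\<omega> \<in> space M. Z (BM i j) \<omega> = 0} = q"
    and lawMV: "\<And>i m. 1 \<le> i \<Longrightarrow> measure M {\<omega> \<in> space M. Z (MV i) \<omega> = m} = q ^ (i * m) * (1 - q ^ i)"
  shows "redwood_props q M (Yq Z) \<and>
    (\<forall>(N :: 'b measure) (W :: 'b \<Rightarrow> word set).
       prob_space N \<and> (\<forall>\<omega> \<in> space N. W \<omega> = (\<Union>k. {one_pow k}) \<union> (\<Union>k. Ypart (W \<omega>) k))
       \<and> redwood_props q N W
       \<longrightarrow> distr N tree_space W = distr M tree_space (Yq Z))"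
proof -
  interpret prob_space M by (rule P)
  interpret mallows_driver M q Z
    using q indep lawBP lawBM lawMV by unfold_locales auto
  have fin: "\<exists>t\<in>fin_trees. Ypart (Yq Z \<omega>) k = place k t" for \<omega> k
    unfolding Yq_conv Ypart_RW
    by (rule bexI[of _ "bst (seg (perm \<omega>) k)"]) (simp_all add: fin_trees_def is_bintree_bst)
  have dec: "Yq Z \<omega> = (\<Union>k. {one_pow k}) \<union> (\<Union>k. Ypart (Yq Z \<omega>) k)" for \<omega>
    unfolding Yq_conv by (rule RW_decompose)
  show ?thesis
  proof (intro conjI allI impI)
    show props: "redwood_props q M (Yq Z)" by (rule redwood_props_Yq)
    fix N :: "'b measure" and W :: "'b \<Rightarrow> word set"
    assume "prob_space N \<and> (\<forall>\<omega>\<in>space N. W \<omega> = (\<Union>k. {one_pow k}) \<union> (\<Union>k. Ypart (W \<omega>) k)) \<and>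
      redwood_props q N W"
    then have "prob_space N" "redwood_props q N W"
      "\<And>\<omega>. \<omega> \<in> space N \<Longrightarrow> W \<omega> = (\<Union>k. {one_pow k}) \<union> (\<Union>k. Ypart (W \<omega>) k)" by blast+
    then show "distr N tree_space W = distr M tree_space (Yq Z)"
      by (intro redwood_law_unique[OF P _ props _ dec fin])
  qed
qed

end
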